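(* Let $F_{\mu}$, $\mu=(\mu_1,\mu_2,\mu_3)\in\mathbb R^3$, be a smooth ($C^\infty$ or analytic) family of area-preserving maps with a fixed point of elliptic type at the origin, such that $F_{\mathbf{0}}$ has a resonant (of order $n$) elliptic fixed point at the origin, and let its Hamiltonian in Takens normal form be $$H_\mu (z, \bar z)=\sum_{k+l+m \ge 3,\ k\equiv l\ (\mathrm{mod}\ n)}h_{klm}(\mu_1, \mu_2)z^k\bar z^l\varepsilon^m ,$$ which in symplectic polar coordinates reads $$H_\mu (I,\varphi )=\varepsilon I +I^2\sum_{k,m \ge 0}a_{km}(\mu_1, \mu_2)I^k\varepsilon^m+\sum_{j \ge 1,\ k,m \ge 0}a_{jkm}(\mu_1, \mu_2)I^{k+jn/2}\varepsilon^m\cos (jn\varphi +\psi_{jkm}(\mu_1, \mu_2)).$$ Assume $a_{00}(0,0)\ne 0$ (that is, $h_{220}(0,0)\neq0$). Assume moreover that $h_{n00}(0,0)=0$, that $h_{n+1,1,0}^2(0,0)-4h_{220}(0,0)h_{2n,0,0}(0,0)\ne 0$, and that the parameters $\mu$ can be expressed in terms of $\Upsilon=(\varepsilon,\nu_1,\nu_2)$, where $\varepsilon=\alpha_0-\alpha_\mu$ and $$\nu_1+i\nu_2=\nu=\gamma e^{i\beta}=h_{n00} (\mu_1, \mu_2)\exp \left( -\frac{i}{2}\arg \left( h_{2n,0,0}(\mu_1, \mu_2)-\frac{h_{n+1,1,0}^2(\mu_1, \mu_2)}{4h_{220}(\mu_1, \mu_2)} \right) \right).$$ Then there are a formal Hamiltonian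 $\widetilde H_{\Upsilon}$ and a formal canonical change of variables which conjugates $F_\mu$ with $R_{\alpha_0}\circ\Phi^1_{\widetilde H_{\Upsilon}}$. Moreover, $\widetilde H_{\Upsilon}$ has the form $$\widetilde H_{\Upsilon}(I, \varphi )=\varepsilon I+2\gamma I^{n/2} \cos (n\varphi +\beta )+I^{2}\sum_{k,|\mathbf{m}|\ge0} \tilde a_{k\mathbf{m}} I^k \Upsilon^{\mathbf{m}}+ I^{n/2}\sum_{\substack {k+m_1\ge 1, \\ k,m_1,m_2,m_3\ge 0}}c_{k\mathbf{m}}I^{kn/2}\Upsilon^{\mathbf{m}}\cos ((k+1)n\varphi+\psi_{k\mathbf{m}}),$$ with real coefficients $\tilde a_{k\mathbf m},c_{k\mathbf m},\psi_{k\mathbf m}$.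
   Context: Area-preserving maps of $\mathbb R^2$ (near the origin) preserve area and orientation and here fix the origin. The fixed point is elliptic: the eigenvalues of $DF_\mu(0)$ are non-real, $\lambda_\mu=e^{i\alpha_\mu}$ and $\bar\lambda_\mu$. Resonance of order $n$ at $\mu=\mathbf 0$: $n$ is the least positive integer with $\lambda_0^n=1$ (so $n\ge3$). $R_\alpha$ is the rotation of the plane by angle $\alpha$. Complex variables: $z=(x+iy)/\sqrt2$, $\bar z=(x-iy)/\sqrt2$. Symplectic polar coordinates: $z=\sqrt I e^{i\varphi}$, $\bar z=\sqrt I e^{-i\varphi}$. Formal series in $(I,\varphi)$ are formal power series in $(z,\bar z)$ rewritten in these coordinates. For a real-valued formal Hamiltonian $H$, $\Phi^t_H$ is the (formal) Hamiltonian flow of $H$, with equation $\dot z=-i\,\partial H/\partial\bar z$. A formal canonical change of variables is an invertible formal power series change of $(z,\bar z)$, fixing the origin and depending formally on the parameters, that preserves the area form. Takens normal form (TNF) of the family: put $\varepsilon=\alpha_0-\alpha_\mu$ and assume $\mu_3$ is expressed through $(\varepsilon,\mu_1,\mu_2)$. By a linear change of coordinates and a formal canonical (parameter-dependent) change of coordinates, the family is brought to Birkhoff normal form, i.e. its first component is $\lambda_0z+\sum_{k+l+m\ge2,\,k-l\equiv1\ (\mathrm{mod}\ n)}f_{klm}(\mu_1,\mu_2)z^k\bar z^l\varepsilon^m$, and in these coordinates it equals $R_{\alpha_0}\circ\Phi^1_{H_\mu}$ with a formal Hamiltonian $H_\mu(z,\bar z)=\sum_{k+l+m \ge 3,\ k\equiv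 l\ (\mathrm{mod}\ n)}h_{klm}(\mu_1, \mu_2)z^k\bar z^l\varepsilon^m$, $h_{klm}=\overline{h_{lkm}}$, whose only term in $z\bar z\,\varepsilon^m$ is $\varepsilon z\bar z$ (i.e. $h_{111}=1$ and $h_{11m}=0$ for $m\neq1$). Multi-index notation: $\mathbf m=(m_1,m_2,m_3)$ with non-negative integer entries, $|\mathbf m|=m_1+m_2+m_3$, $\Upsilon^{\mathbf m}=\varepsilon^{m_1}\nu_1^{m_2}\nu_2^{m_3}$. *)

theory Defs
  imports
    "HOL-Analysis.Analysis"
    "HOL-Computational_Algebra.Formal_Power_Series"
    "HOL-Number_Theory.Cong"
begin

section \<open>Smooth functions and their partial derivatives\<close>

definition dir_deriv ::
    "'a::euclidean_space \<Rightarrow> ('a \<Rightarrow> 'b::real_normed_vector) \<Rightarrow> 'a \<Rightarrow> 'b" where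
  "dir_deriv v f = (\<lambda>x. frechet_derivative f (at x) v)"

fun Ck_on :: "nat \<Rightarrow> ('a::euclidean_space \<Rightarrow> 'b::real_normed_vector) \<Rightarrow> 'a set \<Rightarrow> bool" where
  "Ck_on 0 f S \<longleftrightarrow> continuous_on S f"
| "Ck_on (Suc k) f S \<longleftrightarrow>
     (\<forall>x\<in>S. f differentiable (at x)) \<and> (\<forall>v. Ck_on k (dir_deriv v f) S)"

definition smooth_near_0 :: "('a::euclidean_space \<Rightarrow> 'b::real_normed_vector) \<Rightarrow> bool" where
  "smooth_near_0 f \<longleftrightarrow> (\<exists>S. open S \<and> 0 \<in> S \<and> (\<forall>k. Ck_on k f S))"

text \<open>\<open>P\<close> is a smooth local change of parameters at the origin, with inverse \<open>Q\<close>; that is,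
  the old parameters \<open>\<mu>\<close> are expressed through the new ones \<open>P \<mu>\<close> by \<open>\<mu> = Q (P \<mu>)\<close>.\<close>

definition param_change ::
    "('a::euclidean_space \<Rightarrow> 'b::euclidean_space) \<Rightarrow> ('b \<Rightarrow> 'a) \<Rightarrow> bool" where
  "param_change P Q \<longleftrightarrow>
     P 0 = 0 \<and> Q 0 = 0 \<and> smooth_near_0 P \<and> smooth_near_0 Q \<and>
     (\<forall>\<^sub>F x in nhds 0. Q (P x) = x) \<and> (\<forall>\<^sub>F y in nhds 0. P (Q y) = y)"


section \<open>Families of area-preserving maps\<close>

text \<open>The parameters range over \<open>real \<times> real \<times> real\<close>, the phase plane is \<open>real^2\<close>.\<close>

type_synonym params = "real \<times> real \<times> real"

definition jacobian :: "(real^2 \<Rightarrow> real^2) \<Rightarrow> real^2 \<Rightarrow> real^2^2" where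
  "jacobian f x = matrix (frechet_derivative f (at x))"

definition complex_eigenvalue :: "real^2^2 \<Rightarrow> complex \<Rightarrow> bool" where
  "complex_eigenvalue A c \<longleftrightarrow>
     (\<exists>v::complex^2. v \<noteq> 0 \<and> (\<chi> i j. complex_of_real (A $ i $ j)) *v v = c *s v)"

text \<open>Determinant \<open>1\<close> (rather than \<open>\<plusminus>1\<close>): area and orientation are preserved.\<close>

definition area_preserving_family :: "(params \<Rightarrow> real^2 \<Rightarrow> real^2) \<Rightarrow> bool" where
  "area_preserving_family F \<longleftrightarrow>
     smooth_near_0 (\<lambda>(\<mu>, x). F \<mu> x) \<and>
     (\<forall>\<^sub>F (\<mu>, x) in nhds 0. det (jacobian (F \<mu>) x) = 1)"

text \<open>Since \<open>D F\<^sub>\<mu>(0)\<close> is real, its second eigenvalue is the conjugate of \<open>exp (\<i> \<alpha>\<^sub>\<mu>)\<close>.\<close>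

definition elliptic_at_0 :: "(params \<Rightarrow> real^2 \<Rightarrow> real^2) \<Rightarrow> (params \<Rightarrow> real) \<Rightarrow> bool" where
  "elliptic_at_0 F \<alpha> \<longleftrightarrow>
     (\<forall>\<^sub>F \<mu> in nhds 0. F \<mu> 0 = 0 \<and>
        complex_eigenvalue (jacobian (F \<mu>) 0) (cis (\<alpha> \<mu>)) \<and> cis (\<alpha> \<mu>) \<notin> \<real>)"

definition resonant_of_order :: "nat \<Rightarrow> complex \<Rightarrow> bool" where
  "resonant_of_order n c \<longleftrightarrow> 0 < n \<and> c ^ n = 1 \<and> (\<forall>k. 0 < k \<and> k < n \<longrightarrow> c ^ k \<noteq> 1)"


section \<open>Formal series in \<open>z\<close> and its conjugate, depending formally on three parameters\<close>

text \<open>A \<open>formal_series\<close> is a power series in \<open>z\<close> (outermost) and \<open>zbar\<close>, whose coefficients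
  are power series in three parameters, the first parameter being outermost.\<close>

type_synonym param_series = "complex fps fps fps"
type_synonym formal_series = "param_series fps fps"

abbreviation mk_param :: "(nat \<Rightarrow> nat \<Rightarrow> nat \<Rightarrow> complex) \<Rightarrow> param_series" where
  "mk_param c \<equiv> Abs_fps (\<lambda>m1. Abs_fps (\<lambda>m2. Abs_fps (\<lambda>m3. c m1 m2 m3)))"

abbreviation mk_series :: "(nat \<Rightarrow> nat \<Rightarrow> param_series) \<Rightarrow> formal_series" where
  "mk_series c \<equiv> Abs_fps (\<lambda>k. Abs_fps (\<lambda>l. c k l))"

abbreviation pcoeff :: "param_series \<Rightarrow> nat \<Rightarrow> nat \<Rightarrow> nat \<Rightarrow> complex" where
  "pcoeff c m1 m2 m3 \<equiv> fps_nth (fps_nth (fps_nth c m1) m2) m3"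

abbreviation zcoeff :: "formal_series \<Rightarrow> nat \<Rightarrow> nat \<Rightarrow> param_series" where
  "zcoeff f k l \<equiv> fps_nth (fps_nth f k) l"

definition const_series :: "complex \<Rightarrow> formal_series" where
  "const_series c = fps_const (fps_const (fps_const (fps_const (fps_const c))))"

definition param_monom :: "nat \<Rightarrow> nat \<Rightarrow> nat \<Rightarrow> formal_series" where
  "param_monom m1 m2 m3 =
     fps_const (fps_const (fps_X ^ m1 * fps_const (fps_X ^ m2 * fps_const (fps_X ^ m3))))"

definition Z :: formal_series where "Z = fps_X"

definition Zbar :: formal_series where "Zbar = fps_const fps_X"

definition deriv_z :: "formal_series \<Rightarrow> formal_series" where
  "deriv_z f = fps_deriv f"

definition deriv_zbar :: "formal_series \<Rightarrow> formal_series" where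
  "deriv_zbar f = Abs_fps (\<lambda>k. fps_deriv (fps_nth f k))"

text \<open>Complex conjugation with real parameters; it exchanges \<open>z\<close> and \<open>zbar\<close>.\<close>

definition cnj_series :: "formal_series \<Rightarrow> formal_series" where
  "cnj_series f = mk_series (\<lambda>k l. mk_param (\<lambda>m1 m2 m3. cnj (pcoeff (zcoeff f l k) m1 m2 m3)))"

definition real_series :: "formal_series \<Rightarrow> bool" where
  "real_series f \<longleftrightarrow> cnj_series f = f"

text \<open>A formal map of the plane fixing the origin for all parameters is given by its first
  component \<open>u\<close>, a series without term of degree \<open>0\<close> in \<open>z, zbar\<close>; its second component is
  \<open>cnj_series u\<close>. In \<open>compose_series f u\<close> the series \<open>u\<close> and \<open>cnj_series u\<close> are substituted for \<open>z\<close> and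
  \<open>zbar\<close>. If \<open>u\<close> fixes the origin, only terms of \<open>f\<close> of degree at most \<open>a + b\<close> contribute to
  the coefficient of \<open>z^a zbar^b\<close>.\<close>

definition fixes_origin :: "formal_series \<Rightarrow> bool" where
  "fixes_origin u \<longleftrightarrow> zcoeff u 0 0 = 0"

definition compose_series :: "formal_series \<Rightarrow> formal_series \<Rightarrow> formal_series" where
  "compose_series f u = mk_series (\<lambda>a b.
     \<Sum>k\<le>a + b. \<Sum>l\<le>a + b. zcoeff f k l * zcoeff (u ^ k * cnj_series u ^ l) a b)"

text \<open>The area form is a constant multiple of \<open>dz \<and> dzbar\<close>, so it is preserved iff the Jacobian
  determinant with respect to \<open>(z, zbar)\<close> equals \<open>1\<close>.\<close>

definition canonical_change :: "formal_series \<Rightarrow> bool" where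
  "canonical_change u \<longleftrightarrow>
     fixes_origin u \<and>
     (\<exists>w. fixes_origin w \<and> compose_series u w = Z \<and> compose_series w u = Z) \<and>
     deriv_z u * deriv_zbar (cnj_series u) - deriv_zbar u * deriv_z (cnj_series u) = 1"

definition conjugates :: "formal_series \<Rightarrow> formal_series \<Rightarrow> formal_series \<Rightarrow> bool" where
  "conjugates u f g \<longleftrightarrow> compose_series u f = compose_series g u"

text \<open>\<open>rotate_map a u\<close> is the composition of the rotation by the angle \<open>a\<close> with the map \<open>u\<close>.\<close>

definition rotate_map :: "real \<Rightarrow> formal_series \<Rightarrow> formal_series" where
  "rotate_map a u = const_series (cis a) * u"

text \<open>\<open>\<Phi> t\<close> is the formal time-\<open>t\<close> map of the Hamiltonian \<open>H\<close>: coefficientwise, it solves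
  \<open>dz/dt = -\<i> \<partial>H/\<partial>zbar\<close> with \<open>\<Phi> 0\<close> the identity.\<close>

definition ham_flow :: "formal_series \<Rightarrow> (real \<Rightarrow> formal_series) \<Rightarrow> bool" where
  "ham_flow H \<Phi> \<longleftrightarrow>
     \<Phi> 0 = Z \<and> (\<forall>t. fixes_origin (\<Phi> t)) \<and>
     (\<forall>t k l m1 m2 m3.
        ((\<lambda>s. pcoeff (zcoeff (\<Phi> s) k l) m1 m2 m3) has_vector_derivative
           - \<i> * pcoeff (zcoeff (compose_series (deriv_zbar H) (\<Phi> t)) k l) m1 m2 m3) (at t))"

text \<open>Coefficientwise sum of a locally finite family of series.\<close>

definition series_sum :: "('i \<Rightarrow> formal_series) \<Rightarrow> 'i set \<Rightarrow> formal_series" where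
  "series_sum f A = mk_series (\<lambda>k l. mk_param (\<lambda>m1 m2 m3.
     \<Sum>i\<in>{i\<in>A. pcoeff (zcoeff (f i) k l) m1 m2 m3 \<noteq> 0}. pcoeff (zcoeff (f i) k l) m1 m2 m3))"

text \<open>Symplectic polar coordinates \<open>z = sqrt I exp (\<i> \<phi>)\<close>: \<open>I = z zbar\<close>, and
  \<open>I^(p/2) exp (\<i> q \<phi>) = z^((p+q)/2) zbar^((p-q)/2)\<close> if \<open>q \<le> p\<close> and \<open>p - q\<close> is even. Under these
  conditions \<open>I_cos p q \<psi>\<close> is \<open>I^(p/2) cos (q \<phi> + \<psi>)\<close>.\<close>

definition I_pow :: "nat \<Rightarrow> formal_series" where
  "I_pow k = (Z * Zbar) ^ k"

definition I_cos :: "nat \<Rightarrow> nat \<Rightarrow> real \<Rightarrow> formal_series" where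
  "I_cos p q \<psi> =
     const_series (cis \<psi> / 2) * Z ^ ((p + q) div 2) * Zbar ^ ((p - q) div 2) +
     const_series (cis (- \<psi>) / 2) * Z ^ ((p - q) div 2) * Zbar ^ ((p + q) div 2)"


section \<open>Taylor series\<close>

definition z_of :: "real^2 \<Rightarrow> complex" where
  "z_of x = Complex (x $ 1) (x $ 2) / sqrt 2"

text \<open>Partial derivatives with respect to \<open>z = (x + \<i> y)/sqrt 2\<close> and \<open>zbar = (x - \<i> y)/sqrt 2\<close>.\<close>

definition wirtinger_z :: "(params \<times> (real^2) \<Rightarrow> complex) \<Rightarrow> params \<times> (real^2) \<Rightarrow> complex" where
  "wirtinger_z f =
     (\<lambda>w. (dir_deriv (0, axis 1 1) f w - \<i> * dir_deriv (0, axis 2 1) f w) / sqrt 2)"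

definition wirtinger_zbar :: "(params \<times> (real^2) \<Rightarrow> complex) \<Rightarrow> params \<times> (real^2) \<Rightarrow> complex" where
  "wirtinger_zbar f =
     (\<lambda>w. (dir_deriv (0, axis 1 1) f w + \<i> * dir_deriv (0, axis 2 1) f w) / sqrt 2)"

definition taylor_series :: "(params \<times> (real^2) \<Rightarrow> complex) \<Rightarrow> formal_series" where
  "taylor_series f = mk_series (\<lambda>k l. mk_param (\<lambda>m1 m2 m3.
     (wirtinger_z ^^ k) ((wirtinger_zbar ^^ l)
       ((dir_deriv ((1, 0, 0), 0) ^^ m1) ((dir_deriv ((0, 1, 0), 0) ^^ m2)
         ((dir_deriv ((0, 0, 1), 0) ^^ m3) f)))) 0
     / (fact k * fact l * fact m1 * fact m2 * fact m3)))"

text \<open>First component of the Taylor series, in \<open>z, zbar\<close> and the parameters, of a family of maps.\<close>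

definition map_series :: "(params \<Rightarrow> real^2 \<Rightarrow> real^2) \<Rightarrow> formal_series" where
  "map_series F = taylor_series (\<lambda>(\<mu>, x). z_of (F \<mu> x))"

definition taylor_series2 :: "(real \<times> real \<Rightarrow> complex) \<Rightarrow> complex fps fps" where
  "taylor_series2 f = Abs_fps (\<lambda>i. Abs_fps (\<lambda>j.
     (dir_deriv (1, 0) ^^ i) ((dir_deriv (0, 1) ^^ j) f) 0 / (fact i * fact j)))"


section \<open>Takens normal form\<close>

text \<open>The coefficients \<open>h k l m\<close> are smooth functions of \<open>(\<mu>\<^sub>1, \<mu>\<^sub>2)\<close>. The formal Hamiltonian is a
  series with parameters \<open>(\<epsilon>, \<mu>\<^sub>1, \<mu>\<^sub>2)\<close>, in this order.\<close>

type_synonym ham_coeffs = "nat \<Rightarrow> nat \<Rightarrow> nat \<Rightarrow> real \<times> real \<Rightarrow> complex"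

definition takens_coeffs :: "nat \<Rightarrow> ham_coeffs \<Rightarrow> bool" where
  "takens_coeffs n h \<longleftrightarrow>
     (\<forall>k l m. smooth_near_0 (h k l m)) \<and>
     (\<forall>k l m. \<forall>\<^sub>F \<mu> in nhds 0.
        (\<not> (3 \<le> k + l + m \<and> [k = l] (mod n)) \<longrightarrow> h k l m \<mu> = 0) \<and>
        h k l m \<mu> = cnj (h l k m \<mu>) \<and>
        h 1 1 m \<mu> = (if m = 1 then 1 else 0))"

definition takens_ham :: "ham_coeffs \<Rightarrow> formal_series" where
  "takens_ham h = mk_series (\<lambda>k l. Abs_fps (\<lambda>m. taylor_series2 (h k l m)))"

text \<open>Birkhoff normal form: \<open>c z\<close> plus terms \<open>z^k zbar^l \<epsilon>^m\<close> with \<open>k + l + m \<ge> 2\<close> and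
  \<open>k - l \<equiv> 1 (mod n)\<close>; here \<open>\<epsilon>\<close> is the first parameter.\<close>

definition birkhoff_normal_form :: "nat \<Rightarrow> complex \<Rightarrow> formal_series \<Rightarrow> bool" where
  "birkhoff_normal_form n c f \<longleftrightarrow>
     fps_nth (zcoeff f 1 0) 0 = fps_const (fps_const c) \<and>
     (\<forall>k l m. (k, l, m) \<noteq> (1, 0, 0) \<and> \<not> (2 \<le> k + l + m \<and> [k = l + 1] (mod n)) \<longrightarrow>
        fps_nth (zcoeff f k l) m = 0)"

text \<open>\<open>h\<close> gives the Hamiltonian in Takens normal form of a family with Taylor series \<open>f\<close>, whose
  parameters are \<open>(\<epsilon>, \<mu>\<^sub>1, \<mu>\<^sub>2)\<close>. The preliminary linear change of coordinates is the linear
  part of the formal canonical change \<open>u\<close>.\<close>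

definition takens_normal_form :: "nat \<Rightarrow> real \<Rightarrow> formal_series \<Rightarrow> ham_coeffs \<Rightarrow> bool" where
  "takens_normal_form n a f h \<longleftrightarrow>
     takens_coeffs n h \<and>
     (\<exists>\<Phi> u. ham_flow (takens_ham h) \<Phi> \<and> canonical_change u \<and>
        conjugates u f (rotate_map a (\<Phi> 1)) \<and>
        birkhoff_normal_form n (cis a) (rotate_map a (\<Phi> 1)))"

definition resonance_discriminant :: "nat \<Rightarrow> ham_coeffs \<Rightarrow> real \<times> real \<Rightarrow> complex" where
  "resonance_discriminant n h \<mu> = h (2 * n) 0 0 \<mu> - (h (n + 1) 1 0 \<mu>)\<^sup>2 / (4 * h 2 2 0 \<mu>)"

text \<open>A smooth branch of \<open>arg\<close> along \<open>g\<close> near the origin. The principal value \<open>Arg\<close> is not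
  suitable, since it may jump near the origin (if \<open>g 0\<close> is a negative real).\<close>

definition arg_branch :: "(real \<times> real \<Rightarrow> complex) \<Rightarrow> (real \<times> real \<Rightarrow> real) \<Rightarrow> bool" where
  "arg_branch g \<theta> \<longleftrightarrow>
     smooth_near_0 \<theta> \<and> (\<forall>\<^sub>F \<mu> in nhds 0. g \<mu> = of_real (cmod (g \<mu>)) * cis (\<theta> \<mu>))"

text \<open>In series with parameters \<open>(\<epsilon>, \<nu>\<^sub>1, \<nu>\<^sub>2)\<close> and with \<open>\<nu>\<^sub>1 + \<i> \<nu>\<^sub>2 = \<gamma> exp (\<i> \<beta>)\<close>, the term
  \<open>2 \<gamma> I^(n/2) cos (n \<phi> + \<beta>)\<close> is \<open>(\<nu>\<^sub>1 + \<i> \<nu>\<^sub>2) z^n + (\<nu>\<^sub>1 - \<i> \<nu>\<^sub>2) zbar^n\<close>.\<close>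

definition leading_resonant_term :: "nat \<Rightarrow> formal_series" where
  "leading_resonant_term n =
     (param_monom 0 1 0 + const_series \<i> * param_monom 0 0 1) * Z ^ n +
     (param_monom 0 1 0 - const_series \<i> * param_monom 0 0 1) * Zbar ^ n"

end

(*
  A canonical change of variables v transports a formal flow of H to a formal flow of
  H o v^(-1), so no flow has to be constructed: it suffices to substitute the new parameters in
  the Takens normal form and to normalize the Hamiltonian by canonical changes that commute with
  the rotation.

  A rotation by -theta/(2n), a function of the parameters, turns the coefficient of z^n into
  nu_1 + i nu_2 modulo epsilon. Then give z and zbar weight 1 and each parameter weight 3. Since
  h_n00 vanishes at the origin, h_220 z^2 zbar^2 is the only term of weight less than 5, and
  {z^2 zbar^2, z^k zbar^l} = 2 (l - k) z^(k+1) zbar^(l+1). Hence a Lie transform removes all terms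
  divisible by z zbar except the powers of z zbar. Its generators only contain terms z^k zbar^l
  with k and l congruent modulo n but different; therefore the coefficient of z zbar does not
  change and that of z^n changes only by multiples of epsilon.

  That Taylor series turn a smooth change of parameters into formal substitution is proved by
  induction on the order: the defects of this property for f have derivatives that are
  combinations of the defects for the derivatives of f.
*)

theory Submission
  imports Defs
begin

section \<open>Coefficients, weights and derivations of formal series\<close>

text \<open>Why weight 3: epsilon z zbar has to lie strictly above z^2 zbar^2, and 3 is the smallest
  integer weight of a parameter that achieves this. For n = 3, 4 the monomial z^n would compete with
  the quartic term, but without its constant coefficient it moves up too. Bracketing with z^2 zbar^2
  yields only multiples of z zbar, with the divisor l - k. Hence exactly two kinds of terms resist:
  the powers of z zbar, where the divisor vanishes, and the pure powers of z or zbar, which are not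
  in the image. These are the two sums of the final form. Normalization takes infinitely many steps.
  No infinite product of canonical maps is formed: one generator depending on an auxiliary time s is
  used, whose s-coefficients are found weight by weight, so that a single automorphism has to be
  studied and inverted. Takens normal form admits terms free of z and zbar; they do not act on the
  flow and are discarded before normalizing. Identities between operations on series are checked on
  monomials and extended by additivity and continuity.\<close>

type_synonym expo = "nat \<times> nat \<times> nat \<times> nat \<times> nat"

text \<open>One exponent tuple replaces five nested indices, so that weights mixing z, zbar and the
  parameters are easy to compare.\<close>

definition cf :: "formal_series \<Rightarrow> expo \<Rightarrow> complex" where
  "cf f = (\<lambda>(k, l, a, b, c). pcoeff (zcoeff f k l) a b c)"

lemma cf_simp: "cf f (k, l, a, b, c) = pcoeff (zcoeff f k l) a b c"
  by (simp add: cf_def)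

lemma cf_eqI: "(\<And>e. cf f e = cf g e) \<Longrightarrow> f = g"
  unfolding fps_eq_iff by (metis cf_simp)

lemma cf_add [simp]: "cf (f + g) e = cf f e + cf g e"
  by (cases e) (simp add: cf_def)

lemma cf_diff [simp]: "cf (f - g) e = cf f e - cf g e"
  by (cases e) (simp add: cf_def)

lemma cf_uminus [simp]: "cf (- f) e = - cf f e"
  by (cases e) (simp add: cf_def)

lemma cf_0 [simp]: "cf 0 e = 0"
  by (cases e) (simp add: cf_def)

lemma cf_sum [simp]: "cf (sum f A) e = (\<Sum>i\<in>A. cf (f i) e)"
  by (induction A rule: infinite_finite_induct) auto

lemma cf_mult: "cf (f * g) (k, l, a, b, c) =
  (\<Sum>i\<le>k. \<Sum>j\<le>l. \<Sum>p\<le>a. \<Sum>q\<le>b. \<Sum>r\<le>c. cf f (i, j, p, q, r) * cf g (k - i, l - j, a - p, b - q, c - r))"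
  by (simp add: cf_def fps_mult_nth fps_sum_nth atLeast0AtMost)

lemma cf_mk: "cf (mk_series (\<lambda>k l. mk_param (\<lambda>a b c. F k l a b c))) (k, l, a, b, c) = F k l a b c"
  by (simp add: cf_def)

lemma cf_const_mult [simp]: "cf (const_series c * f) e = c * cf f e"
  by (cases e) (simp add: cf_def const_series_def)

lemma const_series_mult: "const_series (a * b) = const_series a * const_series b"
  by (simp add: const_series_def)

lemma const_series_add: "const_series (a + b) = const_series a + const_series b"
  by (simp add: const_series_def)

lemma const_series_1 [simp]: "const_series 1 = 1"
  by (simp add: const_series_def)

lemma const_series_0 [simp]: "const_series 0 = 0"
  by (simp add: const_series_def)

lemma const_series_minus: "const_series (- a) = - const_series a"
  by (metis add.inverse_unique add.right_inverse const_series_0 const_series_add)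

definition monom_series :: "complex \<Rightarrow> expo \<Rightarrow> formal_series" where
  "monom_series c = (\<lambda>(k, l, p, q, r). const_series c * (Z ^ k * Zbar ^ l * param_monom p q r))"

lemma Zbar_power: "Zbar ^ l = fps_const (fps_X ^ l)"
  by (simp add: Zbar_def fps_const_power)

lemma cf_mono: "cf (monom_series c e) e' = (if e = e' then c else 0)"
proof (cases e)
  case (fields k l p q r)
  then show ?thesis
    by (cases e') (auto simp: monom_series_def cf_simp const_series_def Z_def Zbar_power param_monom_def
      mult.assoc fps_X_power_mult_nth)
qed

lemma param_monom_mult: "param_monom a b c * param_monom a' b' c' = param_monom (a + a') (b + b') (c
    + c')"
  by (simp add: param_monom_def power_add ac_simps flip: fps_const_mult)

lemma param_monom_0 [simp]: "param_monom 0 0 0 = 1"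
  by (simp add: param_monom_def)

lemma mono_mult: "monom_series c e * monom_series c' e' = monom_series (c * c') (e + e')"
proof (cases e; cases e')
  fix k l p q r k' l' p' q' r'
  assume e: "e = (k, l, p, q, r)" "e' = (k', l', p', q', r')"
  show ?thesis
    unfolding e by (simp add: monom_series_def power_add const_series_mult ac_simps flip:
        param_monom_mult)
qed

text \<open>Each parameter has weight \<open>p\<close>: \<open>p = 0\<close> measures the order at the origin of the plane, \<open>p = 1\<close>
  gives the topology of formal series, and \<open>p = 3\<close> is the grading used for the normal form.\<close>

fun wt :: "nat \<Rightarrow> expo \<Rightarrow> nat" where
  "wt p (k, l, a, b, c) = k + l + p * (a + b + c)"

lemma wt_add: "wt p (e + e') = wt p e + wt p e'"
  by (cases e; cases e') (simp add: algebra_simps)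

lemma monom_series_0: "monom_series 1 (0, 0, 0, 0, 0) = 1"
  by (simp add: monom_series_def)

lemma cf_1: "cf 1 e = (if e = (0, 0, 0, 0, 0) then 1 else 0)"
  using cf_mono[of 1 "(0, 0, 0, 0, 0)" e] by (auto simp: monom_series_0)

text \<open>For fixed \<open>p\<close> these are ideals forming a decreasing filtration. Only 0 lies
  in all of them, which is how estimates become equalities.\<close>

definition Fil :: "nat \<Rightarrow> nat \<Rightarrow> formal_series set" where
  "Fil p N = {f. \<forall>e. wt p e < N \<longrightarrow> cf f e = 0}"

lemma FilD: "f \<in> Fil p N \<Longrightarrow> wt p e < N \<Longrightarrow> cf f e = 0"
  unfolding Fil_def by blast

lemma FilI: "(\<And>e. wt p e < N \<Longrightarrow> cf f e = 0) \<Longrightarrow> f \<in> Fil p N"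
  by (simp add: Fil_def)

lemma Fil_0 [simp]: "f \<in> Fil p 0" by (simp add: Fil_def)

lemma zero_Fil [simp]: "0 \<in> Fil p N" by (simp add: Fil_def)

lemma Fil_add: "f \<in> Fil p N \<Longrightarrow> g \<in> Fil p N \<Longrightarrow> f + g \<in> Fil p N"
  by (simp add: Fil_def)

lemma Fil_diff: "f \<in> Fil p N \<Longrightarrow> g \<in> Fil p N \<Longrightarrow> f - g \<in> Fil p N"
  by (simp add: Fil_def)

lemma Fil_uminus: "f \<in> Fil p N \<Longrightarrow> - f \<in> Fil p N"
  by (simp add: Fil_def)

lemma Fil_sum: "(\<And>i. i \<in> A \<Longrightarrow> f i \<in> Fil p N) \<Longrightarrow> sum f A \<in> Fil p N"
  by (simp add: Fil_def)

lemma Fil_const: "f \<in> Fil p N \<Longrightarrow> const_series c * f \<in> Fil p N"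
  by (simp add: Fil_def)

lemma Fil_mono: "f \<in> Fil p N \<Longrightarrow> M \<le> N \<Longrightarrow> f \<in> Fil p M"
  by (simp add: Fil_def)

lemma Fil_eqI: "(\<And>N. f - g \<in> Fil p N) \<Longrightarrow> f = g"
  by (rule cf_eqI) (metis FilD cf_diff eq_iff_diff_eq_0 lessI)

lemma Fil_weight: "f \<in> Fil p N \<Longrightarrow> p \<le> q \<Longrightarrow> f \<in> Fil q N"
proof (rule FilI)
  fix e assume f: "f \<in> Fil p N" and "p \<le> q" and w: "wt q e < N"
  have "wt p e \<le> wt q e"
    using \<open>p \<le> q\<close> by (cases e) simp
  then show "cf f e = 0" using f w by (simp add: FilD)
qed

text \<open>Each exponent counts at most \<open>q\<close> times, so
  \<open>wt q e \<le> q * wt 1 e\<close>. This brings estimates in weight 3 back to the total degree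
  that defines continuity.\<close>

lemma Fil_weight_1: "f \<in> Fil q (q * N) \<Longrightarrow> 0 < q \<Longrightarrow> f \<in> Fil 1 N"
proof (rule FilI)
  fix e assume f: "f \<in> Fil q (q * N)" and q: "0 < q" and w: "wt 1 e < N"
  have "wt q e \<le> q * wt 1 e"
    using q by (cases e) (simp add: add_mult_distrib2 add_le_mono)
  also have "\<dots> < q * N" using w q by simp
  finally show "cf f e = 0" using f by (simp add: FilD)
qed

lemma Fil_mult:
  assumes "f \<in> Fil p M" "g \<in> Fil p N"
  shows "f * g \<in> Fil p (M + N)"
proof (rule FilI)
  fix e assume w: "wt p e < M + N"
  obtain k l a b c where e: "e = (k, l, a, b, c)" by (cases e)
  show "cf (f * g) e = 0"
    unfolding e cf_mult
  proof (intro sum.neutral ballI)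
    fix i j x y z
    assume *: "i \<in> {..k}" "j \<in> {..l}" "x \<in> {..a}" "y \<in> {..b}" "z \<in> {..c}"
    have "e = (i, j, x, y, z) + (k - i, l - j, a - x, b - y, c - z)"
      using * by (simp add: e)
    then have "wt p e = wt p (i, j, x, y, z) + wt p (k - i, l - j, a - x, b - y, c - z)"
      by (simp only: wt_add)
    then have "wt p (i, j, x, y, z) < M \<or> wt p (k - i, l - j, a - x, b - y, c - z) < N"
      using w by linarith
    then show "cf f (i, j, x, y, z) * cf g (k - i, l - j, a - x, b - y, c - z) = 0"
      using assms by (metis FilD mult_zero_left mult_zero_right)
  qed
qed

lemma Fil_mult_left: "g \<in> Fil p N \<Longrightarrow> f * g \<in> Fil p N"
  using Fil_mult[of f p 0 g N] by simp

lemma Fil_mult_right: "f \<in> Fil p N \<Longrightarrow> f * g \<in> Fil p N"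
  using Fil_mult[of f p N g 0] by simp

lemma Fil_power: "f \<in> Fil p M \<Longrightarrow> f ^ k \<in> Fil p (k * M)"
  by (induction k) (auto simp: Fil_mult)

lemma mono_Fil: "N \<le> wt p e \<Longrightarrow> monom_series c e \<in> Fil p N"
  by (auto simp: Fil_def cf_mono)

section \<open>Density of polynomials and continuous additive maps\<close>

lemma finite_wt: "finite {e. wt 1 e < N}"
proof (rule finite_subset)
  show "{e. wt 1 e < N} \<subseteq> {..N} \<times> {..N} \<times> {..N} \<times> {..N} \<times> {..N}" by auto
qed auto

definition trunc :: "nat \<Rightarrow> formal_series \<Rightarrow> formal_series" where
  "trunc N f = (\<Sum>e\<in>{e. wt 1 e < N}. monom_series (cf f e) e)"

lemma cf_trunc: "cf (trunc N f) e = (if wt 1 e < N then cf f e else 0)"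
  using finite_wt[of N] by (simp add: trunc_def cf_mono)

lemma trunc_diff: "f - trunc N f \<in> Fil 1 N"
  by (rule FilI) (simp add: cf_trunc)

text \<open>Polynomials are dense, because truncation leaves only terms of total degree at least
  \<open>N\<close>; the third premise closes \<open>P\<close> under limits.\<close>

lemma series_induct [case_names monom_series add lim]:
  assumes "\<And>c e. P (monom_series c e)"
    and "\<And>f g. P f \<Longrightarrow> P g \<Longrightarrow> P (f + g)"
    and "\<And>f. (\<And>N. \<exists>g. P g \<and> f - g \<in> Fil 1 N) \<Longrightarrow> P f"
  shows "P f"
proof (rule assms(3))
  fix N
  have z: "monom_series 0 e = 0" for e by (rule cf_eqI) (simp add: cf_mono)
  have "P (\<Sum>e\<in>A. monom_series (cf f e) e)" if "finite A" for A
    using that by (induction A rule: finite_induct) (use assms(1)[of 0 0] in \<open>simp_all add: z assms\<close>)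
  then show "\<exists>g. P g \<and> f - g \<in> Fil 1 N"
    using trunc_diff finite_wt unfolding trunc_def by blast
qed

text \<open>Additivity with continuity at 0 for the total degree. Homogeneity is replaced by
  additivity so that complex conjugation is covered; monomials are therefore always tested with
  their coefficient.\<close>

definition cadd :: "(formal_series \<Rightarrow> formal_series) \<Rightarrow> bool" where
  "cadd T \<longleftrightarrow> (\<forall>f g. T (f + g) = T f + T g) \<and> (\<forall>N. \<exists>M. \<forall>f\<in>Fil 1 M. T f \<in> Fil 1 N)"

lemma caddD: "cadd T \<Longrightarrow> T (f + g) = T f + T g" by (simp add: cadd_def)

lemma cadd_0: "cadd T \<Longrightarrow> T 0 = 0"
  using caddD[of T 0 0] by simp

lemma cadd_uminus: "cadd T \<Longrightarrow> T (- f) = - T f"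
  using caddD[of T f "- f"] cadd_0[of T] by (simp add: eq_neg_iff_add_eq_0 add.commute)

lemma cadd_minus: "cadd T \<Longrightarrow> T (f - g) = T f - T g"
  using caddD[of T f "- g"] cadd_uminus[of T g] by simp

lemma cadd_sum: "cadd T \<Longrightarrow> T (sum f A) = (\<Sum>i\<in>A. T (f i))"
  by (induction A rule: infinite_finite_induct) (auto simp: cadd_0 caddD)

lemma caddI:
  assumes "\<And>f g. T (f + g) = T f + T g" "\<And>N f. f \<in> Fil 1 (N + k) \<Longrightarrow> T f \<in> Fil 1 N"
  shows "cadd T"
  unfolding cadd_def using assms by blast

lemma cadd_id: "cadd (\<lambda>f. f)" by (rule caddI[of _ 0]) auto

lemma cadd_comp: "cadd S \<Longrightarrow> cadd T \<Longrightarrow> cadd (\<lambda>f. S (T f))"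
  unfolding cadd_def by metis

lemma cadd_plus: "cadd S \<Longrightarrow> cadd T \<Longrightarrow> cadd (\<lambda>f. S f + T f)"
  unfolding cadd_def
proof (intro conjI allI)
  fix N assume *: "(\<forall>f g. S (f + g) = S f + S g) \<and> (\<forall>N. \<exists>M. \<forall>f\<in>Fil 1 M. S f \<in> Fil 1 N)"
     "(\<forall>f g. T (f + g) = T f + T g) \<and> (\<forall>N. \<exists>M. \<forall>f\<in>Fil 1 M. T f \<in> Fil 1 N)"
  then obtain M1 M2 where "\<forall>f\<in>Fil 1 M1. S f \<in> Fil 1 N" "\<forall>f\<in>Fil 1 M2. T f \<in> Fil 1 N" by blast
  then have "\<forall>f\<in>Fil 1 (max M1 M2). S f + T f \<in> Fil 1 N"
    by (metis Fil_add Fil_mono max.cobounded1 max.cobounded2)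
  then show "\<exists>M. \<forall>f\<in>Fil 1 M. S f + T f \<in> Fil 1 N" by blast
qed simp

lemma cadd_mult: "cadd T \<Longrightarrow> cadd (\<lambda>f. g * T f)"
  unfolding cadd_def by (metis Fil_mult_left distrib_left)

lemma cadd_mult': "cadd T \<Longrightarrow> cadd (\<lambda>f. T f * g)"
  using cadd_mult by (simp add: mult.commute)

lemma cadd_neg: "cadd T \<Longrightarrow> cadd (\<lambda>f. - T f)"
  using cadd_mult[of T "-1"] by simp

lemma cadd_diff: "cadd S \<Longrightarrow> cadd T \<Longrightarrow> cadd (\<lambda>f. S f - T f)"
  using cadd_plus[of S "\<lambda>f. - T f"] cadd_neg by simp

text \<open>The difference of the two maps is continuous and vanishes on the dense set of
  polynomials.\<close>

lemma cadd_ext: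
  assumes "cadd S" "cadd T" "\<And>c e. S (monom_series c e) = T (monom_series c e)"
  shows "S f = T f"
proof (induction f rule: series_induct)
  case (lim f)
  show ?case
  proof (rule Fil_eqI)
    fix N
    have "cadd (\<lambda>f. S f - T f)" using assms cadd_diff by blast
    then obtain M where M: "\<forall>f\<in>Fil 1 M. S f - T f \<in> Fil 1 N" unfolding cadd_def by blast
    obtain g where "S g = T g" "f - g \<in> Fil 1 M" using lim by blast
    then show "S f - T f \<in> Fil 1 N"
      using M assms(1,2) by (force simp: cadd_minus)
  qed
qed (simp_all add: assms caddD)

text \<open>With one factor fixed, both sides are continuous additive maps of the other, so
  \<open>cadd_ext\<close> applies to each factor in turn.\<close>

lemma cadd_multiplicative:
  assumes T: "cadd T" and m: "\<And>c e c' e'. T (monom_series c e * monom_series c' e')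
      = T (monom_series c e) * T (monom_series c' e')"
  shows "T (f * g) = T f * T g"
proof (rule cadd_ext[of "\<lambda>f. T (f * g)" "\<lambda>f. T f * T g"])
  fix c e
  show "T (monom_series c e * g) = T (monom_series c e) * T g"
    by (rule cadd_ext[of "\<lambda>g. T (monom_series c e * g)" "\<lambda>g. T (monom_series c e) * T g"])
      (auto intro!: cadd_comp[OF T] cadd_mult cadd_mult' cadd_id T m)
qed (auto intro!: cadd_comp[OF T] cadd_mult cadd_mult' cadd_id T m)

section \<open>Derivations in the five variables, and conjugation\<close>

definition fmap :: "('a \<Rightarrow> 'a) \<Rightarrow> 'a fps \<Rightarrow> 'a fps" where
  "fmap d f = Abs_fps (\<lambda>k. d (fps_nth f k))"

definition derivation :: "('a::comm_ring_1 \<Rightarrow> 'a) \<Rightarrow> bool" where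
  "derivation d \<longleftrightarrow> (\<forall>x y. d (x + y) = d x + d y) \<and> (\<forall>x y. d (x * y) = d x * y + x * d y)"

lemma derivation_fps_deriv: "derivation fps_deriv"
  by (simp add: derivation_def)

lemma derivation_sum: "derivation d \<Longrightarrow> d (sum f A) = (\<Sum>i\<in>A. d (f i))"
proof -
  assume d: "derivation d"
  then have "d 0 = 0" unfolding derivation_def by (metis add_cancel_right_right)
  then show ?thesis
    using d by (induction A rule: infinite_finite_induct) (auto simp: derivation_def)
qed

text \<open>Iterating this lifts \<open>fps_deriv\<close> from any level of nesting to the whole
  ring, so all five partial derivatives are derivations.\<close>

lemma derivation_fmap:
  assumes d: "derivation d" shows "derivation (fmap d)"
  unfolding derivation_def
proof (intro conjI allI)
  fix f g :: "'a fps"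
  show "fmap d (f + g) = fmap d f + fmap d g"
    using d by (auto simp: fps_eq_iff fmap_def derivation_def)
  have m: "\<And>x y. d (x * y) = d x * y + x * d y" using d by (simp add: derivation_def)
  show "fmap d (f * g) = fmap d f * g + f * fmap d g"
    by (auto simp: fps_eq_iff fmap_def fps_mult_nth derivation_sum[OF d] m sum.distrib)
qed

lemma deriv_z_derivation: "derivation deriv_z"
  unfolding deriv_z_def by (rule derivation_fps_deriv)

lemma deriv_zbar_fmap: "deriv_zbar = fmap fps_deriv"
  by (auto simp: deriv_zbar_def fmap_def)

lemma deriv_zbar_derivation: "derivation deriv_zbar"
  unfolding deriv_zbar_fmap by (intro derivation_fmap derivation_fps_deriv)

definition deriv_p1 :: "formal_series \<Rightarrow> formal_series" where
  "deriv_p1 = fmap (fmap fps_deriv)"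

definition deriv_p2 :: "formal_series \<Rightarrow> formal_series" where
  "deriv_p2 = fmap (fmap (fmap fps_deriv))"

definition deriv_p3 :: "formal_series \<Rightarrow> formal_series" where
  "deriv_p3 = fmap (fmap (fmap (fmap fps_deriv)))"

lemma deriv_p_derivation: "derivation deriv_p1" "derivation deriv_p2" "derivation deriv_p3"
  unfolding deriv_p1_def deriv_p2_def deriv_p3_def by (intro derivation_fmap derivation_fps_deriv)+

lemma cf_deriv_z: "cf (deriv_z f) (k, l, a, b, c) = of_nat (Suc k) * cf f (Suc k, l, a, b, c)"
  by (simp add: cf_def deriv_z_def flip: fps_of_nat)
lemma cf_deriv_zbar: "cf (deriv_zbar f) (k, l, a, b, c) = of_nat (Suc l) * cf f (k, Suc l, a, b, c)"
  by (simp add: cf_def deriv_zbar_fmap fmap_def flip: fps_of_nat)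
lemma cf_deriv_p1: "cf (deriv_p1 f) (k, l, a, b, c) = of_nat (Suc a) * cf f (k, l, Suc a, b, c)"
  by (simp add: cf_def deriv_p1_def fmap_def flip: fps_of_nat)
lemma cf_deriv_p2: "cf (deriv_p2 f) (k, l, a, b, c) = of_nat (Suc b) * cf f (k, l, a, Suc b, c)"
  by (simp add: cf_def deriv_p2_def fmap_def flip: fps_of_nat)
lemma cf_deriv_p3: "cf (deriv_p3 f) (k, l, a, b, c) = of_nat (Suc c) * cf f (k, l, a, b, Suc c)"
  by (simp add: cf_def deriv_p3_def fmap_def)

lemmas cf_derivs = cf_deriv_z cf_deriv_zbar cf_deriv_p1 cf_deriv_p2 cf_deriv_p3

lemma derivationD: "derivation d \<Longrightarrow> d (x + y) = d x + d y" "derivation d \<Longrightarrow> d (x * y) = d x * y + x * d y"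
  by (auto simp: derivation_def)

lemma derivation_power: "derivation d \<Longrightarrow> d (x ^ k) = of_nat k * x ^ (k - 1) * d x"
proof (induction k)
  case 0
  have "d (1 * 1) = d 1 + d 1" using derivationD(2)[OF 0, of 1 1] by simp
  then show ?case by simp
next
  case (Suc k)
  then show ?case
    by (cases k) (auto simp: derivationD algebra_simps)
qed

lemma Fil_deriv_z: "f \<in> Fil p N \<Longrightarrow> deriv_z f \<in> Fil p (N - 1)"
  by (auto simp: Fil_def cf_deriv_z less_diff_conv)

lemma Fil_deriv_zbar: "f \<in> Fil p N \<Longrightarrow> deriv_zbar f \<in> Fil p (N - 1)"
  by (auto simp: Fil_def cf_deriv_zbar less_diff_conv)

lemma cadd_deriv_z: "cadd deriv_z"
  by (rule caddI[of _ 1]) (auto simp: derivationD deriv_z_derivation dest: Fil_deriv_z)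

lemma cadd_deriv_zbar: "cadd deriv_zbar"
  by (rule caddI[of _ 1]) (auto simp: derivationD deriv_zbar_derivation dest: Fil_deriv_zbar)

lemma cadd_deriv_p: "cadd deriv_p1" "cadd deriv_p2" "cadd deriv_p3"
  by (rule caddI[of _ 1]; force simp: derivationD deriv_p_derivation Fil_def cf_derivs)+

lemma cf_cnj: "cf (cnj_series f) (k, l, a, b, c) = cnj (cf f (l, k, a, b, c))"
  by (simp add: cf_def cnj_series_def)

lemma cadd_cnj: "cadd cnj_series"
  by (rule caddI[of _ 0], rule cf_eqI) (auto simp: Fil_def cf_cnj add.commute split: prod.splits)

lemma Fil_cnj: "f \<in> Fil p N \<Longrightarrow> cnj_series f \<in> Fil p N"
  by (auto simp: Fil_def cf_cnj add.commute)

lemma cnj_mono: "cnj_series (monom_series c (k, l, e)) = monom_series (cnj c) (l, k, e)"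
  by (rule cf_eqI) (cases e, auto simp: cf_cnj cf_mono split: if_splits)

lemma cnj_cnj [simp]: "cnj_series (cnj_series f) = f"
  by (rule cf_eqI) (auto simp: cf_cnj)

lemma cnj_mult: "cnj_series (f * g) = cnj_series f * cnj_series g"
proof (rule cadd_multiplicative[OF cadd_cnj])
  fix c e c' e'
  show "cnj_series (monom_series c e * monom_series c' e') = cnj_series (monom_series c e)
      * cnj_series (monom_series c' e')"
    by (cases e; cases e') (simp add: mono_mult cnj_mono)
qed

lemmas cnj_diff = cadd_minus[OF cadd_cnj] and cnj_zero = cadd_0[OF cadd_cnj]

lemma mono_eqs: "const_series c = monom_series c (0,0,0,0,0)" "Z = monom_series 1 (1,0,0,0,0)"
  "Zbar = monom_series 1 (0,1,0,0,0)" "param_monom p q r = monom_series 1 (0,0,p,q,r)"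
  by (simp_all add: monom_series_def)

lemma cnj_const: "cnj_series (const_series c) = const_series (cnj c)"
  by (simp add: mono_eqs cnj_mono)

lemma cnj_Z [simp]: "cnj_series Z = Zbar" "cnj_series Zbar = Z"
  by (simp_all add: mono_eqs cnj_mono)

lemma cnj_1 [simp]: "cnj_series 1 = 1"
  using cnj_const[of 1] by simp

lemma cnj_param [simp]: "cnj_series (param_monom p q r) = param_monom p q r"
  by (simp add: mono_eqs cnj_mono)

lemma cnj_power: "cnj_series (f ^ k) = cnj_series f ^ k"
  by (induction k) (auto simp: cnj_mult)

lemma deriv_z_cnj: "deriv_z (cnj_series f) = cnj_series (deriv_zbar f)"
  by (rule cf_eqI) (auto simp: cf_cnj cf_derivs)

lemma deriv_zbar_cnj: "deriv_zbar (cnj_series f) = cnj_series (deriv_z f)"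
  by (rule cf_eqI) (auto simp: cf_cnj cf_derivs)

section \<open>Composition, canonical changes and flows\<close>

definition lift :: "param_series \<Rightarrow> formal_series" where
  "lift c = fps_const (fps_const c)"

lemma cf_lift: "cf (lift c) (k, l, p, q, r) = (if k = 0 \<and> l = 0 then pcoeff c p q r else 0)"
  by (simp add: cf_def lift_def)

lemma lift_0 [simp]: "lift 0 = 0" by (simp add: lift_def)

lemma lift_mult: "lift (a * b) = lift a * lift b" by (simp add: lift_def)

lemma zcoeff_lift_mult: "zcoeff (lift c * f) k l = c * zcoeff f k l"
  by (simp add: lift_def)

lemma fixes_origin_Fil: "fixes_origin u \<longleftrightarrow> u \<in> Fil 0 1"
  by (auto simp: fixes_origin_def Fil_def cf_def fps_eq_iff)

lemma fixes_origin_Fil': "fixes_origin u \<Longrightarrow> u \<in> Fil p 1"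
  using Fil_weight[of u 0 1 p] by (simp add: fixes_origin_Fil)

lemma fixes_origin_Z [simp]: "fixes_origin Z"
  by (simp add: fixes_origin_def Z_def)

lemma powers_Fil: "fixes_origin u \<Longrightarrow> u ^ k * cnj_series u ^ l \<in> Fil p (k + l)"
  using Fil_power[of u p 1 k] Fil_power[of "cnj_series u" p 1 l] fixes_origin_Fil'[of u p]
  by (simp add: Fil_mult Fil_cnj)

lemma cf_compose: "cf (compose_series f u) (a, b, e) =
  (\<Sum>k\<le>a + b. \<Sum>l\<le>a + b. cf (lift (zcoeff f k l) * (u ^ k * cnj_series u ^ l)) (a, b, e))"
  by (cases e) (simp add: cf_simp compose_series_def fps_sum_nth lift_def)

lemma lift_zcoeff_Fil: "f \<in> Fil p N \<Longrightarrow> lift (zcoeff f k l) \<in> Fil p (N - (k + l))"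
proof (rule FilI)
  fix e assume f: "f \<in> Fil p N" and "wt p e < N - (k + l)"
  moreover obtain k' l' a b c where e: "e = (k', l', a, b, c)" by (cases e)
  ultimately have "cf f (k, l, a, b, c) = 0" if "k' = 0" "l' = 0"
    by (intro FilD[OF f]) (use that in auto)
  then show "cf (lift (zcoeff f k l)) e = 0"
    by (simp add: e cf_lift) (simp add: cf_simp)
qed

text \<open>Extracting the coefficient of z^k zbar^l costs weight k + l, and
  \<open>u ^ k * cnj_series u ^ l\<close> gives it back because \<open>u\<close> has no term of
  degree 0. This works for every weight \<open>p\<close>.\<close>

lemma compose_Fil:
  assumes "fixes_origin u" "f \<in> Fil p N" shows "compose_series f u \<in> Fil p N"
proof (rule FilI)
  fix e assume w: "wt p e < N"
  obtain a b e' where e: "e = (a, b, e')" by (cases e)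
  show "cf (compose_series f u) e = 0"
    unfolding e cf_compose
  proof (intro sum.neutral ballI)
    fix k l
    have "lift (zcoeff f k l) * (u ^ k * cnj_series u ^ l) \<in> Fil p ((N - (k + l)) + (k + l))"
      using assms by (intro Fil_mult powers_Fil lift_zcoeff_Fil)
    then show "cf (lift (zcoeff f k l) * (u ^ k * cnj_series u ^ l)) (a, b, e') = 0"
      by (rule FilD) (use w e in auto)
  qed
qed

lemma compose_add: "compose_series (f + g) u = compose_series f u + compose_series g u"
  by (simp add: compose_series_def fps_eq_iff distrib_right sum.distrib)

lemma cadd_compose: "fixes_origin u \<Longrightarrow> cadd (\<lambda>f. compose_series f u)"
  by (rule caddI[of _ 0]) (auto simp: compose_add compose_Fil)

lemma zcoeff_mono: "lift (zcoeff (monom_series c (k, l, p, q, r)) k' l') =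
   (if k = k' \<and> l = l' then const_series c * param_monom p q r else 0)"
proof (rule cf_eqI)
  fix e
  have "cf (lift (zcoeff (monom_series c (k, l, p, q, r)) k' l')) (i, j, x, y, z) =
     cf (if k = k' \<and> l = l' then const_series c * param_monom p q r else 0) (i, j, x, y, z)"
         for i j x y z
  proof -
    have "cf (lift (zcoeff (monom_series c (k, l, p, q, r)) k' l')) (i, j, x, y, z) =
      (if i = 0 \<and> j = 0 then cf (monom_series c (k, l, p, q, r)) (k', l', x, y, z) else 0)"
      by (subst cf_lift) (simp only: cf_simp)
    then show ?thesis by (auto simp: cf_mono mono_eqs(4))
  qed
  then show "cf (lift (zcoeff (monom_series c (k, l, p, q, r)) k' l')) e =
     cf (if k = k' \<and> l = l' then const_series c * param_monom p q r else 0) e" by (metis surj_pair)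
qed

lemma double_delta: "(\<Sum>k'\<le>n. \<Sum>l'\<le>n. if k = k' then (if l = l' then x else 0) else 0) =
    (if k \<le> n \<and> l \<le> (n::nat) then x else (0::'a::comm_monoid_add))"
proof -
  have "(\<Sum>l'\<le>n. if k = k' then (if l = l' then x else 0) else 0) = (if k = k' then (if l \<le> n then x
      else 0) else 0)" for k'
    by simp
  then show ?thesis by simp
qed

lemma compose_mono:
  assumes u: "fixes_origin u"
  shows "compose_series (monom_series c (k, l, p, q, r)) u =
    const_series c * param_monom p q r * (u ^ k * cnj_series u ^ l)" (is "?L = ?R")
proof (rule cf_eqI)
  fix e :: expo
  obtain a b e' where e: "e = (a, b, e')" by (cases e)
  have "cf ?L e = (\<Sum>k'\<le>a + b. \<Sum>l'\<le>a + b. if k = k' then (if l = l' then cf ?R e else 0) else 0)"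
    unfolding e cf_compose by (intro sum.cong refl) (auto simp: zcoeff_mono)
  also have "\<dots> = (if k \<le> a + b \<and> l \<le> a + b then cf ?R e else 0)"
    by (rule double_delta)
  also have "\<dots> = cf ?R e"
  proof (cases "k \<le> a + b \<and> l \<le> a + b")
    case False
    \<comment> \<open>Beyond the cutoff built into \<open>compose_series\<close> the product has too
      high an order in z, zbar to contribute.\<close>
    have "?R \<in> Fil 0 (k + l)" by (intro Fil_mult_left powers_Fil u)
    then have "cf ?R e = 0" by (rule FilD) (use False e in \<open>cases e', auto\<close>)
    then show ?thesis by auto
  qed auto
  finally show "cf ?L e = cf ?R e" .
qed

lemma compose_mult:
  assumes u: "fixes_origin u"
  shows "compose_series (f * g) u = compose_series f u * compose_series g u"
proof (rule cadd_multiplicative[OF cadd_compose[OF u]])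
  fix c e c' e'
  show "compose_series (monom_series c e * monom_series c' e') u
      = compose_series (monom_series c e) u * compose_series (monom_series c' e') u"
    by (cases e; cases e') (simp add: mono_mult compose_mono[OF u] power_add const_series_mult ac_simps
      flip: param_monom_mult)
qed

lemma compose_lift: "compose_series (lift c * f) u = lift c * compose_series f u"
  by (auto simp: fps_eq_iff compose_series_def lift_def sum_distrib_left mult.assoc)

lemma compose_const_mult: "compose_series (const_series c * f) u = const_series c * compose_series f u"
  using compose_lift[of "fps_const (fps_const (fps_const c))"] by (simp add: lift_def const_series_def)

lemma deriv_z_monom: "deriv_z (monom_series x (k, l, p, q, r)) =
    (if k = 0 then 0 else monom_series (of_nat k * x) (k - 1, l, p, q, r))"
  by (rule cf_eqI) (auto simp: cf_derivs cf_mono split: if_splits)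

lemma deriv_zbar_monom: "deriv_zbar (monom_series x (k, l, p, q, r)) =
    (if l = 0 then 0 else monom_series (of_nat l * x) (k, l - 1, p, q, r))"
  by (rule cf_eqI) (auto simp: cf_derivs cf_mono split: if_splits)

lemma const_series_of_nat: "const_series (of_nat k) = of_nat k"
  by (induction k) (auto simp: const_series_add)

context
  fixes u :: formal_series
  assumes u: "fixes_origin u"
begin

lemma compose_basic: "compose_series Z u = u" "compose_series Zbar u = cnj_series u"
   "compose_series (const_series c) u = const_series c" "compose_series (param_monom p q r) u
       = param_monom p q r"
  by (simp_all add: mono_eqs(1-3) mono_eqs(4)[of p] compose_mono[OF u] monom_series_0)

lemma compose_1: "compose_series 1 u = 1"
  using compose_basic(3)[of 1] by simp

lemmas compose_diff = cadd_minus[OF cadd_compose[OF u]]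

lemma cnj_compose: "cnj_series (compose_series f u) = compose_series (cnj_series f) u"
proof (rule cadd_ext[of "\<lambda>f. cnj_series (compose_series f u)"])
  fix c e show "cnj_series (compose_series (monom_series c e) u)
      = compose_series (cnj_series (monom_series c e)) u"
    by (cases e) (simp add: compose_mono[OF u] cnj_mono cnj_mult cnj_const cnj_power mult_ac)
qed (auto intro!: cadd_comp[OF cadd_cnj] cadd_comp[OF cadd_compose[OF u]] cadd_cnj cadd_compose u)

lemma compose_power: "compose_series (f ^ k) u = compose_series f u ^ k"
  by (induction k) (auto simp: compose_1 compose_mult[OF u])

lemma fixes_origin_compose: "fixes_origin v \<Longrightarrow> fixes_origin (compose_series v u)"
  using compose_Fil[OF u] by (simp add: fixes_origin_Fil)

lemma compose_assoc:
  assumes v: "fixes_origin v"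
  shows "compose_series (compose_series f v) u = compose_series f (compose_series v u)"
proof (rule cadd_ext[of "\<lambda>f. compose_series (compose_series f v) u"])
  fix c e
  show "compose_series (compose_series (monom_series c e) v) u
      = compose_series (monom_series c e) (compose_series v u)"
    by (cases e) (simp add: compose_mono[OF v] compose_mono[OF fixes_origin_compose[OF v]]
        compose_mult[OF u]
      compose_basic compose_power cnj_compose)
qed (auto intro!: cadd_comp[OF cadd_compose[OF u]] cadd_compose v fixes_origin_compose)

text \<open>Stated for an abstract derivation killing constants and parameters, so that both plane
  derivatives are instances. On monomials it is the power rule.\<close>

lemma compose_chain:
  assumes d: "derivation d" "cadd d" and c: "\<And>c p q r. d (const_series c * param_monom p q r) = 0"
  shows "d (compose_series f u) = compose_series (deriv_z f) u * d u
      + compose_series (deriv_zbar f) u * d (cnj_series u)"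
proof (rule cadd_ext[of "\<lambda>f. d (compose_series f u)"])
  fix x and e :: expo
  obtain k l p q r where e: "e = (k, l, p, q, r)" by (cases e)
  note z = deriv_z_monom[of x k l p q r, folded e] deriv_zbar_monom[of x k l p q r, folded e]
  note o = const_series_of_nat
  have 0: "compose_series 0 u = 0" using cadd_0[OF cadd_compose[OF u]] .
  show "d (compose_series (monom_series x e) u) = compose_series (deriv_z (monom_series x e)) u * d u
    + compose_series (deriv_zbar (monom_series x e)) u * d (cnj_series u)"
    unfolding z using c[of x 0 0 0] c[of 1 p q r]
    by (auto simp: e compose_mono[OF u] derivationD[OF d(1)] derivation_power[OF d(1)] c 0
        const_series_mult o algebra_simps)
qed (auto intro!: cadd_comp[OF d(2)] cadd_plus cadd_mult' cadd_comp[OF cadd_compose[OF u]]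
    cadd_deriv_z cadd_deriv_zbar cadd_compose[OF u])

lemma deriv_z_compose: "deriv_z (compose_series f u) =
  compose_series (deriv_z f) u * deriv_z u + compose_series (deriv_zbar f) u * deriv_z (cnj_series u)"
proof (rule compose_chain[OF deriv_z_derivation cadd_deriv_z])
  fix c p q r show "deriv_z (const_series c * param_monom p q r) = 0"
    by (rule cf_eqI) (auto simp: mono_eqs(4) cf_derivs cf_mono)
qed

lemma deriv_zbar_compose: "deriv_zbar (compose_series f u) =
  compose_series (deriv_z f) u * deriv_zbar u + compose_series (deriv_zbar f) u
      * deriv_zbar (cnj_series u)"
proof (rule compose_chain[OF deriv_zbar_derivation cadd_deriv_zbar])
  fix c p q r show "deriv_zbar (const_series c * param_monom p q r) = 0"
    by (rule cf_eqI) (auto simp: mono_eqs(4) cf_derivs cf_mono)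
qed

end

lemma compose_id: "compose_series f Z = f"
proof (rule cadd_ext[of "\<lambda>f. compose_series f Z"])
  fix c e show "compose_series (monom_series c e) Z = monom_series c e"
  proof (cases e)
    case (fields k l p q r)
    show ?thesis unfolding fields compose_mono[OF fixes_origin_Z] by (simp add: monom_series_def)
  qed
qed (auto intro!: cadd_compose cadd_id)


text \<open>The Poisson bracket up to the factor \<open>-\<i>\<close>; hence generators \<open>c\<close> of real canonical changes satisfy
  \<open>cnj_series c = - c\<close>.\<close>

definition bracket :: "formal_series \<Rightarrow> formal_series \<Rightarrow> formal_series" where
  "bracket f g = deriv_z f * deriv_zbar g - deriv_zbar f * deriv_z g"

section \<open>Canonical changes of variables\<close>

definition inverse_change :: "formal_series \<Rightarrow> formal_series \<Rightarrow> bool" where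
  "inverse_change u w \<longleftrightarrow> fixes_origin u \<and> fixes_origin w \<and> compose_series u w = Z
      \<and> compose_series w u = Z"

lemma canonical_change_iff:
  "canonical_change u \<longleftrightarrow> (\<exists>w. inverse_change u w) \<and> bracket u (cnj_series u) = 1"
  by (auto simp: canonical_change_def inverse_change_def bracket_def)

text \<open>The bracket is a Jacobian determinant, and \<open>bracket u (cnj_series u)\<close> is
  the Jacobian of the map \<open>u\<close>.\<close>

lemma bracket_compose:
  assumes "fixes_origin u"
  shows "bracket (compose_series f u) (compose_series g u) = compose_series (bracket f g) u
      * bracket u (cnj_series u)"
  using assms by (simp add: bracket_def deriv_z_compose deriv_zbar_compose compose_diff compose_mult
      algebra_simps)

lemma bracket_Z: "bracket Z Zbar = 1"
proof -
  have "deriv_z Z = 1" by (simp add: Z_def deriv_z_def)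
  moreover have "deriv_zbar Zbar = 1"
    by (rule cf_eqI) (auto simp: mono_eqs cf_derivs cf_mono cf_1 split: if_splits)
  moreover have "deriv_z Zbar = 0" by (simp add: Zbar_def deriv_z_def)
  ultimately show ?thesis by (simp add: bracket_def)
qed

text \<open>Jacobians multiply along v o w = id; since that of \<open>w\<close> is 1, the Jacobian
  of \<open>v\<close> composed with \<open>w\<close> is 1, and composing with \<open>v\<close>
  removes \<open>w\<close>.\<close>

lemma inverse_change_canonical:
  assumes w: "canonical_change w" and v: "inverse_change w v"
  shows "canonical_change v"
proof -
  have fo: "fixes_origin w" "fixes_origin v" and c: "compose_series w v = Z" "compose_series v w = Z"
    using v by (auto simp: inverse_change_def)
  let ?J = "bracket v (cnj_series v)"
  have "compose_series ?J w * bracket w (cnj_series w)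
      = bracket (compose_series v w) (compose_series (cnj_series v) w)"
    by (simp add: bracket_compose fo)
  also have "\<dots> = 1"
    using cnj_compose[of w v] by (simp add: c fo bracket_Z)
  finally have "compose_series ?J w = 1" using w by (simp add: canonical_change_iff)
  then have "compose_series (compose_series ?J w) v = 1" by (simp add: compose_1 fo)
  then have "?J = 1" by (simp add: compose_assoc fo c compose_id)
  then show ?thesis using v by (auto simp: canonical_change_iff inverse_change_def)
qed

lemma canonical_compose:
  assumes "canonical_change u" "canonical_change v"
  shows "canonical_change (compose_series u v)"
proof -
  obtain u' v' where u: "inverse_change u u'" and v: "inverse_change v v'"
    using assms by (auto simp: canonical_change_iff)
  then have fo: "fixes_origin u" "fixes_origin u'" "fixes_origin v" "fixes_origin v'"
    and c: "compose_series u u' = Z" "compose_series u' u = Z" "compose_series v v' = Z"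
        "compose_series v' v = Z"
    by (auto simp: inverse_change_def)
  have "compose_series (compose_series u v) (compose_series v' u')
      = compose_series u (compose_series (compose_series v v') u')"
    by (simp add: compose_assoc fo fixes_origin_compose)
  also have "\<dots> = Z" using compose_basic(1) by (simp add: c fo)
  finally have 1: "compose_series (compose_series u v) (compose_series v' u') = Z" .
  have "compose_series (compose_series v' u') (compose_series u v)
      = compose_series v' (compose_series (compose_series u' u) v)"
    by (simp add: compose_assoc fo fixes_origin_compose)
  also have "\<dots> = Z" using compose_basic(1) by (simp add: c fo)
  finally have "inverse_change (compose_series u v) (compose_series v' u')"
    using 1 by (simp add: inverse_change_def fixes_origin_compose fo)
  moreover have "bracket (compose_series u v) (cnj_series (compose_series u v)) = 1"
    using assms by (simp add: cnj_compose fo bracket_compose compose_1 canonical_change_iff)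
  ultimately show ?thesis by (auto simp: canonical_change_iff)
qed


section \<open>Time derivatives and formal flows\<close>

definition has_sderiv :: "(real \<Rightarrow> formal_series) \<Rightarrow> formal_series \<Rightarrow> real \<Rightarrow> bool" where
  "has_sderiv f f' t \<longleftrightarrow> (\<forall>e. ((\<lambda>s. cf (f s) e) has_vector_derivative cf f' e) (at t))"

lemma has_sderivD: "has_sderiv f f' t \<Longrightarrow> ((\<lambda>s. cf (f s) e) has_vector_derivative cf f' e) (at t)"
  unfolding has_sderiv_def by blast

lemma has_sderiv_iff: "has_sderiv f f' t \<longleftrightarrow> (\<forall>k l a b c.
  ((\<lambda>s. pcoeff (zcoeff (f s) k l) a b c) has_vector_derivative pcoeff (zcoeff f' k l) a b c) (at t))"
  by (auto simp: has_sderiv_def cf_def)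

lemma ham_flow_iff: "ham_flow H \<Phi> \<longleftrightarrow> \<Phi> 0 = Z \<and> (\<forall>t. fixes_origin (\<Phi> t)) \<and>
  (\<forall>t. has_sderiv \<Phi> (const_series (- \<i>) * compose_series (deriv_zbar H) (\<Phi> t)) t)"
proof -
  have "- \<i> * pcoeff (zcoeff f k l) a b c = pcoeff (zcoeff (const_series (- \<i>) * f) k l) a b c"
      for f k l a b c
    using cf_const_mult[of "-\<i>" f "(k, l, a, b, c)"] unfolding cf_simp by simp
  then show ?thesis unfolding ham_flow_def has_sderiv_iff by simp
qed

lemma has_sderiv_const: "has_sderiv (\<lambda>t. f) 0 t"
  by (simp add: has_sderiv_def)

lemma has_sderiv_add: "has_sderiv f f' t \<Longrightarrow> has_sderiv g g' t \<Longrightarrow> has_sderiv (\<lambda>t. f t + g t) (f' + g') t"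
  by (auto simp: has_sderiv_def intro: has_vector_derivative_add)

lemma has_sderiv_mult:
  assumes "has_sderiv f f' t" "has_sderiv g g' t"
  shows "has_sderiv (\<lambda>t. f t * g t) (f' * g t + f t * g') t"
  unfolding has_sderiv_def
proof
  fix e :: expo
  obtain k l p q r where e: "e = (k, l, p, q, r)" by (cases e)
  have "((\<lambda>s. cf (f s) e1 * cf (g s) e2) has_vector_derivative cf f' e1 * cf (g t) e2 + cf (f t) e1
      * cf g' e2) (at t)" for e1 e2
    using has_vector_derivative_mult[of "\<lambda>s. cf (f s) e1" _ t UNIV "\<lambda>s. cf (g s) e2",
        OF has_sderivD[OF assms(1)] has_sderivD[OF assms(2)]]
    by (simp add: add.commute)
  then have "((\<lambda>s. cf (f s * g s) (k, l, p, q, r)) has_vector_derivative (\<Sum>i\<le>k. \<Sum>j\<le>l. \<Sum>a\<le>p. \<Sum>b\<le>q. \<Sum>c\<le>r.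
    (cf f' (i, j, a, b, c) * cf (g t) (k - i, l - j, p - a, q - b, r - c) + cf (f t) (i, j, a, b, c)
        * cf g' (k - i, l - j, p - a, q - b, r - c)))) (at t)"
    unfolding cf_mult by (intro has_vector_derivative_sum)
  then show "((\<lambda>s. cf (f s * g s) e) has_vector_derivative cf (f' * g t + f t * g') e) (at t)"
    unfolding e cf_add by (simp add: cf_mult sum.distrib)
qed

lemma has_sderiv_power:
  assumes "has_sderiv f f' t"
  shows "has_sderiv (\<lambda>t. f t ^ k) (of_nat k * f t ^ (k - 1) * f') t"
proof (induction k)
  case (Suc k)
  show ?case
    using has_sderiv_mult[OF assms Suc] by (cases k) (auto simp: algebra_simps)
qed (auto simp: has_sderiv_const)

lemma has_sderiv_cnj: "has_sderiv f f' t \<Longrightarrow> has_sderiv (\<lambda>t. cnj_series (f t)) (cnj_series f') t"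
  by (auto simp: has_sderiv_def cf_cnj intro!: has_vector_derivative_cnj)

lemma has_sderiv_compose_left:
  assumes f: "has_sderiv f f' t"
  shows "has_sderiv (\<lambda>t. compose_series (f t) u) (compose_series f' u) t"
  unfolding has_sderiv_def
proof
  fix e :: expo
  obtain a b e' where e: "e = (a, b, e')" by (cases e)
  have l: "has_sderiv (\<lambda>t. lift (zcoeff (f t) k l)) (lift (zcoeff f' k l)) t" for k l
    unfolding has_sderiv_def
  proof
    fix e show "((\<lambda>s. cf (lift (zcoeff (f s) k l)) e) has_vector_derivative cf (lift (zcoeff f' k
        l)) e) (at t)"
      using f by (cases e) (auto simp: cf_lift has_sderiv_iff)
  qed
  have "has_sderiv (\<lambda>t. lift (zcoeff (f t) k l) * v) (lift (zcoeff f' k l) * v) t" for k l v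
    using has_sderiv_mult[OF l has_sderiv_const] by simp
  then show "((\<lambda>s. cf (compose_series (f s) u) e) has_vector_derivative cf (compose_series f' u) e)
      (at t)"
    unfolding e cf_compose by (intro has_vector_derivative_sum has_sderivD)
qed

text \<open>Monomials follow from the product rule. In the limit step nothing has to converge: a
  fixed coefficient of both sides depends on finitely many terms of \<open>f\<close> only.\<close>

lemma has_sderiv_compose_right:
  assumes f: "has_sderiv \<Phi> \<Phi>' t" and fo: "\<And>s. fixes_origin (\<Phi> s)"
  shows "has_sderiv (\<lambda>t. compose_series f (\<Phi> t))
    (compose_series (deriv_z f) (\<Phi> t) * \<Phi>' + compose_series (deriv_zbar f) (\<Phi> t) * cnj_series \<Phi>') t"
proof (induction f rule: series_induct)
  case (monom_series x e)
  obtain k l p q r where e: "e = (k, l, p, q, r)" by (cases e)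
  note z = deriv_z_monom[of x k l p q r, folded e] deriv_zbar_monom[of x k l p q r, folded e]
  note o = const_series_of_nat
  have 0: "compose_series 0 u = 0" if "fixes_origin u" for u using cadd_0[OF cadd_compose[OF that]] .
  let ?C = "const_series x * param_monom p q r"
  have "has_sderiv (\<lambda>t. ?C * (\<Phi> t ^ k * cnj_series (\<Phi> t) ^ l))
    (0 * (\<Phi> t ^ k * cnj_series (\<Phi> t) ^ l) + ?C * (of_nat k * \<Phi> t ^ (k - 1) * \<Phi>' * cnj_series (\<Phi> t) ^ l
      + \<Phi> t ^ k * (of_nat l * cnj_series (\<Phi> t) ^ (l - 1) * cnj_series \<Phi>'))) t"
    by (intro has_sderiv_mult has_sderiv_const has_sderiv_power f has_sderiv_cnj)
  moreover have "compose_series (deriv_z (monom_series x e)) (\<Phi> t) * \<Phi>' = ?C * (of_nat k * \<Phi> t ^ (k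
      - 1) * \<Phi>' * cnj_series (\<Phi> t) ^ l)"
    unfolding z by (simp add: compose_mono[OF fo] 0[OF fo] const_series_mult o ac_simps)
  moreover have "compose_series (deriv_zbar (monom_series x e)) (\<Phi> t) * cnj_series \<Phi>' = ?C
      * (\<Phi> t ^ k * (of_nat l * cnj_series (\<Phi> t) ^ (l - 1) * cnj_series \<Phi>'))"
    unfolding z by (simp add: compose_mono[OF fo] 0[OF fo] const_series_mult o ac_simps)
  ultimately show ?case unfolding e compose_mono[OF fo]
      by (simp only: mult_zero_left add_0_left distrib_left)
next
  case (add f g)
  show ?case using has_sderiv_add[OF add]
    by (simp add: compose_add derivationD deriv_z_derivation deriv_zbar_derivation algebra_simps)
next
  case (lim f)
  let ?D = "\<lambda>f. compose_series (deriv_z f) (\<Phi> t) * \<Phi>' + compose_series (deriv_zbar f) (\<Phi> t)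
      * cnj_series \<Phi>'"
  show ?case unfolding has_sderiv_def
  proof
    fix e
    \<comment> \<open>One unit of the margin 2 pays for the derivatives in \<open>?D\<close>, the
      other makes the weight of \<open>e\<close> strictly smaller than the bound.\<close>
    obtain g where g: "has_sderiv (\<lambda>t. compose_series g (\<Phi> t)) (?D g) t" "f - g \<in> Fil 1 (wt 1 e + 2)"
      using lim by blast
    have f: "f = g + (f - g)" by simp
    have e: "wt 1 e < wt 1 e + 2" "wt 1 e < wt 1 e + 2 - 1" by auto
    have 1: "cf (compose_series f (\<Phi> s)) e = cf (compose_series g (\<Phi> s)) e" for s
      by (subst f, unfold compose_add) (use FilD[OF compose_Fil[OF fo g(2)] e(1)] in simp)
    have z: "?D (f - g) \<in> Fil 1 (wt 1 e + 2 - 1)"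
      by (intro Fil_add Fil_mult_right compose_Fil fo Fil_deriv_z Fil_deriv_zbar g)
    have "?D (f - g) = ?D f - ?D g"
      by (simp add: cadd_minus[OF cadd_deriv_z] cadd_minus[OF cadd_deriv_zbar] compose_diff[OF fo]
          algebra_simps)
    then have 2: "cf (?D f) e = cf (?D g) e"
      using FilD[OF z e(2)] by simp
    show "((\<lambda>s. cf (compose_series f (\<Phi> s)) e) has_vector_derivative cf (?D f) e) (at t)"
      using g(1) unfolding 1 2 has_sderiv_def by blast
  qed
qed

text \<open>The invariant of the whole argument. Flow and conjugation stay existential, so each step
  only has to say what happens to \<open>f\<close> and \<open>H\<close>.\<close>

definition flow_conjugate :: "real \<Rightarrow> formal_series \<Rightarrow> formal_series \<Rightarrow> bool" where
  "flow_conjugate a f H \<longleftrightarrow> fixes_origin f \<and> real_series H \<and>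
     (\<exists>\<Phi> u. ham_flow H \<Phi> \<and> canonical_change u \<and> conjugates u f (rotate_map a (\<Phi> 1)))"

text \<open>As \<open>v\<close> inverts \<open>w\<close>, the flow of H o w is v o Phi_t o w, and v
  o u conjugates \<open>f\<close> to the new map provided that \<open>v\<close> can be moved past
  the rotation; this is what \<open>eq\<close> grants.\<close>

lemma flow_conjugate_step:
  assumes N: "flow_conjugate a f H" and w: "canonical_change w" and v: "inverse_change w v"
    and eq: "compose_series v (const_series (cis a) * Z) = const_series (cis a) * v"
  shows "flow_conjugate a f (compose_series H w)"
proof -
  obtain \<Phi> u where f: "fixes_origin f" and H: "cnj_series H = H"
     and \<Phi>: "\<Phi> 0 = Z" "\<And>t. fixes_origin (\<Phi> t)"
       "\<And>t. has_sderiv \<Phi> (const_series (- \<i>) * compose_series (deriv_zbar H) (\<Phi> t)) t"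
     and u: "canonical_change u" "compose_series u f = compose_series (const_series (cis a) * \<Phi> 1) u"
    using N by (auto simp: flow_conjugate_def ham_flow_iff real_series_def conjugates_def
        rotate_map_def)
  have fo: "fixes_origin w" "fixes_origin v" and c: "compose_series w v = Z" "compose_series v w = Z"
    using v by (auto simp: inverse_change_def)
  have fu: "fixes_origin u" using u by (simp add: canonical_change_def)
  have vc: "canonical_change v" using inverse_change_canonical[OF w v] .
  define K where "K = compose_series H w"
  define \<Psi> where "\<Psi> t = compose_series (compose_series v (\<Phi> t)) w" for t
  have HK: "H = compose_series K v"
    by (simp add: K_def compose_assoc fo c compose_id)
  have foPhi: "fixes_origin (const_series (cis a) * \<Phi> 1)"
    using \<Phi>(2) by (simp add: fixes_origin_Fil Fil_const)
  have foZ: "fixes_origin (const_series (cis a) * Z)"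
    using fixes_origin_Z unfolding fixes_origin_Fil by (rule Fil_const)
  have fl: "ham_flow K \<Psi>"
    unfolding ham_flow_iff
  proof (intro conjI allI)
    show "\<Psi> 0 = Z" by (simp add: \<Psi>_def \<Phi> compose_id c)
    show "fixes_origin (\<Psi> t)" for t by (simp add: \<Psi>_def fixes_origin_compose fo \<Phi>)
    fix t
    let ?X = "const_series (- \<i>) * compose_series (deriv_zbar H) (\<Phi> t)"
    let ?D = "compose_series (deriv_z v) (\<Phi> t) * ?X + compose_series (deriv_zbar v) (\<Phi> t)
        * cnj_series ?X"
    have 1: "has_sderiv \<Psi> (compose_series ?D w) t"
      unfolding \<Psi>_def by (intro has_sderiv_compose_left has_sderiv_compose_right \<Phi>)
    have "deriv_z H = cnj_series (deriv_zbar H)"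
      using deriv_z_cnj[of H] H by simp
    then have X: "cnj_series ?X = const_series \<i> * compose_series (deriv_z H) (\<Phi> t)"
      by (simp add: cnj_mult cnj_const cnj_compose \<Phi>)
    \<comment> \<open>Along the flow, \<open>v\<close> moves with velocity -i {v, H}. Writing H as K
      o v turns this into the vector field of K at v times the Jacobian of \<open>v\<close>, which
      is 1.\<close>
    have "?D = const_series (- \<i>) * compose_series (bracket v H) (\<Phi> t)"
      unfolding X bracket_def by (simp add: compose_diff compose_mult \<Phi> const_series_minus
          algebra_simps)
    also have "bracket v H = compose_series (deriv_zbar K) v * bracket v (cnj_series v)"
      unfolding HK by (simp add: bracket_def deriv_z_compose deriv_zbar_compose fo algebra_simps)
    also have "\<dots> = compose_series (deriv_zbar K) v" using vc by (simp add: canonical_change_iff)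
    finally have "compose_series ?D w = const_series (- \<i>)
        * compose_series (compose_series (compose_series (deriv_zbar K) v) (\<Phi> t)) w"
      by (simp add: compose_const_mult)
    also have "\<dots> = const_series (- \<i>) * compose_series (deriv_zbar K) (\<Psi> t)"
      by (simp add: \<Psi>_def compose_assoc fo \<Phi> fixes_origin_compose)
    finally show "has_sderiv \<Psi> (const_series (- \<i>) * compose_series (deriv_zbar K) (\<Psi> t)) t"
      using 1 by simp
  qed
  have "compose_series (compose_series v u) f = compose_series v (compose_series (const_series (cis
      a) * \<Phi> 1) u)"
    using u by (simp add: compose_assoc fu f)
  also have "\<dots> = compose_series (compose_series v (const_series (cis a) * \<Phi> 1)) u"
    by (simp add: compose_assoc fu foPhi)
  also have "compose_series v (const_series (cis a) * \<Phi> 1)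
      = compose_series (compose_series v (const_series (cis a) * Z)) (\<Phi> 1)"
    using \<Phi>(2) foZ by (simp add: compose_assoc compose_const_mult compose_basic)
  also have "\<dots> = const_series (cis a) * compose_series v (\<Phi> 1)" by (simp add: eq compose_const_mult)
  also have "compose_series (const_series (cis a) * compose_series v (\<Phi> 1)) u
     = compose_series (const_series (cis a) * \<Psi> 1) (compose_series v u)"
  proof -
    have "compose_series (\<Psi> 1) (compose_series v u)
        = compose_series (compose_series v (\<Phi> 1)) (compose_series (compose_series w v) u)"
      by (simp add: \<Psi>_def compose_assoc fo fu \<Phi> fixes_origin_compose)
    also have "\<dots> = compose_series (compose_series v (\<Phi> 1)) u" by (simp add: c compose_basic fu)
    finally show ?thesis by (simp add: compose_const_mult)
  qed
  finally have "conjugates (compose_series v u) f (rotate_map a (\<Psi> 1))"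
    by (simp add: conjugates_def rotate_map_def)
  moreover have "real_series K" using H by (simp add: real_series_def K_def cnj_compose fo)
  moreover have "canonical_change (compose_series v u)" using canonical_compose[OF vc u(1)] .
  ultimately show ?thesis using fl f unfolding flow_conjugate_def K_def by blast
qed

section \<open>Substitution of parameters\<close>

definition is_param :: "formal_series \<Rightarrow> bool" where
  "is_param f \<longleftrightarrow> f = lift (zcoeff f 0 0)"

lemma is_param_lift: "is_param (lift c)"
  by (simp add: is_param_def lift_def)

lemma is_param_1: "is_param 1"
  by (simp add: is_param_def lift_def)

lemma is_param_mult: "is_param f \<Longrightarrow> is_param g \<Longrightarrow> is_param (f * g)"
  unfolding is_param_def by (metis is_param_def is_param_lift lift_mult)

lemma is_param_power: "is_param f \<Longrightarrow> is_param (f ^ k)"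
  by (induction k) (auto simp: is_param_1 is_param_mult)

lemma is_param_iff: "is_param f \<longleftrightarrow> (\<forall>k l e. (k, l) \<noteq> (0, 0) \<longrightarrow> cf f (k, l, e) = 0)"
proof
  assume "is_param f"
  then have f: "f = lift (zcoeff f 0 0)" by (simp add: is_param_def)
  show "\<forall>k l e. (k, l) \<noteq> (0, 0) \<longrightarrow> cf f (k, l, e) = 0"
    by (subst f) (auto simp: cf_lift)
next
  assume *: "\<forall>k l e. (k, l) \<noteq> (0, 0) \<longrightarrow> cf f (k, l, e) = 0"
  show "is_param f"
    unfolding is_param_def
  proof (rule cf_eqI)
    fix e :: expo
    obtain k l a b c where e: "e = (k, l, a, b, c)" by (cases e)
    show "cf f e = cf (lift (zcoeff f 0 0)) e"
      using * by (cases "(k, l) = (0, 0)") (auto simp: e cf_lift, simp add: cf_simp)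
  qed
qed

lemma cf_Z_mult: "cf (Z ^ k * Zbar ^ l * f) (k', l', e) = (if k \<le> k' \<and> l \<le> l' then cf f (k' - k, l'
    - l, e) else 0)"
  by (cases e) (auto simp: cf_simp Z_def Zbar_power mult.assoc fps_X_power_mult_nth)

lemma compose_param:
  assumes u: "fixes_origin u" and "is_param f"
  shows "compose_series (f * g) u = f * compose_series g u"
proof -
  have f: "f = lift (zcoeff f 0 0)" using assms by (simp add: is_param_def)
  show ?thesis by (subst f, subst (2) f) (rule compose_lift)
qed

lemma compose_param': "fixes_origin u \<Longrightarrow> is_param f \<Longrightarrow> compose_series f u = f"
  using compose_param[of u f 1] by (simp add: compose_1)

lemma deriv_param: "is_param f \<Longrightarrow> deriv_z f = 0" "is_param f \<Longrightarrow> deriv_zbar f = 0"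
  by (rule cf_eqI; auto simp: is_param_iff cf_derivs)+

lemma deriv_p_monom:
  "deriv_p1 (monom_series x (k, l, p, q, r)) = (if p = 0 then 0 else monom_series (of_nat p * x) (k,
      l, p - 1, q, r))"
  "deriv_p2 (monom_series x (k, l, p, q, r)) = (if q = 0 then 0 else monom_series (of_nat q * x) (k,
      l, p, q - 1, r))"
  "deriv_p3 (monom_series x (k, l, p, q, r)) = (if r = 0 then 0 else monom_series (of_nat r * x) (k,
      l, p, q, r - 1))"
  by ((rule cf_eqI); auto simp: cf_derivs cf_mono split: if_splits)+

text \<open>The substituted series depend on parameters alone and have no constant term, which makes
  every coefficient of the result a finite sum.\<close>

locale param_subst =
  fixes g1 g2 g3 :: formal_series
  assumes g_param: "is_param g1" "is_param g2" "is_param g3"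
    and g_Fil: "g1 \<in> Fil 1 1" "g2 \<in> Fil 1 1" "g3 \<in> Fil 1 1"
begin

definition gm :: "nat \<Rightarrow> nat \<Rightarrow> nat \<Rightarrow> formal_series" where
  "gm p q r = g1 ^ p * g2 ^ q * g3 ^ r"

lemma gm_param: "is_param (gm p q r)"
  unfolding gm_def by (intro is_param_mult is_param_power g_param)

lemma gm_Fil: "gm p q r \<in> Fil 1 (p + q + r)"
  unfolding gm_def using Fil_power[OF g_Fil(1), of p] Fil_power[OF g_Fil(2),
      of q] Fil_power[OF g_Fil(3), of r]
  by (intro Fil_mult) auto

text \<open>The cutoffs are exact: \<open>gm p q r\<close> has total degree at least p + q + r and
  cannot reach the coefficient otherwise.\<close>

definition sub :: "formal_series \<Rightarrow> formal_series" where
  "sub f = mk_series (\<lambda>k l. mk_param (\<lambda>a b c. \<Sum>p\<le>a + b + c. \<Sum>q\<le>a + b + c. \<Sum>r\<le>a + b + c.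
     cf f (k, l, p, q, r) * cf (gm p q r) (0, 0, a, b, c)))"

lemma cf_sub: "cf (sub f) (k, l, a, b, c) = (\<Sum>p\<le>a + b + c. \<Sum>q\<le>a + b + c. \<Sum>r\<le>a + b + c.
     cf f (k, l, p, q, r) * cf (gm p q r) (0, 0, a, b, c))"
  unfolding sub_def by (rule cf_mk)

lemma sub_add: "sub (f + g) = sub f + sub g"
proof (rule cf_eqI)
  fix e show "cf (sub (f + g)) e = cf (sub f + sub g) e"
    by (cases e) (simp add: cf_sub distrib_right sum.distrib)
qed

lemma sub_Fil: "f \<in> Fil 1 N \<Longrightarrow> sub f \<in> Fil 1 N"
proof (rule FilI)
  fix e assume f: "f \<in> Fil 1 N" and w: "wt 1 e < N"
  obtain k l a b c where e: "e = (k, l, a, b, c)" by (cases e)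
  have "cf f (k, l, p, q, r) * cf (gm p q r) (0, 0, a, b, c) = 0" for p q r
  proof (cases "p + q + r \<le> a + b + c")
    case True
    then have "cf f (k, l, p, q, r) = 0" by (intro FilD[OF f]) (use w e in auto)
    then show ?thesis by simp
  next
    case False
    then have "cf (gm p q r) (0, 0, a, b, c) = 0" by (intro FilD[OF gm_Fil]) auto
    then show ?thesis by simp
  qed
  then show "cf (sub f) e = 0" unfolding e cf_sub by (intro sum.neutral ballI)
qed

lemma sub_Fil0: "f \<in> Fil 0 N \<Longrightarrow> sub f \<in> Fil 0 N"
proof (rule FilI)
  fix e assume f: "f \<in> Fil 0 N" and w: "wt 0 e < N"
  obtain k l a b c where e: "e = (k, l, a, b, c)" by (cases e)
  have "cf f (k, l, p, q, r) = 0" for p q r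
    by (intro FilD[OF f]) (use w e in auto)
  then show "cf (sub f) e = 0" by (simp add: e cf_sub)
qed

lemma cadd_sub: "cadd sub"
  by (rule caddI[of _ 0], rule sub_add, rule sub_Fil) simp

lemma triple_delta: "(\<Sum>p'\<le>n. \<Sum>q'\<le>n. \<Sum>r'\<le>n. if p = p' \<and> q = q' \<and> r = r' then h p' q' r' else 0) =
    (if p \<le> n \<and> q \<le> n \<and> r \<le> (n::nat) then h p q r else (0::'b::comm_monoid_add))"
proof -
  have "(\<Sum>r'\<le>n. if p = p' \<and> q = q' \<and> r = r' then h p' q' r' else 0) =
    (if p = p' then (if q = q' then (if r \<le> n then h p' q' r else 0) else 0) else 0)" for p' q'
    by simp
  moreover have "(\<Sum>q'\<le>n. if p = p' then (if q = q' then (if r \<le> n then h p' q' r else 0) else 0)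
      else 0) =
     (if p = p' then (if q \<le> n then (if r \<le> n then h p' q r else 0) else 0) else 0)" for p'
    by simp
  ultimately show ?thesis by simp
qed

lemma sub_mono: "sub (monom_series x (k, l, p, q, r)) = const_series x * (Z ^ k * Zbar ^ l
    * gm p q r)" (is "?L = ?R")
proof (rule cf_eqI)
  fix e :: expo
  obtain k' l' a b c where e: "e = (k', l', a, b, c)" by (cases e)
  let ?n = "a + b + c"
  have "cf ?L e = (\<Sum>p'\<le>?n. \<Sum>q'\<le>?n. \<Sum>r'\<le>?n. if p = p' \<and> q = q' \<and> r = r'
     then (if k = k' \<and> l = l' then x * cf (gm p' q' r') (0, 0, a, b, c) else 0) else 0)"
    unfolding e cf_sub by (intro sum.cong refl) (simp add: cf_mono)
  also have "\<dots> = (if p \<le> ?n \<and> q \<le> ?n \<and> r \<le> ?n then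
     (if k = k' \<and> l = l' then x * cf (gm p q r) (0, 0, a, b, c) else 0) else 0)"
    by (rule triple_delta)
  also have "\<dots> = (if k = k' \<and> l = l' then x * cf (gm p q r) (0, 0, a, b, c) else 0)"
    using FilD[OF gm_Fil, of "(0, 0, a, b, c)" p q r] by auto
  also have "\<dots> = cf ?R e"
    using gm_param[of p q r] by (auto simp: e cf_Z_mult is_param_iff)
  finally show "cf ?L e = cf ?R e" .
qed

lemma sub_mult: "sub (f * g) = sub f * sub g"
proof (rule cadd_multiplicative[OF cadd_sub])
  fix c e c' e' show "sub (monom_series c e * monom_series c' e') = sub (monom_series c e)
      * sub (monom_series c' e')"
    by (cases e; cases e') (simp add: mono_mult sub_mono const_series_mult power_add gm_def ac_simps)
qed

lemma sub_const: "sub (const_series c) = const_series c"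
  by (simp add: mono_eqs(1)[of c] sub_mono gm_def flip: monom_series_def)

lemma sub_1: "sub 1 = 1" using sub_const[of 1] by simp

lemma sub_Z: "sub Z = Z"
  by (subst mono_eqs(2), subst sub_mono) (simp add: gm_def)

lemma sub_param_monom: "sub (param_monom p q r) = gm p q r"
  by (subst mono_eqs(4), subst sub_mono) simp

lemma sub_power: "sub (f ^ k) = sub f ^ k"
  by (induction k) (auto simp: sub_1 sub_mult)

lemmas sub_diff = cadd_minus[OF cadd_sub] and sub_0 = cadd_0[OF cadd_sub]

lemma sub_fixes_origin: "fixes_origin u \<Longrightarrow> fixes_origin (sub u)"
  by (simp add: fixes_origin_Fil sub_Fil0)

lemma sub_deriv_z: "sub (deriv_z f) = deriv_z (sub f)"
proof (rule cf_eqI)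
  fix e show "cf (sub (deriv_z f)) e = cf (deriv_z (sub f)) e"
    by (cases e) (simp add: cf_sub cf_derivs sum_distrib_left mult.assoc)
qed

lemma sub_deriv_zbar: "sub (deriv_zbar f) = deriv_zbar (sub f)"
proof (rule cf_eqI)
  fix e show "cf (sub (deriv_zbar f)) e = cf (deriv_zbar (sub f)) e"
    by (cases e) (simp add: cf_sub cf_derivs sum_distrib_left mult.assoc)
qed

lemma sub_bracket: "sub (bracket f g) = bracket (sub f) (sub g)"
  by (simp add: bracket_def sub_diff sub_mult sub_deriv_z sub_deriv_zbar)

text \<open>Counterpart of \<open>compose_chain\<close> for derivations that act on the parameters
  only. It will be matched with the chain rule for smooth functions.\<close>

lemma sub_chain:
  assumes d: "derivation d" "cadd d" and z: "d Z = 0" "d Zbar = 0" and c: "\<And>c. d (const_series c) = 0"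
  shows "d (sub f) = sub (deriv_p1 f) * d g1 + sub (deriv_p2 f) * d g2 + sub (deriv_p3 f) * d g3"
proof (rule cadd_ext[of "\<lambda>f. d (sub f)"])
  fix x and e :: expo
  obtain k l p q r where e: "e = (k, l, p, q, r)" by (cases e)
  show "d (sub (monom_series x e)) = sub (deriv_p1 (monom_series x e)) * d g1
     + sub (deriv_p2 (monom_series x e)) * d g2 + sub (deriv_p3 (monom_series x e)) * d g3"
    unfolding e deriv_p_monom
    by (auto simp: sub_mono sub_0 gm_def derivationD[OF d(1)] derivation_power[OF d(1)] z c
        const_series_mult
        const_series_of_nat algebra_simps)
qed (auto intro!: cadd_comp[OF d(2)] cadd_plus cadd_mult' cadd_comp[OF cadd_sub] cadd_sub cadd_deriv_p)

end

text \<open>Reality lets substitution commute with conjugation, and hence with composition, where a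
  map and its conjugate occur together.\<close>

locale real_param_subst = param_subst +
  assumes g_real: "cnj_series g1 = g1" "cnj_series g2 = g2" "cnj_series g3 = g3"
begin

lemma gm_real: "cnj_series (gm p q r) = gm p q r"
  by (simp add: gm_def cnj_mult cnj_power g_real)

lemma sub_cnj: "sub (cnj_series f) = cnj_series (sub f)"
proof (rule cadd_ext[of "\<lambda>f. sub (cnj_series f)"])
  fix x and e :: expo
  show "sub (cnj_series (monom_series x e)) = cnj_series (sub (monom_series x e))"
    by (cases e) (simp add: cnj_mono sub_mono cnj_mult cnj_power cnj_const gm_real mult_ac)
qed (auto intro!: cadd_comp[OF cadd_sub] cadd_comp[OF cadd_cnj] cadd_cnj cadd_sub)

lemma sub_compose:
  assumes u: "fixes_origin u"
  shows "sub (compose_series f u) = compose_series (sub f) (sub u)"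
proof (rule cadd_ext[of "\<lambda>f. sub (compose_series f u)"])
  fix x and e :: expo
  obtain k l p q r where e: "e = (k, l, p, q, r)" by (cases e)
  have v: "fixes_origin (sub u)" using u by (rule sub_fixes_origin)
  have "sub (compose_series (monom_series x e) u) = const_series x * gm p q r * (sub u ^ k
      * cnj_series (sub u) ^ l)"
    unfolding e by (simp add: compose_mono u sub_mult sub_const sub_param_monom sub_power sub_cnj)
  also have "\<dots> = compose_series (gm p q r * (const_series x * (Z ^ k * Zbar ^ l))) (sub u)"
    by (simp add: compose_param compose_param' v gm_param compose_const_mult compose_mult
        compose_power compose_basic mult_ac)
  also have "\<dots> = compose_series (sub (monom_series x e)) (sub u)"
    unfolding e sub_mono by (simp add: mult_ac)
  finally show "sub (compose_series (monom_series x e) u)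
      = compose_series (sub (monom_series x e)) (sub u)" .
qed (auto intro!: cadd_comp[OF cadd_sub] cadd_comp[OF cadd_compose] cadd_compose cadd_sub
    sub_fixes_origin u)

lemma has_sderiv_sub:
  assumes f: "has_sderiv f f' t" shows "has_sderiv (\<lambda>t. sub (f t)) (sub f') t"
  unfolding has_sderiv_def
proof
  fix e show "((\<lambda>s. cf (sub (f s)) e) has_vector_derivative cf (sub f') e) (at t)"
    by (cases e) (simp only: cf_sub, intro has_vector_derivative_sum has_vector_derivative_mult_left
        has_sderivD[OF f])
qed

lemma sub_canonical: "canonical_change u \<Longrightarrow> canonical_change (sub u)"
proof -
  assume u: "canonical_change u"
  then obtain w where w: "inverse_change u w" by (auto simp: canonical_change_iff)
  then have "inverse_change (sub u) (sub w)"
    by (auto simp: inverse_change_def sub_fixes_origin sub_Z simp flip: sub_compose)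
  moreover have "bracket (sub u) (cnj_series (sub u)) = 1"
    using u by (simp add: canonical_change_iff sub_1 flip: sub_cnj sub_bracket)
  ultimately show ?thesis by (auto simp: canonical_change_iff)
qed

text \<open>Substitution is a ring homomorphism commuting with plane derivatives, conjugation,
  composition and time derivatives, so every defining equation is transported as it stands.\<close>

lemma sub_flow_conjugate:
  assumes "flow_conjugate a f H" shows "flow_conjugate a (sub f) (sub H)"
proof -
  obtain \<Phi> u where f: "fixes_origin f" and H: "cnj_series H = H"
     and \<Phi>: "\<Phi> 0 = Z" "\<And>t. fixes_origin (\<Phi> t)"
       "\<And>t. has_sderiv \<Phi> (const_series (- \<i>) * compose_series (deriv_zbar H) (\<Phi> t)) t"
     and u: "canonical_change u" "compose_series u f = compose_series (const_series (cis a) * \<Phi> 1) u"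
    using assms by (auto simp: flow_conjugate_def ham_flow_iff real_series_def conjugates_def
        rotate_map_def)
  have fu: "fixes_origin u" using u by (simp add: canonical_change_def)
  have "ham_flow (sub H) (\<lambda>t. sub (\<Phi> t))"
    unfolding ham_flow_iff
  proof (intro conjI allI)
    fix t
    show "has_sderiv (\<lambda>t. sub (\<Phi> t)) (const_series (- \<i>)
        * compose_series (deriv_zbar (sub H)) (sub (\<Phi> t))) t"
      using has_sderiv_sub[OF \<Phi>(3)[of t]] by (simp add: sub_mult sub_const sub_compose \<Phi> sub_deriv_zbar)
  qed (auto simp: \<Phi> sub_Z sub_fixes_origin)
  moreover have "conjugates (sub u) (sub f) (rotate_map a (sub (\<Phi> 1)))"
    using arg_cong[OF u(2), of sub] by (simp add: conjugates_def rotate_map_def sub_compose f fu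
        sub_mult sub_const)
  ultimately show ?thesis
    using sub_canonical[OF u(1)] H f
    by (auto simp: flow_conjugate_def real_series_def sub_fixes_origin simp flip: sub_cnj)
qed

end

section \<open>Lie transforms\<close>

lemma bracket_add: "bracket (f + f') g = bracket f g + bracket f' g" "bracket f (g + g')
    = bracket f g + bracket f g'"
  by (simp_all add: bracket_def derivationD deriv_z_derivation deriv_zbar_derivation algebra_simps)

lemma bracket_0 [simp]: "bracket 0 g = 0" "bracket f 0 = 0"
  using bracket_add(1)[of 0 0 g] bracket_add(2)[of f 0 0] by auto

lemma is_param_const: "is_param (const_series c)"
  by (simp add: is_param_def lift_def const_series_def)

lemma is_param_monom: "is_param (param_monom p q r)"
  by (simp add: is_param_def lift_def param_monom_def)

lemma bracket_param: "is_param f \<Longrightarrow> bracket f g = 0" "is_param g \<Longrightarrow> bracket f g = 0"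
  by (simp_all add: bracket_def deriv_param)

lemma bracket_mult: "bracket (f * f') g = bracket f g * f' + f * bracket f' g"
  by (simp add: bracket_def derivationD deriv_z_derivation deriv_zbar_derivation algebra_simps)

lemma bracket_mult': "bracket f (g * g') = bracket f g * g' + g * bracket f g'"
  by (simp add: bracket_def derivationD deriv_z_derivation deriv_zbar_derivation algebra_simps)

lemma bracket_const: "bracket (const_series c * f) g = const_series c * bracket f g"
  "bracket f (const_series c * g) = const_series c * bracket f g"
  by (simp_all add: bracket_mult bracket_mult' bracket_param is_param_const)

lemma derivs_commute: "deriv_z (deriv_zbar f) = deriv_zbar (deriv_z f)"
  by (rule cf_eqI) (auto simp: cf_derivs)

lemma bracket_jacobi: "bracket (bracket f g) h = bracket (bracket f h) g + bracket f (bracket g h)"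
  by (simp add: bracket_def cadd_minus[OF cadd_deriv_z] cadd_minus[OF cadd_deriv_zbar] derivationD
      deriv_z_derivation deriv_zbar_derivation derivs_commute algebra_simps)

lemma bracket_cnj: "cnj_series (bracket f g) = - bracket (cnj_series f) (cnj_series g)"
  by (simp add: bracket_def cnj_diff cnj_mult deriv_z_cnj deriv_zbar_cnj)

lemma bracket_minus: "bracket f (- g) = - bracket f g"
  using bracket_const(2)[of f "-1" g] by (simp add: const_series_minus)

lemma bracket_Fil: "f \<in> Fil p M \<Longrightarrow> g \<in> Fil p N \<Longrightarrow> bracket f g \<in> Fil p ((M - 1) + (N - 1))"
  unfolding bracket_def by (intro Fil_diff Fil_mult Fil_deriv_z Fil_deriv_zbar)

text \<open>Deprit's recursion: \<open>W(s) = (\<Sum>k. s^k lie_term c k)\<close> is the solution of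
  \<open>W'(s) f = W(s) {f, \<Sum>j. s^j c j}\<close> with \<open>W(0) = id\<close>. Its value at \<open>s = 1\<close> makes sense if
  \<open>c j\<close> has weight at least \<open>j + 3\<close>.\<close>

fun lie_term :: "(nat \<Rightarrow> formal_series) \<Rightarrow> nat \<Rightarrow> formal_series \<Rightarrow> formal_series" where
  "lie_term c 0 f = f"
| "lie_term c (Suc k) f = const_series (1 / of_nat (Suc k)) * (\<Sum>j\<le>k. lie_term c (k
    - j) (bracket f (c j)))"

declare lie_term.simps(2) [simp del]

lemma lie_term_rec: "const_series (of_nat (Suc k)) * lie_term c (Suc k) f = (\<Sum>j\<le>k. lie_term c (k
    - j) (bracket f (c j)))"
proof -
  have "const_series (of_nat (Suc k)) * const_series (1 / of_nat (Suc k)) = 1"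
    unfolding const_series_mult[symmetric] by (simp del: of_nat_Suc)
  then show ?thesis
    unfolding lie_term.simps(2) by (simp only: mult.assoc[symmetric]) simp
qed

lemma const_cancel: "const_series (of_nat (Suc k)) * x = const_series (of_nat (Suc k)) * y \<Longrightarrow> x = y"
proof (rule cf_eqI)
  fix e assume "const_series (of_nat (Suc k)) * x = const_series (of_nat (Suc k)) * y"
  then have "cf (const_series (of_nat (Suc k)) * x) e = cf (const_series (of_nat (Suc k)) * y) e"
      by (rule arg_cong)
  then show "cf x e = cf y e" by (simp del: of_nat_Suc)
qed

lemma lie_term_add: "lie_term c k (f + g) = lie_term c k f + lie_term c k g"
proof (induction k arbitrary: f g rule: less_induct)
  case (less k)
  then show ?case
    by (cases k) (auto simp: lie_term.simps(2) bracket_add sum.distrib distrib_left)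
qed

lemma lie_term_const: "lie_term c k (const_series x * f) = const_series x * lie_term c k f"
proof (induction k arbitrary: f rule: less_induct)
  case (less k)
  show ?case
  proof (cases k)
    case (Suc m)
    have "lie_term c (m - j) (bracket (const_series x * f) (c j)) = const_series x * lie_term c (m
        - j) (bracket f (c j))" for j
      using less Suc by (simp add: bracket_const)
    then show ?thesis unfolding Suc lie_term.simps(2)
      by (simp add: sum_distrib_left[symmetric] mult.left_commute)
  qed simp
qed

lemma lie_term_0: "lie_term c k 0 = 0" using lie_term_const[of c k 0 0] by simp

lemma lie_term_param: "is_param f \<Longrightarrow> lie_term c (Suc k) f = 0"
  by (simp add: lie_term.simps(2) bracket_param lie_term_0)

text \<open>The recursion reaches only generators of index below \<open>k\<close>. This permits
  choosing the generators one at a time.\<close>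

lemma lie_term_cong: "(\<And>j. j < k \<Longrightarrow> c j = c' j) \<Longrightarrow> lie_term c k f = lie_term c' k f"
proof (induction k arbitrary: f rule: less_induct)
  case (less k)
  show ?case
  proof (cases k)
    case (Suc m)
    have "lie_term c (m - j) (bracket f (c j)) = lie_term c' (m - j) (bracket f (c' j))" if "j \<le> m"
        for j
      using less Suc that by simp
    then show ?thesis unfolding Suc lie_term.simps(2) by simp
  qed simp
qed

lemma triangle_sum: "(\<Sum>j\<le>m. \<Sum>i\<le>m - j. h j i) = (\<Sum>k\<le>m. \<Sum>j\<le>k. h j (k - j))" for m :: nat
proof -
  have "(\<Sum>j\<le>m. \<Sum>i\<le>m - j. h j i) = (\<Sum>(j, i)\<in>Sigma {..m} (\<lambda>j. {..m - j}). h j i)"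
    by (rule sum.Sigma) auto
  also have "Sigma {..m} (\<lambda>j. {..m - j}) = {(j, i). j + i \<le> m}" by auto
  finally show ?thesis by (simp add: sum.triangle_reindex_eq)
qed

lemma triangle_sum': "(\<Sum>j\<le>m. \<Sum>i\<le>m - j. h j i) = (\<Sum>i\<le>m. \<Sum>j\<le>m - i. h j i)" for m :: nat
proof -
  have "(\<Sum>j\<le>m. \<Sum>i\<le>m - j. h j i) = (\<Sum>k\<le>m. \<Sum>j\<le>k. h j (k - j))" by (rule triangle_sum)
  also have "\<dots> = (\<Sum>k\<le>m. \<Sum>j\<le>k. h (k - j) j)"
  proof (rule sum.cong[OF refl])
    fix k show "(\<Sum>j\<le>k. h j (k - j)) = (\<Sum>j\<le>k. h (k - j) j)"
      by (rule sum.reindex_bij_witness[of _ "\<lambda>j. k - j" "\<lambda>j. k - j"]) auto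
  qed
  also have "\<dots> = (\<Sum>i\<le>m. \<Sum>j\<le>m - i. h j i)" by (rule triangle_sum[symmetric])
  finally show ?thesis .
qed

text \<open>Bilinear operations of which each \<open>bracket _ (c j)\<close> is a derivation.
  Product and bracket are the two instances, so one argument makes the Lie transform respect
  both.\<close>

definition leibniz :: "(nat \<Rightarrow> formal_series) \<Rightarrow> (formal_series \<Rightarrow> formal_series \<Rightarrow>
    formal_series) \<Rightarrow> bool" where
  "leibniz c B \<longleftrightarrow> (\<forall>f f' g. B (f + f') g = B f g + B f' g) \<and> (\<forall>f g g'. B f (g + g') = B f g + B f g') \<and>
     (\<forall>x f g. B (const_series x * f) g = const_series x * B f g) \<and>
     (\<forall>x f g. B f (const_series x * g) = const_series x * B f g) \<and>
     (\<forall>f g j. bracket (B f g) (c j) = B (bracket f (c j)) g + B f (bracket g (c j)))"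

lemma leibnizD:
  assumes "leibniz c B"
  shows "B (f + f') g = B f g + B f' g" "B f (g + g') = B f g + B f g'"
    "B (const_series x * f) g = const_series x * B f g" "B f (const_series x * g) = const_series x
        * B f g"
    "bracket (B f g) (c j) = B (bracket f (c j)) g + B f (bracket g (c j))"
  using assms unfolding leibniz_def by blast+

lemma leibniz_0: assumes "leibniz c B" shows "B 0 g = 0" "B f 0 = 0"
  using leibnizD(3)[OF assms, of 0 0 g] leibnizD(4)[OF assms, of f 0 0] by auto

lemma leibniz_sum:
  assumes "leibniz c B"
  shows "B (\<Sum>i\<in>A. F i) g = (\<Sum>i\<in>A. B (F i) g)" "B f (\<Sum>i\<in>A. G i) = (\<Sum>i\<in>A. B f (G i))"
  by (induction A rule: infinite_finite_induct) (auto simp: leibnizD[OF assms] leibniz_0[OF assms])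

lemma leibniz_diff:
  assumes "leibniz c B"
  shows "B (f - f') g = B f g - B f' g" "B f (g - g') = B f g - B f g'"
proof -
  show "B (f - f') g = B f g - B f' g"
    using leibnizD(1)[OF assms, of "f - f'" f' g] by simp
  show "B f (g - g') = B f g - B f g'"
    using leibnizD(2)[OF assms, of f "g - g'" g'] by simp
qed

lemma leibniz_mult: "leibniz c (\<lambda>f g. f * g)"
  by (simp add: leibniz_def algebra_simps bracket_mult)

lemma leibniz_bracket: "leibniz c bracket"
  unfolding leibniz_def by (intro conjI allI bracket_add bracket_const bracket_jacobi)

text \<open>Coefficientwise form of W(s) B(f, g) = B(W(s) f, W(s) g). After multiplication by
  \<open>k\<close>, the recursion splits this number into i from acting on \<open>f\<close> and k -
  i from acting on \<open>g\<close>.\<close>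

lemma lie_term_leibniz:
  assumes B: "leibniz c B"
  shows "lie_term c k (B f g) = (\<Sum>i\<le>k. B (lie_term c i f) (lie_term c (k - i) g))"
proof (induction k arbitrary: f g rule: less_induct)
  case (less k)
  show ?case
  proof (cases k)
    case (Suc m)
    have "const_series (of_nat (Suc m)) * lie_term c (Suc m) (B f g) =
      (\<Sum>j\<le>m. lie_term c (m - j) (B (bracket f (c j)) g + B f (bracket g (c j))))"
      by (simp only: lie_term_rec leibnizD(5)[OF B])
    also have "\<dots> = (\<Sum>j\<le>m. \<Sum>i\<le>m - j. B (lie_term c i (bracket f (c j))) (lie_term c (m - j - i) g)) +
      (\<Sum>j\<le>m. \<Sum>i\<le>m - j. B (lie_term c i f) (lie_term c (m - j - i) (bracket g (c j))))"
      by (simp add: lie_term_add less Suc sum.distrib)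
    also have "(\<Sum>j\<le>m. \<Sum>i\<le>m - j. B (lie_term c i (bracket f (c j))) (lie_term c (m - j - i) g)) =
       (\<Sum>k\<le>m. B (\<Sum>j\<le>k. lie_term c (k - j) (bracket f (c j))) (lie_term c (m - k) g))"
      by (subst triangle_sum) (simp add: leibniz_sum[OF B])
    \<comment> \<open>The factor i undoes the division in the recursion; the added summand i = 0
      carries the factor 0.\<close>
    also have "\<dots> = (\<Sum>i\<le>Suc m. const_series (of_nat i) * B (lie_term c i f) (lie_term c (Suc m - i) g))"
      unfolding sum.atMost_Suc_shift
      by (simp only: leibnizD(3)[OF B, symmetric] lie_term_rec diff_Suc_Suc of_nat_0 const_series_0
          mult_zero_left
        leibniz_0[OF B] add_0_left)
    also have "(\<Sum>j\<le>m. \<Sum>i\<le>m - j. B (lie_term c i f) (lie_term c (m - j - i) (bracket g (c j)))) =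
      (\<Sum>i\<le>m. B (lie_term c i f) (\<Sum>j\<le>m - i. lie_term c (m - i - j) (bracket g (c j))))"
      by (subst triangle_sum') (simp add: leibniz_sum[OF B] diff_commute add.commute)
    also have "\<dots> = (\<Sum>i\<le>m. const_series (of_nat (Suc m - i)) * B (lie_term c i f) (lie_term c (Suc m
        - i) g))"
      by (intro sum.cong refl) (simp only: atMost_iff Suc_diff_le leibnizD(4)[OF B,
          symmetric] lie_term_rec)
    also have "\<dots> = (\<Sum>i\<le>Suc m. const_series (of_nat (Suc m - i))
        * B (lie_term c i f) (lie_term c (Suc m - i) g))"
      by simp
    \<comment> \<open>The two factors i and \<open>Suc m - i\<close> add up to \<open>Suc m\<close>,
      the same for all summands, so it can be cancelled at the end.\<close>
    also have "(\<Sum>i\<le>Suc m. const_series (of_nat i) * B (lie_term c i f) (lie_term c (Suc m - i) g)) + \<dots> =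
      (\<Sum>i\<le>Suc m. const_series (of_nat (Suc m)) * B (lie_term c i f) (lie_term c (Suc m - i) g))"
      unfolding sum.distrib[symmetric] distrib_right[symmetric] const_series_add[symmetric]
          of_nat_add[symmetric]
      by (intro sum.cong refl) (simp only: atMost_iff le_add_diff_inverse)
    finally have "const_series (of_nat (Suc m)) * lie_term c (Suc m) (B f g) =
      const_series (of_nat (Suc m)) * (\<Sum>i\<le>Suc m. B (lie_term c i f) (lie_term c (Suc m - i) g))"
      by (simp only: sum_distrib_left)
    then show ?thesis unfolding Suc by (rule const_cancel)
  qed simp
qed

lemma lie_term_cnj: "(\<And>j. j < k \<Longrightarrow> cnj_series (c j) = - c j) \<Longrightarrow> lie_term c k (cnj_series f)
    = cnj_series (lie_term c k f)"
proof (induction k arbitrary: f rule: less_induct)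
  case (less k)
  show ?case
  proof (cases k)
    case (Suc m)
    have "lie_term c (m - j) (bracket (cnj_series f) (c j)) = cnj_series (lie_term c (m
        - j) (bracket f (c j)))" if "j \<le> m" for j
    proof -
      have "bracket (cnj_series f) (c j) = cnj_series (bracket f (c j))"
        using bracket_cnj[of f "c j"] less(2)[of j] that Suc by (simp add: bracket_minus)
      then show ?thesis using less Suc by simp
    qed
    then show ?thesis unfolding Suc lie_term.simps(2)
      by (simp add: cnj_mult cnj_const cadd_sum[OF cadd_cnj])
  qed simp
qed

text \<open>This is W(1), with the sum cut at the weight of the exponent. The cut is exact once
  \<open>c j\<close> has weight at least j + 3, for then the i-th Lie term has weight at least
  i.\<close>

definition lie_transform :: "(nat \<Rightarrow> formal_series) \<Rightarrow> formal_series \<Rightarrow> formal_series" where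
  "lie_transform c f = mk_series (\<lambda>k l. mk_param (\<lambda>p q r. \<Sum>i\<le>wt 3 (k, l, p, q,
      r). cf (lie_term c i f) (k, l, p, q, r)))"

lemma cf_lie_transform: "cf (lie_transform c f) e = (\<Sum>i\<le>wt 3 e. cf (lie_term c i f) e)"
proof (cases e)
  case (fields k l p q r)
  then show ?thesis unfolding lie_transform_def by (simp only: cf_mk)
qed

lemma lie_transform_add: "lie_transform c (f + g) = lie_transform c f + lie_transform c g"
  by (rule cf_eqI) (simp add: cf_lie_transform lie_term_add sum.distrib)

lemma lie_transform_param: "is_param f \<Longrightarrow> lie_transform c f = f"
proof (rule cf_eqI)
  fix e assume f: "is_param f"
  have "cf (lie_transform c f) e = (\<Sum>i\<le>wt 3 e. if i = 0 then cf f e else 0)"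
    unfolding cf_lie_transform
  proof (intro sum.cong refl)
    fix i show "cf (lie_term c i f) e = (if i = 0 then cf f e else 0)"
      using f by (cases i) (auto simp: lie_term_param)
  qed
  then show "cf (lie_transform c f) e = cf f e" by simp
qed

text \<open>A bracket loses weight 2, so the bound j + 3 makes bracketing with \<open>c j\<close>
  raise the weight by j + 1. Order at least 3 in z, zbar keeps the origin fixed for all parameters,
  and the sign condition makes the change real.\<close>

locale generators =
  fixes c :: "nat \<Rightarrow> formal_series"
  assumes c_Fil: "c j \<in> Fil 3 (j + 3)" and c_Fil0: "c j \<in> Fil 0 3"
    and c_real: "cnj_series (c j) = - c j"
begin

text \<open>In the recursion, bracketing with \<open>c j\<close> lowers the index by j + 1 and
  raises the weight by the same amount.\<close>

lemma lie_term_Fil: "f \<in> Fil 3 N \<Longrightarrow> lie_term c k f \<in> Fil 3 (N + k)"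
proof (induction k arbitrary: f N rule: less_induct)
  case (less k)
  show ?case
  proof (cases k)
    case (Suc m)
    have "lie_term c (m - j) (bracket f (c j)) \<in> Fil 3 (N + k)" if "j \<le> m" for j
    proof -
      have "bracket f (c j) \<in> Fil 3 (N + j + 1)"
        by (rule Fil_mono[OF bracket_Fil[OF less(2) c_Fil]]) auto
      then have "lie_term c (m - j) (bracket f (c j)) \<in> Fil 3 (N + j + 1 + (m - j))"
        using less(1)[of "m - j" _ "N + j + 1"] Suc by simp
      then show ?thesis by (rule Fil_mono) (use that Suc in simp)
    qed
    then show ?thesis unfolding Suc lie_term.simps(2) by (intro Fil_const Fil_sum) auto
  qed (use less in simp)
qed

lemma bracket_Fil0: "f \<in> Fil 0 N \<Longrightarrow> bracket f (c j) \<in> Fil 0 (N + 1)"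
  by (rule Fil_mono[OF bracket_Fil[OF _ c_Fil0]]) auto

lemma lie_term_Fil0: "f \<in> Fil 0 N \<Longrightarrow> lie_term c k f \<in> Fil 0 N"
proof (induction k arbitrary: f N rule: less_induct)
  case (less k)
  show ?case
  proof (cases k)
    case (Suc m)
    have "lie_term c (m - j) (bracket f (c j)) \<in> Fil 0 N" if "j \<le> m" for j
      using Fil_mono[OF bracket_Fil0[OF less(2)], of N] less(1) Suc by simp
    then show ?thesis unfolding Suc lie_term.simps(2) by (intro Fil_const Fil_sum) auto
  qed (use less in simp)
qed

lemma lie_transform_approx: "lie_transform c f - (\<Sum>k<N. lie_term c k f) \<in> Fil 3 N"
proof (rule FilI)
  fix e assume "wt 3 e < N"
  have "(\<Sum>k<N. cf (lie_term c k f) e) = (\<Sum>k\<le>wt 3 e. cf (lie_term c k f) e)"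
  proof (rule sum.mono_neutral_right)
    show "\<forall>i\<in>{..<N} - {..wt 3 e}. cf (lie_term c i f) e = 0"
      using FilD[OF lie_term_Fil[of f 0]] by auto
  qed (use \<open>wt 3 e < N\<close> in auto)
  then show "cf (lie_transform c f - (\<Sum>k<N. lie_term c k f)) e = 0" by (simp add: cf_lie_transform)
qed

lemma lie_transform_Fil: "f \<in> Fil 3 N \<Longrightarrow> lie_transform c f \<in> Fil 3 N"
proof (rule FilI)
  fix e assume f: "f \<in> Fil 3 N" and "wt 3 e < N"
  then have "cf (lie_term c k f) e = 0" for k using FilD[OF lie_term_Fil[OF f]] by simp
  then show "cf (lie_transform c f) e = 0" by (simp add: cf_lie_transform)
qed

lemma lie_transform_Fil0: "f \<in> Fil 0 N \<Longrightarrow> lie_transform c f \<in> Fil 0 N"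
proof (rule FilI)
  fix e assume f: "f \<in> Fil 0 N" and "wt 0 e < N"
  then have "cf (lie_term c k f) e = 0" for k using FilD[OF lie_term_Fil0[OF f]] by blast
  then show "cf (lie_transform c f) e = 0" by (simp add: cf_lie_transform)
qed

text \<open>The transform is the identity up to terms of higher weight. Its injectivity and the
  Neumann series of its inverse both rest on this.\<close>

lemma lie_transform_diff_Fil: "f \<in> Fil 3 N \<Longrightarrow> lie_transform c f - f \<in> Fil 3 (N + 1)"
proof (rule FilI)
  fix e assume f: "f \<in> Fil 3 N" and w: "wt 3 e < N + 1"
  have "(\<Sum>k\<le>wt 3 e. cf (lie_term c k f) e) = (\<Sum>k\<le>wt 3 e. if k = 0 then cf f e else 0)"
  proof (intro sum.cong refl)
    fix k show "cf (lie_term c k f) e = (if k = 0 then cf f e else 0)"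
      using FilD[OF lie_term_Fil[OF f], of e k] w by (cases k) auto
  qed
  then show "cf (lie_transform c f - f) e = 0" by (simp add: cf_lie_transform)
qed

lemma cadd_lie_transform: "cadd (lie_transform c)"
  unfolding cadd_def
proof (intro conjI allI)
  fix N
  \<comment> \<open>Total degree bounds weight 3 from below, and the factor 3 is lost on the way
    back to total degree.\<close>
  have "lie_transform c f \<in> Fil 1 N" if "f \<in> Fil 1 (3 * N)" for f
    by (rule Fil_weight_1[OF lie_transform_Fil[OF Fil_weight[OF that]]]) auto
  then show "\<exists>M. \<forall>f\<in>Fil 1 M. lie_transform c f \<in> Fil 1 N" by blast
qed (rule lie_transform_add)

text \<open>The sums over indices below N + 2 satisfy the identity up to pairs with i + j \<ge> N +
  2. Those have weight at least N, as \<open>B\<close> loses at most weight 2.\<close>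

lemma lie_transform_leibniz:
  assumes B: "leibniz c B" and BF: "\<And>M N f g. f \<in> Fil 3 M \<Longrightarrow> g \<in> Fil 3 N \<Longrightarrow> B f g \<in> Fil 3 (M + N - 2)"
  shows "lie_transform c (B f g) = B (lie_transform c f) (lie_transform c g)"
proof (rule Fil_eqI)
  fix N
  define F where "F h = (\<Sum>k<N+2. lie_term c k h)" for h
  have app: "lie_transform c h - F h \<in> Fil 3 (N + 2)" for h unfolding F_def
      by (rule lie_transform_approx)
  have "lie_transform c (B f g) - B (lie_transform c f) (lie_transform c g)
      = (lie_transform c (B f g) - F (B f g)) + (F (B f g) - B (F f) (F g))
    - (B (lie_transform c f - F f) (lie_transform c g) + B (F f) (lie_transform c g - F g))"
    by (simp add: leibniz_diff[OF B])
  moreover have "B (lie_transform c f - F f) (lie_transform c g) \<in> Fil 3 N" using BF[OF app Fil_0]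
      by simp
  moreover have "B (F f) (lie_transform c g - F g) \<in> Fil 3 N" using BF[OF Fil_0 app] by simp
  moreover have "F (B f g) - B (F f) (F g) \<in> Fil 3 N"
  proof -
    let ?b = "\<lambda>i j. B (lie_term c i f) (lie_term c j g)"
    let ?S = "{..<N+2} \<times> {..<N+2}" and ?T = "{(i, j). i + j < N + 2}"
    have "F (B f g) = (\<Sum>(i, j)\<in>?T. ?b i j)"
      by (simp add: F_def lie_term_leibniz[OF B] sum.triangle_reindex)
    moreover have "B (F f) (F g) = (\<Sum>(i, j)\<in>?S. ?b i j)"
      unfolding F_def leibniz_sum(1)[OF B] unfolding leibniz_sum(2)[OF B]
          by (rule sum.cartesian_product)
    moreover have "(\<Sum>(i, j)\<in>?S. ?b i j) = (\<Sum>(i, j)\<in>?S - ?T. ?b i j) + (\<Sum>(i, j)\<in>?T. ?b i j)"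
      by (rule sum.subset_diff) auto
    moreover have "(\<Sum>(i, j)\<in>?S - ?T. ?b i j) \<in> Fil 3 N"
    proof (rule Fil_sum)
      fix x assume x: "x \<in> ?S - ?T"
      obtain i j where ij: "x = (i, j)" by (cases x)
      have "?b i j \<in> Fil 3 (0 + i + (0 + j) - 2)"
        by (intro BF lie_term_Fil Fil_0)
      then have "?b i j \<in> Fil 3 N" by (rule Fil_mono) (use x ij in auto)
      then show "(case x of (i, j) \<Rightarrow> ?b i j) \<in> Fil 3 N" by (simp add: ij)
    qed
    ultimately show ?thesis by (simp add: Fil_uminus)
  qed
  moreover have "lie_transform c (B f g) - F (B f g) \<in> Fil 3 N"
    using Fil_mono[OF app, of N] by simp
  ultimately show "lie_transform c (B f g) - B (lie_transform c f) (lie_transform c g) \<in> Fil 3 N"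
    by (metis Fil_add Fil_diff)
qed

lemma lie_transform_mult: "lie_transform c (f * g) = lie_transform c f * lie_transform c g"
  by (rule lie_transform_leibniz[OF leibniz_mult]) (rule Fil_mono[OF Fil_mult], auto)

lemma lie_transform_bracket: "lie_transform c (bracket f g)
    = bracket (lie_transform c f) (lie_transform c g)"
  by (rule lie_transform_leibniz[OF leibniz_bracket]) (rule Fil_mono[OF bracket_Fil], auto)

lemma lie_transform_1: "lie_transform c 1 = 1" by (simp add: lie_transform_param is_param_1)

lemma lie_transform_power: "lie_transform c (f ^ k) = lie_transform c f ^ k"
  by (induction k) (auto simp: lie_transform_mult lie_transform_1)

lemma lie_transform_cnj: "lie_transform c (cnj_series f) = cnj_series (lie_transform c f)"
proof (rule cf_eqI)
  fix e show "cf (lie_transform c (cnj_series f)) e = cf (cnj_series (lie_transform c f)) e"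
    by (cases e) (simp add: cf_cnj cf_lie_transform lie_term_cnj c_real add.commute)
qed

abbreviation w :: formal_series where "w \<equiv> lie_transform c Z"

lemma fixes_origin_w: "fixes_origin w"
  using fixes_origin_Z by (simp add: fixes_origin_Fil lie_transform_Fil0)

text \<open>A continuous ring homomorphism that fixes constants and parameters and commutes with
  conjugation is substitution of its value at \<open>Z\<close>.\<close>

lemma lie_transform_compose: "lie_transform c f = compose_series f w"
proof (rule cadd_ext[of "lie_transform c"])
  fix x and e :: expo
  obtain k l p q r where e: "e = (k, l, p, q, r)" by (cases e)
  have "lie_transform c Zbar = cnj_series w" using lie_transform_cnj[of Z] by simp
  then show "lie_transform c (monom_series x e) = compose_series (monom_series x e) w"
    unfolding e compose_mono[OF fixes_origin_w]
    by (simp add: monom_series_def lie_transform_mult lie_transform_power lie_transform_param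
        is_param_const is_param_monom mult_ac)
qed (auto intro!: cadd_lie_transform cadd_compose fixes_origin_w)

text \<open>An element of the kernel is minus its own change under the transform, so its weight can
  be raised indefinitely.\<close>

lemma lie_transform_inj: assumes "lie_transform c f = lie_transform c g" shows "f = g"
proof (rule Fil_eqI)
  fix N show "f - g \<in> Fil 3 N"
  proof (induction N)
    case (Suc N)
    have "lie_transform c (f - g) = 0" using assms by (simp add: cadd_minus[OF cadd_lie_transform])
    then show ?case using Fil_uminus[OF lie_transform_diff_Fil[OF Suc]] by simp
  qed simp
qed

text \<open>The inverse of the Lie transform is given by its Neumann series.\<close>

primrec rem :: "nat \<Rightarrow> formal_series" where
  "rem 0 = Z" | "rem (Suc N) = rem N - lie_transform c (rem N)"

lemma rem_Fil: "rem N \<in> Fil 3 N"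
proof (induction N)
  case (Suc N)
  show ?case using Fil_uminus[OF lie_transform_diff_Fil[OF Suc]] by simp
qed simp

lemma rem_Fil0: "rem N \<in> Fil 0 1"
  by (induction N) (use fixes_origin_Z in \<open>simp_all add: fixes_origin_Fil Fil_diff lie_transform_Fil0\<close>)

lemma lie_transform_rem_sum: "lie_transform c (\<Sum>k<N. rem k) = Z - rem N"
  by (induction N) (auto simp: lie_transform_add cadd_0[OF cadd_lie_transform])

text \<open>The sum of all \<open>rem i\<close>; the cut is exact because \<open>rem i\<close> has
  weight at least i.\<close>

definition v :: formal_series where
  "v = mk_series (\<lambda>k l. mk_param (\<lambda>p q r. \<Sum>i\<le>wt 3 (k, l, p, q, r). cf (rem i) (k, l, p, q, r)))"

lemma cf_v: "cf v e = (\<Sum>i\<le>wt 3 e. cf (rem i) e)"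
proof (cases e)
  case (fields k l p q r)
  then show ?thesis unfolding v_def by (simp only: cf_mk)
qed

lemma v_approx: "v - (\<Sum>k<N. rem k) \<in> Fil 3 N"
proof (rule FilI)
  fix e assume "wt 3 e < N"
  have "(\<Sum>k<N. cf (rem k) e) = (\<Sum>k\<le>wt 3 e. cf (rem k) e)"
  proof (rule sum.mono_neutral_right)
    show "\<forall>i\<in>{..<N} - {..wt 3 e}. cf (rem i) e = 0"
      using FilD[OF rem_Fil] by auto
  qed (use \<open>wt 3 e < N\<close> in auto)
  then show "cf (v - (\<Sum>k<N. rem k)) e = 0" by (simp add: cf_v)
qed

lemma fixes_origin_v: "fixes_origin v"
  unfolding fixes_origin_Fil by (rule FilI) (simp add: cf_v FilD[OF rem_Fil0])

lemma lie_transform_v: "lie_transform c v = Z"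
proof (rule Fil_eqI)
  fix N
  have "lie_transform c v - Z = lie_transform c (v - (\<Sum>k<N. rem k)) - rem N"
    by (simp add: cadd_minus[OF cadd_lie_transform] lie_transform_rem_sum)
  then show "lie_transform c v - Z \<in> Fil 3 N" using lie_transform_Fil[OF v_approx] rem_Fil Fil_diff
      by metis
qed

text \<open>\<open>lie_transform_v\<close> says v o w = id. For the other side, w o v and
  \<open>Z\<close> have the same transform w o v o w = w, and the transform is injective.\<close>

lemma inverse_w: "inverse_change w v"
  unfolding inverse_change_def
proof (intro conjI fixes_origin_w fixes_origin_v)
  show vw: "compose_series v w = Z" using lie_transform_v unfolding lie_transform_compose[of v] .
  have "lie_transform c (compose_series w v) = compose_series (compose_series w v) w"
    by (rule lie_transform_compose)
  also have "\<dots> = compose_series w (compose_series v w)"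
    by (rule compose_assoc[OF fixes_origin_w fixes_origin_v])
  also have "\<dots> = lie_transform c Z" by (simp only: vw compose_id)
  finally have "lie_transform c (compose_series w v) = lie_transform c Z" .
  then show "compose_series w v = Z" by (rule lie_transform_inj)
qed

text \<open>The transform respects brackets, so the Jacobian of \<open>w\<close> is the transform of
  that of the identity, namely 1.\<close>

lemma canonical_w: "canonical_change w"
proof -
  have "bracket w (cnj_series w) = lie_transform c (bracket Z Zbar)"
    unfolding lie_transform_bracket lie_transform_cnj[symmetric] cnj_Z ..
  then show ?thesis using inverse_w unfolding canonical_change_iff bracket_Z lie_transform_1 by blast
qed

end

section \<open>Resonant normal form\<close>

lemma zcoeff_ZZ: "zcoeff (Z ^ k * Zbar ^ l) a b = (if k = a \<and> l = b then 1 else 0)"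
  by (auto simp: Z_def Zbar_power fps_X_power_mult_nth)

lemma zcoeff_compose_scale:
  assumes "lift E' = cnj_series (lift E)"
  shows "zcoeff (compose_series f (lift E * Z)) a b = zcoeff f a b * E ^ a * E' ^ b"
proof -
  have p: "lift E ^ k = lift (E ^ k)" for E k by (simp add: lift_def fps_const_power)
  have "(lift E * Z) ^ k * cnj_series (lift E * Z) ^ l = lift (E ^ k * E' ^ l) * (Z ^ k * Zbar ^ l)"
      for k l
    by (simp add: power_mult_distrib cnj_mult assms[symmetric] p lift_mult mult_ac)
  then have "zcoeff (compose_series f (lift E * Z)) a b =
     (\<Sum>k\<le>a + b. \<Sum>l\<le>a + b. if a = k then (if b = l then zcoeff f a b * (E ^ a * E' ^ b) else 0) else 0)"
    by (auto simp: compose_series_def zcoeff_lift_mult zcoeff_ZZ intro!: sum.cong)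
  also have "\<dots> = zcoeff f a b * E ^ a * E' ^ b" by (simp add: double_delta mult.assoc)
  finally show ?thesis .
qed

lemma cf_rotate: "cf (compose_series f (const_series x * Z)) (k, l, e) = x ^ k * cnj x ^ l
    * cf f (k, l, e)"
proof -
  obtain p q r where e: "e = (p, q, r)" by (cases e)
  define E E' :: param_series where "E = fps_const (fps_const (fps_const x))" and "E'
      = fps_const (fps_const (fps_const (cnj x)))"
  have "lift E' = cnj_series (lift E)"
    unfolding E_def E'_def using cnj_const[of x] by (simp add: lift_def const_series_def)
  then have "zcoeff (compose_series f (const_series x * Z)) k l = zcoeff f k l * E ^ k * E' ^ l"
    using zcoeff_compose_scale[of E' E f k l] by (simp add: E_def lift_def const_series_def)
  then show ?thesis
    unfolding e cf_simp by (simp add: E_def E'_def fps_const_power)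
qed

locale resonance =
  fixes n :: nat and lam :: complex
  assumes resonant: "resonant_of_order n lam" and n3: "3 \<le> n" and lam1: "lam * cnj lam = 1"
begin

abbreviation rot :: formal_series where "rot \<equiv> const_series lam * Z"

lemma fixes_origin_rot: "fixes_origin rot"
  using fixes_origin_Z by (simp add: fixes_origin_Fil Fil_const)

lemma bracket_rot: "bracket rot (cnj_series rot) = 1"
proof -
  have "bracket rot (cnj_series rot) = const_series (lam * cnj lam) * bracket Z Zbar"
    by (simp add: cnj_mult cnj_const bracket_const const_series_mult mult.assoc)
  then show ?thesis by (simp add: lam1 bracket_Z)
qed

section \<open>Symmetry under the resonant rotation\<close>

definition invariant :: "formal_series \<Rightarrow> bool" where
  "invariant f \<longleftrightarrow> compose_series f rot = f"

lemma pow_lam: "lam ^ k * cnj lam ^ k = 1"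
  by (simp add: lam1 flip: power_mult_distrib)

text \<open>On the unit circle \<open>cnj lam\<close> is the inverse of \<open>lam\<close>, and
  exact order \<open>n\<close> separates the powers with exponents below \<open>n\<close>.\<close>

lemma lam_pow_iff: "lam ^ k * cnj lam ^ l = 1 \<longleftrightarrow> k mod n = l mod n"
proof -
  have n: "lam ^ n = 1" and p: "\<And>j. 0 < j \<Longrightarrow> j < n \<Longrightarrow> lam ^ j \<noteq> 1"
    using resonant by (auto simp: resonant_of_order_def)
  have nz: "lam \<noteq> 0" using lam1 by auto
  have m: "lam ^ k = lam ^ (k mod n)" for k
  proof -
    have "lam ^ k = lam ^ (n * (k div n) + k mod n)" by simp
    then show ?thesis unfolding power_add power_mult n by simp
  qed
  have *: "\<not> (lam ^ i = lam ^ j)" if "i < j" "j < n" for i j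
  proof
    assume "lam ^ i = lam ^ j"
    also have "lam ^ j = lam ^ i * lam ^ (j - i)" using that by (simp flip: power_add)
    finally have "lam ^ (j - i) = 1" using nz by simp
    then show False using p[of "j - i"] that by auto
  qed
  have "lam ^ k * cnj lam ^ l = 1 \<longleftrightarrow> lam ^ k = lam ^ l"
  proof
    assume "lam ^ k * cnj lam ^ l = 1"
    then have "lam ^ k * cnj lam ^ l * lam ^ l = lam ^ l" by simp
    then show "lam ^ k = lam ^ l" using pow_lam[of l] by (simp add: mult.commute mult.left_commute)
  qed (simp add: pow_lam)
  also have "\<dots> \<longleftrightarrow> k mod n = l mod n"
    using *[of "k mod n" "l mod n"] *[of "l mod n" "k mod n"] n3 m[of k] m[of l]
    by (metis linorder_neqE_nat mod_less_divisor n3 less_le_trans zero_less_numeral)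
  finally show ?thesis .
qed

lemma invariant_iff: "invariant f \<longleftrightarrow> (\<forall>k l e. k mod n \<noteq> l mod n \<longrightarrow> cf f (k, l, e) = 0)"
proof
  assume i: "invariant f"
  show "\<forall>k l e. k mod n \<noteq> l mod n \<longrightarrow> cf f (k, l, e) = 0"
  proof (intro allI impI)
    fix k l e assume "k mod n \<noteq> l mod n"
    then have "lam ^ k * cnj lam ^ l \<noteq> 1" by (simp add: lam_pow_iff)
    moreover have "lam ^ k * cnj lam ^ l * cf f (k, l, e) = cf f (k, l, e)"
      using i by (simp add: invariant_def flip: cf_rotate)
    ultimately show "cf f (k, l, e) = 0" by simp
  qed
next
  assume *: "\<forall>k l e. k mod n \<noteq> l mod n \<longrightarrow> cf f (k, l, e) = 0"
  show "invariant f" unfolding invariant_def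
  proof (rule cf_eqI)
    fix e :: expo
    obtain k l e' where e: "e = (k, l, e')" by (cases e)
    show "cf (compose_series f rot) e = cf f e"
    proof (cases "k mod n = l mod n")
      case False
      then have "cf f (k, l, e') = 0" using * by blast
      then show ?thesis unfolding e cf_rotate by simp
    next
      case True
      then have "lam ^ k * cnj lam ^ l = 1" by (simp add: lam_pow_iff)
      then show ?thesis unfolding e cf_rotate by simp
    qed
  qed
qed

text \<open>The rotation is canonical, so it acts on both arguments of a bracket. The eigenvalue
  \<open>x\<close> is kept general because \<open>Z\<close> has eigenvalue \<open>lam\<close>, while
  Hamiltonians have eigenvalue 1.\<close>

lemma bracket_rot_compose:
  assumes "compose_series f rot = const_series x * f" "invariant g"
  shows "compose_series (bracket f g) rot = const_series x * bracket f g"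
proof -
  have "compose_series (bracket f g) rot = bracket (compose_series f rot) (compose_series g rot)"
    by (simp add: bracket_compose fixes_origin_rot bracket_rot)
  then show ?thesis using assms by (simp add: invariant_def bracket_const)
qed

lemma lie_term_rot:
  assumes "\<And>j. j < k \<Longrightarrow> invariant (c j)" "compose_series f rot = const_series x * f"
  shows "compose_series (lie_term c k f) rot = const_series x * lie_term c k f"
  using assms
proof (induction k arbitrary: f rule: less_induct)
  case (less k)
  show ?case
  proof (cases k)
    case (Suc m)
    have "compose_series (lie_term c (m - j) (bracket f (c j))) rot = const_series x * lie_term c (m
        - j) (bracket f (c j))" if "j \<le> m" for j
      using less Suc that by (intro less(1) bracket_rot_compose) auto
    then show ?thesis unfolding Suc lie_term.simps(2)
      by (simp add: compose_const_mult cadd_sum[OF cadd_compose[OF fixes_origin_rot]]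
          sum_distrib_left mult.left_commute)
  qed (use less in simp)
qed

lemma lie_term_invariant: "(\<And>j. j < k \<Longrightarrow> invariant (c j)) \<Longrightarrow> invariant f \<Longrightarrow> invariant (lie_term c k f)"
  using lie_term_rot[of k c f 1] by (simp add: invariant_def)

lemma invariant_sum: "(\<And>i. i \<in> A \<Longrightarrow> invariant (f i)) \<Longrightarrow> invariant (sum f A)"
  by (simp add: invariant_def cadd_sum[OF cadd_compose[OF fixes_origin_rot]])

end

locale resonant_generators = resonance + generators +
  assumes c_invariant: "invariant (c j)"
begin

lemma w_rot: "compose_series w rot = const_series lam * w"
proof (rule cf_eqI)
  fix e :: expo
  obtain k l e' where e: "e = (k, l, e')" by (cases e)
  have "compose_series (lie_term c i Z) rot = const_series lam * lie_term c i Z" for i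
    by (rule lie_term_rot) (simp_all add: c_invariant compose_basic fixes_origin_rot)
  then have "lam ^ k * cnj lam ^ l * cf (lie_term c i Z) e = lam * cf (lie_term c i Z) e" for i
    by (metis cf_const_mult cf_rotate e)
  then show "cf (compose_series w rot) e = cf (const_series lam * w) e"
    unfolding e cf_rotate cf_const_mult cf_lie_transform sum_distrib_left by (intro sum.cong refl)
qed

text \<open>Conjugating \<open>v\<close> by the rotation gives, because of \<open>w_rot\<close>,
  another series whose composition with \<open>w\<close> is \<open>Z\<close>; injectivity of the
  transform identifies it with \<open>v\<close>.\<close>

lemma v_rot: "compose_series v rot = const_series lam * v"
proof -
  define g where "g = const_series (cnj lam) * compose_series v rot"
  have ll: "const_series (cnj lam) * const_series lam = 1" "const_series lam
      * const_series (cnj lam) = 1"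
    by (simp_all only: const_series_mult[symmetric] lam1 mult.commute[of "cnj lam"] const_series_1)
  have lw: "compose_series v w = Z" using inverse_w by (simp add: inverse_change_def)
  have "compose_series g w = const_series (cnj lam) * compose_series v (const_series lam * w)"
    by (simp only: g_def compose_const_mult compose_assoc[OF fixes_origin_w fixes_origin_rot]
        compose_basic(1)[OF fixes_origin_w])
  also have "compose_series v (const_series lam * w) = compose_series (compose_series v w) rot"
    by (simp only: compose_assoc[OF fixes_origin_rot fixes_origin_w] w_rot)
  also have "\<dots> = rot" by (simp only: lw compose_basic(1)[OF fixes_origin_rot])
  also have "const_series (cnj lam) * rot = Z"
    by (simp only: mult.assoc[symmetric] ll mult_1_left)
  finally have "lie_transform c g = lie_transform c v" unfolding lie_transform_v
      unfolding lie_transform_compose[of g] .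
  then have "v = g" by (rule lie_transform_inj[symmetric])
  have "const_series lam * v = const_series lam * g" by (simp flip: \<open>v = g\<close>)
  also have "\<dots> = compose_series v rot"
    by (simp only: g_def mult.assoc[symmetric] ll mult_1_left)
  finally show ?thesis by simp
qed

end

context resonance
begin

text \<open>Bookkeeping modulo the first parameter, which is epsilon: a Hamiltonian whose z zbar
  coefficient is epsilon belongs here, and brackets with the generators fall into
  \<open>res_class0\<close>, where z^n occurs only together with epsilon.\<close>

definition res_class :: "formal_series set" where
  "res_class = {f. invariant f \<and> f \<in> Fil 0 2 \<and> (\<forall>b c. cf f (1, 1, 0, b, c) = 0)}"

definition res_class0 :: "formal_series set" where
  "res_class0 = {f. invariant f \<and> f \<in> Fil 0 3 \<and> (\<forall>b c. cf f (n, 0, 0, b, c) = 0)}"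

lemma res_class0_res_class: "f \<in> res_class0 \<Longrightarrow> f \<in> res_class"
proof -
  assume f: "f \<in> res_class0"
  then have "cf f (1, 1, 0, b, c) = 0" for b c
    by (intro FilD[of _ 0 3]) (auto simp: res_class0_def)
  then show ?thesis using f Fil_mono[of f 0 3 2] by (auto simp: res_class0_def res_class_def)
qed

lemma res_class0_sum: "(\<And>i. i \<in> A \<Longrightarrow> f i \<in> res_class0) \<Longrightarrow> sum f A \<in> res_class0"
  by (auto simp: res_class0_def intro: invariant_sum Fil_sum)

lemma res_class0_const: "f \<in> res_class0 \<Longrightarrow> const_series x * f \<in> res_class0"
  by (auto simp: res_class0_def invariant_def compose_const_mult intro: Fil_const)

text \<open>A pure z^n in the bracket arises from differentiating a resonant z^i zbar with i \<le> n
  in zbar, and resonance forces i = 1. Such a term is absent from \<open>g\<close> and carries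
  epsilon in \<open>f\<close>.\<close>

lemma bracket_res_class:
  assumes f: "f \<in> res_class" and g: "invariant g" "g \<in> Fil 0 3" "\<And>k e. cf g (k, k, e) = 0"
  shows "bracket f g \<in> res_class0"
proof -
  have fi: "invariant f" "f \<in> Fil 0 2" "\<And>b c. cf f (1, 1, 0, b, c) = 0" using f
      by (auto simp: res_class_def)
  have "invariant (bracket f g)" using bracket_rot_compose[of f 1 g] fi g by (simp add: invariant_def)
  moreover have "bracket f g \<in> Fil 0 3"
    by (rule Fil_mono[OF bracket_Fil[OF fi(2) g(2)]]) simp
  moreover have "cf (bracket f g) (n, 0, 0, b, c) = 0" for b c
  proof -
    have gz: "cf g (i, 1, e) = 0" if "i \<le> n" for i e
    proof (cases "i mod n = 1 mod n")
      case True
      then have "i = 1" using that n3 by (cases "i = n") auto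
      then show ?thesis using g(3) by simp
    qed (use g(1) invariant_iff in blast)
    have fz: "cf f (i, 1, 0, e) = 0" if "i \<le> n" for i e
    proof (cases "i mod n = 1 mod n")
      case True
      then have "i = 1" using that n3 by (cases "i = n") auto
      then show ?thesis using fi(3) by (cases e) simp
    qed (use fi(1) invariant_iff in blast)
    have 1: "cf (deriv_z f * deriv_zbar g) (n, 0, 0, b, c) = 0"
      unfolding cf_mult
    proof (intro sum.neutral ballI)
      fix i j x y z :: nat
      have "cf (deriv_zbar g) (n - i, 0 - j, 0 - x, b - y, c - z) = 0"
        using gz[of "n - i"] by (simp add: cf_derivs)
      then show "cf (deriv_z f) (i, j, x, y, z) * cf (deriv_zbar g) (n - i, 0 - j, 0 - x, b - y, c
          - z) = 0"
        by (simp only: mult_zero_right)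
    qed
    have 2: "cf (deriv_zbar f * deriv_z g) (n, 0, 0, b, c) = 0"
      unfolding cf_mult
    proof (intro sum.neutral ballI)
      fix i j x y z :: nat assume "i \<in> {..n}" "j \<in> {..0}" "x \<in> {..0}"
      then have "cf (deriv_zbar f) (i, j, x, y, z) = 0"
        using fz[of i] by (simp add: cf_derivs)
      then show "cf (deriv_zbar f) (i, j, x, y, z) * cf (deriv_z g) (n - i, 0 - j, 0 - x, b - y, c
          - z) = 0"
        by (simp only: mult_zero_left)
    qed
    show ?thesis by (simp add: bracket_def 1 2)
  qed
  ultimately show ?thesis by (simp add: res_class0_def)
qed

lemma lie_term_res_class:
  assumes c: "\<And>j. invariant (c j)" "\<And>j. c j \<in> Fil 0 3" "\<And>j k e. cf (c j) (k, k, e) = 0"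
  shows "f \<in> res_class \<Longrightarrow> lie_term c (Suc k) f \<in> res_class0"
proof (induction k arbitrary: f rule: less_induct)
  case (less k)
  have "lie_term c (k - j) (bracket f (c j)) \<in> res_class0" if "j \<le> k" for j
  proof (cases "k - j")
    case 0
    then show ?thesis using bracket_res_class[OF less(2) c] by simp
  next
    case (Suc i)
    then show ?thesis using less(1)[of i] res_class0_res_class[OF bracket_res_class[OF less(2) c]]
        by simp
  qed
  then show ?case unfolding lie_term.simps(2) by (intro res_class0_const res_class0_sum) auto
qed

end

text \<open>Solution of the homological equation for the leading term \<open>A z\<^sup>2 zbar\<^sup>2\<close> in weight \<open>k + 5\<close>.\<close>

definition hom_sol :: "complex \<Rightarrow> nat \<Rightarrow> formal_series \<Rightarrow> formal_series" where
  "hom_sol A k Q = mk_series (\<lambda>K L. mk_param (\<lambda>p q r.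
     if wt 3 (K, L, p, q, r) = k + 3 \<and> K \<noteq> L
     then - of_nat (Suc k) * cf Q (Suc K, Suc L, p, q, r) / (2 * A * (of_nat L - of_nat K)) else 0))"

lemma cf_hom_sol: "cf (hom_sol A k Q) (K, L, e) = (if wt 3 (K, L, e) = k + 3 \<and> K \<noteq> L
     then - of_nat (Suc k) * cf Q (Suc K, Suc L, e) / (2 * A * (of_nat L - of_nat K)) else 0)"
  unfolding hom_sol_def by (cases e) (simp only: cf_mk)

text \<open>The guard makes the recursion terminate and leaves out the contribution of the unknown
  generator itself. The sum stops at \<open>Suc k\<close> because for a Hamiltonian of weight 4 the
  later Lie terms lie above weight k + 5, where the equation is solved.\<close>

function generator :: "complex \<Rightarrow> formal_series \<Rightarrow> nat \<Rightarrow> formal_series" where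
  "generator A H k = hom_sol A k (\<Sum>i\<le>Suc k. lie_term (\<lambda>j. if j < k then generator A H j else 0) i H)"
  by pat_completeness auto
termination by (relation "Wellfounded.measure (\<lambda>(A, H, k). k)") auto

declare generator.simps [simp del]

lemma cf_bracket_quartic:
  "cf (bracket (monom_series A (2, 2, 0, 0, 0)) g) (K, L, e) =
    (if 1 \<le> K \<and> 1 \<le> L then 2 * A * (of_nat L - of_nat K) * cf g (K - 1, L - 1, e) else 0)"
proof -
  have z: "deriv_z (monom_series A (2, 2, 0, 0, 0)) = const_series (2 * A) * (Z ^ 1 * Zbar ^ 2)"
    "deriv_zbar (monom_series A (2, 2, 0, 0, 0)) = const_series (2 * A) * (Z ^ 2 * Zbar ^ 1)"
    unfolding deriv_z_monom deriv_zbar_monom by (simp_all add: monom_series_def mult.commute)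
  have "bracket (monom_series A (2, 2, 0, 0, 0)) g = const_series (2 * A) *
     (Z ^ 1 * Zbar ^ 2 * deriv_zbar g - Z ^ 2 * Zbar ^ 1 * deriv_z g)"
    unfolding bracket_def z by (simp only: mult.assoc right_diff_distrib)
  moreover have "cf (Z ^ 1 * Zbar ^ 2 * deriv_zbar g - Z ^ 2 * Zbar ^ 1 * deriv_z g) (K, L, e) =
    (if 1 \<le> K \<and> 1 \<le> L then (of_nat L - of_nat K) * cf g (K - 1, L - 1, e) else 0)"
  proof -
    obtain p q r where e: "e = (p, q, r)" by (cases e)
    show ?thesis
      unfolding cf_diff cf_Z_mult
      by (cases K; cases "K - 1"; cases L; cases "L - 1") (auto simp: e cf_derivs algebra_simps)
  qed
  ultimately show ?thesis by simp
qed

text \<open>The situation after changing the parameters, rotating, and dropping pure parameter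
  terms. \<open>H11\<close> and \<open>Hn0\<close> push z zbar and z^n above the weight 4 of the
  quartic term.\<close>

locale quartic_hamiltonian = resonance +
  fixes H :: formal_series
  assumes H_invariant: "invariant H" and H_real: "cnj_series H = H"
    and H00: "\<And>e. cf H (0, 0, e) = 0" and H11: "\<And>e. cf H (1, 1, e) = (if e = (1, 0, 0) then 1 else 0)"
    and A_nz: "cf H (2, 2, 0, 0, 0) \<noteq> 0" and Hn0: "cf H (n, 0, 0, 0, 0) = 0"
begin

definition A :: complex where "A = cf H (2, 2, 0, 0, 0)"

lemma A_real: "cnj A = A"
  using cf_cnj[of H 2 2 0 0 0] by (simp add: A_def H_real)

abbreviation c :: "nat \<Rightarrow> formal_series" where "c \<equiv> generator A H"

lemma c_unfold: "c k = hom_sol A k (\<Sum>i\<le>Suc k. lie_term (\<lambda>j. if j < k then c j else 0) i H)"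
  by (rule generator.simps)

lemma c_invariant: "invariant (c k)"
proof (induction k rule: less_induct)
  case (less k)
  define Q where "Q = (\<Sum>i\<le>Suc k. lie_term (\<lambda>j. if j < k then c j else 0) i H)"
  have ck: "c k = hom_sol A k Q" unfolding Q_def by (rule c_unfold)
  have "invariant 0" by (simp add: invariant_iff)
  then have Q: "invariant Q" unfolding Q_def using less
      by (intro invariant_sum lie_term_invariant H_invariant) auto
  have sh: "K mod n = L mod n" if "Suc K mod n = Suc L mod n" for K L
  proof -
    have "lam ^ Suc K * cnj lam ^ Suc L = (lam * cnj lam) * (lam ^ K * cnj lam ^ L)"
      by (simp only: power_Suc mult_ac)
    then show ?thesis using that unfolding lam1 by (simp only: lam_pow_iff[symmetric] mult_1_left)
  qed
  show ?case
    unfolding invariant_iff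
  proof (intro allI impI)
    fix K L e assume "K mod n \<noteq> L mod n"
    then have "cf Q (Suc K, Suc L, e) = 0" using Q sh unfolding invariant_iff by blast
    then show "cf (c k) (K, L, e) = 0" unfolding ck cf_hom_sol by simp
  qed
qed

text \<open>The right side \<open>Q\<close> is real and \<open>A\<close> is real, while the divisor
  L - K changes sign when z and zbar are exchanged.\<close>

lemma c_real: "cnj_series (c k) = - c k"
proof (induction k rule: less_induct)
  case (less k)
  define Q where "Q = (\<Sum>i\<le>Suc k. lie_term (\<lambda>j. if j < k then c j else 0) i H)"
  have ck: "c k = hom_sol A k Q" unfolding Q_def by (rule c_unfold)
  have "cnj_series (lie_term (\<lambda>j. if j < k then c j else 0) i H) = lie_term (\<lambda>j. if j < k then c j
      else 0) i H" for i
    using less lie_term_cnj[of i "\<lambda>j. if j < k then c j else 0" H] by (simp add: H_real cnj_zero)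
  then have Q: "cnj_series Q = Q" unfolding Q_def cadd_sum[OF cadd_cnj] by (rule sum.cong[OF refl])
  show ?case
  proof (rule cf_eqI)
    fix e :: expo
    obtain K L a b d where e: "e = (K, L, a, b, d)" by (cases e)
    note q = cf_cnj[of Q "Suc K" "Suc L" a b d, unfolded Q, symmetric]
    have w: "wt 3 (L, K, a, b, d) = wt 3 (K, L, a, b, d)" by simp
    have m: "2 * A * (of_nat K - of_nat L) = - (2 * A * (of_nat L - of_nat K))"
      by (simp add: algebra_simps)
    show "cf (cnj_series (c k)) e = cf (- c k) e"
    proof (cases "wt 3 (K, L, a, b, d) = k + 3 \<and> K \<noteq> L")
      case True
      then have "cf (cnj_series (c k)) e = - of_nat (Suc k) * cf Q (Suc K, Suc L, a, b, d) / (2 * A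
          * (of_nat K - of_nat L))"
        unfolding ck e cf_cnj cf_hom_sol w by (simp add: A_real q del: wt.simps of_nat_Suc)
      then show ?thesis using True unfolding m by (simp add: ck e cf_hom_sol del: wt.simps of_nat_Suc)
    next
      case False
      then show ?thesis unfolding ck e cf_uminus cf_cnj cf_hom_sol w by auto
    qed
  qed
qed

lemma c_Fil: "c k \<in> Fil 3 (k + 3)"
proof (rule FilI)
  fix e assume "wt 3 e < k + 3"
  moreover obtain K L e' where e: "e = (K, L, e')" by (cases e)
  ultimately show "cf (c k) e = 0" unfolding c_unfold[of k] e cf_hom_sol by simp
qed

lemma c_diag: "cf (c k) (K, K, e) = 0"
  unfolding c_unfold[of k] cf_hom_sol by simp

text \<open>If K + L < 3 then K and L are smaller than n, so resonance means K = L, and diagonal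
  terms are absent from the generators.\<close>

lemma c_Fil0: "c k \<in> Fil 0 3"
proof (rule FilI)
  fix e :: expo assume w: "wt 0 e < 3"
  obtain K L e' where e: "e = (K, L, e')" by (cases e)
  then have "K + L < 3" using w by (cases e') simp
  then have "K mod n = K" "L mod n = L" using n3 by auto
  then show "cf (c k) e = 0" using c_invariant[of k] c_diag unfolding invariant_iff e by metis
qed

sublocale resonant_generators n lam c
  by unfold_locales (rule c_Fil c_Fil0 c_real c_invariant)+

text \<open>Weight below 5 allows one parameter with K + L \<le> 1, or none with K + L \<le> 4.
  Resonance leaves pure parameter terms, z zbar, z^n, zbar^n without parameters, all excluded by the
  assumptions, and z^2 zbar^2.\<close>

lemma H_quartic: "H - monom_series A (2, 2, 0, 0, 0) \<in> Fil 3 5"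
proof (rule FilI)
  fix e assume w: "wt 3 e < 5"
  obtain K L p q r where e: "e = (K, L, p, q, r)" by (cases e)
  have nz: "cf H (0, n, 0, 0, 0) = 0" using Hn0 cf_cnj[of H 0 n 0 0 0] by (simp add: H_real)
  show "cf (H - monom_series A (2, 2, 0, 0, 0)) e = 0"
  proof (cases "K mod n = L mod n")
    case False
    then show ?thesis using H_invariant unfolding invariant_iff by (auto simp: e cf_mono)
  next
    case True
    have KL: "K + L + 3 * (p + q + r) < 5" using w by (simp add: e)
    \<comment> \<open>Since K + L < 5 and n \<ge> 3, the exponents cannot differ by a larger
      multiple of n.\<close>
    consider "K = L" | "K = L + n" | "L = K + n"
    proof (cases "K < n \<and> L < n")
      case True
      then show ?thesis using \<open>K mod n = L mod n\<close> that by simp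
    next
      case False
      then have "K \<ge> n \<or> L \<ge> n" by auto
      then show ?thesis
      proof
        assume "K \<ge> n"
        then have "L < n" "K - n < n" using KL n3 by auto
        then have "K - n = L" using True \<open>n \<le> K\<close> by (simp add: le_mod_geq)
        then show ?thesis using that \<open>n \<le> K\<close> by auto
      next
        assume "L \<ge> n"
        then have "K < n" "L - n < n" using KL n3 by auto
        then have "L - n = K" using True \<open>n \<le> L\<close> by (simp add: le_mod_geq)
        then show ?thesis using that \<open>n \<le> L\<close> by auto
      qed
    qed
    then show ?thesis
    proof cases
      case 1
      then consider "K = 0" | "K = 1" "p + q + r = 0" | "K = 2" "p + q + r = 0" using KL by force
      then show ?thesis using 1 H00 H11[of "(0, 0, 0)"] by cases (auto simp: e cf_mono A_def)
    next
      case 2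
      then have "L = 0" "p = 0" "q = 0" "r = 0" using KL n3 by auto
      then show ?thesis using 2 Hn0 by (auto simp: e cf_mono)
    next
      case 3
      then have "K = 0" "p = 0" "q = 0" "r = 0" using KL n3 by auto
      then show ?thesis using 3 nz by (auto simp: e cf_mono)
    qed
  qed
qed

lemma H_Fil: "H \<in> Fil 3 4"
proof -
  have "monom_series A (2, 2, 0, 0, 0) \<in> Fil 3 4" by (rule mono_Fil) simp
  then show ?thesis using Fil_add[OF Fil_mono[OF H_quartic, of 4], of "monom_series A (2, 2, 0, 0,
      0)"] by simp
qed

lemma normal_form_low: "wt 3 e < 5 \<Longrightarrow> cf (compose_series H w) e = cf H e"
proof -
  assume "wt 3 e < 5"
  then have "cf (lie_transform c H - H) e = 0" using FilD[OF lie_transform_diff_Fil[OF H_Fil], of e]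
      by simp
  then show ?thesis by (simp add: lie_transform_compose[of H])
qed

text \<open>In weight k + 5 the generators beyond \<open>c k\<close> are invisible, and
  \<open>c k\<close> enters only through its bracket with the quartic term. \<open>hom_sol\<close>
  was chosen so that this bracket cancels what the earlier generators leave.\<close>

lemma normal_form:
  assumes "K \<noteq> L"
  shows "cf (compose_series H w) (Suc K, Suc L, e) = 0"
proof (cases "wt 3 (K, L, e) < 3")
  case True
  obtain p q r where e: "e = (p, q, r)" by (cases e)
  have w: "wt 3 (Suc K, Suc L, e) < 5" using True by (simp add: e)
  have "cf H (Suc K, Suc L, e) = cf (monom_series A (2, 2, 0, 0, 0)) (Suc K, Suc L, e)"
    using FilD[OF H_quartic w] by simp
  also have "\<dots> = 0" using assms by (auto simp: cf_mono)
  finally show ?thesis using normal_form_low[OF w] by simp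
next
  case False
  then obtain k where k: "wt 3 (K, L, e) = k + 3" by (metis add.commute le_Suc_ex not_less)
  obtain p q r where e: "e = (p, q, r)" by (cases e)
  let ?E = "(Suc K, Suc L, e)"
  have w: "wt 3 ?E = k + 5" using k by (simp add: e)
  let ?c' = "\<lambda>j. if j < k then c j else 0"
  let ?Q = "\<Sum>i\<le>Suc k. lie_term ?c' i H"
  have eq: "lie_term c i H = lie_term ?c' i H" if "i \<le> k" for i
    by (rule lie_term_cong) (use that in auto)
  \<comment> \<open>The summand j = k of the recursion is the only place where \<open>c k\<close>
    occurs; setting \<open>c k\<close> to 0 removes exactly this summand.\<close>
  have S: "lie_term c (Suc k) H = lie_term ?c' (Suc k) H + const_series (1 / of_nat (Suc k))
      * bracket H (c k)"
  proof -
    have "(\<Sum>j\<le>k. lie_term c (k - j) (bracket H (c j))) = (\<Sum>j<k. lie_term c (k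
        - j) (bracket H (c j))) + bracket H (c k)"
      by (simp flip: lessThan_Suc_atMost)
    also have "(\<Sum>j<k. lie_term c (k - j) (bracket H (c j))) = (\<Sum>j<k. lie_term ?c' (k
        - j) (bracket H (?c' j)))"
    proof (rule sum.cong[OF refl])
      fix j assume j: "j \<in> {..<k}"
      have "lie_term c (k - j) (bracket H (c j)) = lie_term ?c' (k - j) (bracket H (c j))"
          by (rule lie_term_cong) auto
      then show "lie_term c (k - j) (bracket H (c j)) = lie_term ?c' (k - j) (bracket H (?c' j))"
          using j by simp
    qed
    also have "\<dots> = (\<Sum>j\<le>k. lie_term ?c' (k - j) (bracket H (?c' j)))"
      by (simp add: lie_term_0 flip: lessThan_Suc_atMost)
    finally show ?thesis unfolding lie_term.simps(2) by (simp only: distrib_left)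
  qed
  have "cf (compose_series H w) ?E = (\<Sum>i\<le>k + 5. cf (lie_term c i H) ?E)"
    by (simp only: lie_transform_compose[of H, symmetric] cf_lie_transform w)
  \<comment> \<open>From i = k + 2 on, the i-th Lie term has weight at least 4 + i, more than k +
    5.\<close>
  also have "\<dots> = (\<Sum>i\<le>Suc k. cf (lie_term c i H) ?E)"
  proof (rule sum.mono_neutral_right)
    show "\<forall>i\<in>{..k + 5} - {..Suc k}. cf (lie_term c i H) ?E = 0"
    proof
      fix i assume "i \<in> {..k + 5} - {..Suc k}"
      then show "cf (lie_term c i H) ?E = 0" using FilD[OF lie_term_Fil[OF H_Fil], of ?E i] w by simp
    qed
  qed auto
  also have "\<dots> = (\<Sum>i\<le>k. cf (lie_term ?c' i H) ?E) + cf (lie_term c (Suc k) H) ?E"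
    by (simp add: eq)
  also have "\<dots> = cf ?Q ?E + 1 / of_nat (Suc k) * cf (bracket H (c k)) ?E"
    by (simp add: S)
  also have "cf (bracket H (c k)) ?E = cf (bracket (monom_series A (2, 2, 0, 0, 0)) (c k)) ?E"
  proof -
    \<comment> \<open>The remainder of \<open>H\<close> has weight 5 and \<open>c k\<close> has
      weight k + 3, so after the loss of 2 their bracket starts at k + 6.\<close>
    have "bracket (H - monom_series A (2, 2, 0, 0, 0)) (c k) \<in> Fil 3 (5 - 1 + (k + 3 - 1))"
      by (rule bracket_Fil[OF H_quartic c_Fil])
    then have "cf (bracket (H - monom_series A (2, 2, 0, 0, 0)) (c k)) ?E = 0"
      by (rule FilD) (use w in simp)
    moreover have "bracket (H - monom_series A (2, 2, 0, 0, 0)) (c k) =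
      bracket H (c k) - bracket (monom_series A (2, 2, 0, 0, 0)) (c k)"
      using bracket_add(1)[of "H - monom_series A (2, 2, 0, 0, 0)" "monom_series A (2, 2, 0, 0, 0)"
          "c k"] by simp
    ultimately show ?thesis by simp
  qed
  also have "\<dots> = 2 * A * (of_nat L - of_nat K) * cf (c k) (K, L, e)"
    by (simp add: cf_bracket_quartic)
  also have "cf (c k) (K, L, e) = - of_nat (Suc k) * cf ?Q ?E / (2 * A * (of_nat L - of_nat K))"
    unfolding c_unfold[of k] cf_hom_sol using assms k by simp
  also have "cf ?Q ?E + 1 / of_nat (Suc k) * (2 * A * (of_nat L - of_nat K) *
     (- of_nat (Suc k) * cf ?Q ?E / (2 * A * (of_nat L - of_nat K)))) = 0"
  proof -
    have "A \<noteq> 0" "(of_nat L - of_nat K :: complex) \<noteq> 0" "(of_nat (Suc k) :: complex) \<noteq> 0"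
      using A_nz assms by (auto simp: A_def simp del: of_nat_Suc)
    then show ?thesis by (simp del: cf_sum of_nat_Suc)
  qed
  finally show ?thesis .
qed

lemma H_res_class: "H \<in> res_class"
proof -
  have "H \<in> Fil 0 2"
  proof (rule FilI)
    fix e :: expo assume "wt 0 e < 2"
    moreover obtain K L p q r where e: "e = (K, L, p, q, r)" by (cases e)
    ultimately have "(K = 0 \<and> L = 0) \<or> (K = 1 \<and> L = 0) \<or> (K = 0 \<and> L = 1)" by auto
    then show "cf H e = 0" using H00 H_invariant n3 unfolding invariant_iff e by auto
  qed
  then show ?thesis by (simp add: res_class_def H_invariant H11[unfolded One_nat_def])
qed

text \<open>All Lie terms of positive index lie in \<open>res_class0\<close>, which has none of
  these coefficients. So z zbar and the epsilon-free part of z^n keep their exact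
  coefficients.\<close>

lemma normal_form_unchanged:
  assumes "wt 0 e < 3 \<or> (\<exists>b c. e = (n, 0, 0, b, c))"
  shows "cf (compose_series H w) e = cf H e"
proof -
  have "cf (lie_term c i H) e = 0" if "0 < i" for i
  proof -
    have "lie_term c i H \<in> res_class0" using lie_term_res_class[OF c_invariant c_Fil0 c_diag
        H_res_class, where k = "i - 1"] that by simp
    then show ?thesis using assms FilD[of "lie_term c i H" 0 3 e] by (auto simp: res_class0_def)
  qed
  then have "(\<Sum>i\<le>wt 3 e. cf (lie_term c i H) e) = (\<Sum>i\<le>wt 3 e. if i = 0 then cf H e else 0)"
    by (intro sum.cong) auto
  then show ?thesis by (simp add: lie_transform_compose[of H, symmetric] cf_lie_transform)
qed

end

section \<open>Smooth functions\<close>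

lemma dir_deriv_cong:
  assumes "open S" "x \<in> S" "\<And>y. y \<in> S \<Longrightarrow> f y = g y"
  shows "dir_deriv v f x = dir_deriv v g x" "f differentiable at x \<longleftrightarrow> g differentiable at x"
proof -
  have "(f has_derivative D) (at x) \<longleftrightarrow> (g has_derivative D) (at x)" for D
    using assms by (metis has_derivative_transform_within_open)
  then show "dir_deriv v f x = dir_deriv v g x" "f differentiable at x \<longleftrightarrow> g differentiable at x"
    by (simp_all add: dir_deriv_def frechet_derivative_def differentiable_def)
qed

lemma dir_deriv_eq: "(f has_derivative D) (at x) \<Longrightarrow> dir_deriv v f x = D v"
  by (metis dir_deriv_def frechet_derivative_at)

lemma has_derivative_dir: "f differentiable at x \<Longrightarrow> (f has_derivative (\<lambda>v. dir_deriv v f x)) (at x)"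
  by (simp add: dir_deriv_def frechet_derivative_works)

lemma Ck_on_cong:
  assumes "open S" "\<And>y. y \<in> S \<Longrightarrow> f y = g y"
  shows "Ck_on k f S \<longleftrightarrow> Ck_on k g S"
  using assms(2)
proof (induction k arbitrary: f g)
  case 0
  show ?case unfolding Ck_on.simps by (rule continuous_on_cong[OF refl 0])
next
  case (Suc k)
  have "Ck_on k (dir_deriv v f) S \<longleftrightarrow> Ck_on k (dir_deriv v g) S" for v
    by (rule Suc.IH, rule dir_deriv_cong(1)[OF assms(1)]) (auto intro: Suc.prems)
  moreover have "f differentiable at x \<longleftrightarrow> g differentiable at x" if "x \<in> S" for x
    using dir_deriv_cong(2)[OF assms(1) that] Suc.prems by blast
  ultimately show ?case by simp
qed

lemma Ck_on_Suc: "Ck_on (Suc k) f S \<Longrightarrow> Ck_on k f S"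
proof (induction k arbitrary: f)
  case 0
  then show ?case
    by (auto intro!: continuous_at_imp_continuous_on differentiable_imp_continuous_within)
qed auto

lemma Ck_on_subset: "Ck_on k f S \<Longrightarrow> T \<subseteq> S \<Longrightarrow> Ck_on k f T"
  by (induction k arbitrary: f) (auto intro: continuous_on_subset)

lemma Ck_on_const: "Ck_on k (\<lambda>x. c) (S :: 'a::euclidean_space set)"
proof (induction k arbitrary: c)
  case (Suc k)
  have "dir_deriv v (\<lambda>x::'a. c) = (\<lambda>x. 0)" for v
    by (auto simp: fun_eq_iff intro!: dir_deriv_eq derivative_eq_intros)
  then show ?case using Suc by simp
qed simp

lemma Ck_on_linear: assumes "bounded_linear f" shows "Ck_on k f S"
proof (cases k)
  case 0
  then show ?thesis using assms by (simp add: linear_continuous_on)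
next
  case (Suc k)
  have d: "(f has_derivative f) (at x)" for x using assms by (rule bounded_linear_imp_has_derivative)
  then have "dir_deriv v f = (\<lambda>x. f v)" for v by (auto simp: fun_eq_iff dir_deriv_eq)
  then show ?thesis using Suc d Ck_on_const by (auto simp: differentiable_def)
qed

lemma Ck_on_add: "open S \<Longrightarrow> Ck_on k f S \<Longrightarrow> Ck_on k g S \<Longrightarrow> Ck_on k (\<lambda>x. f x + g x) S"
proof (induction k arbitrary: f g)
  case (Suc k)
  have "dir_deriv v (\<lambda>x. f x + g x) x = dir_deriv v f x + dir_deriv v g x" if "x \<in> S" for v x
    using Suc that by (intro dir_deriv_eq has_derivative_add has_derivative_dir) auto
  then have "Ck_on k (dir_deriv v (\<lambda>x. f x + g x)) S" for v
    using Suc by (subst Ck_on_cong[where g = "\<lambda>x. dir_deriv v f x + dir_deriv v g x"]) auto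
  then show ?case using Suc by (auto intro: differentiable_add)
qed (auto intro: continuous_on_add)

lemma Ck_on_sum: "open S \<Longrightarrow> (\<And>i. i \<in> A \<Longrightarrow> Ck_on k (f i) S) \<Longrightarrow> Ck_on k (\<lambda>x. \<Sum>i\<in>A. f i x) S"
  by (induction A rule: infinite_finite_induct) (auto intro: Ck_on_const Ck_on_add)

lemma dir_deriv_bilinear:
  assumes "bounded_bilinear B" "f differentiable at x" "g differentiable at x"
  shows "dir_deriv v (\<lambda>x. B (f x) (g x)) x = B (f x) (dir_deriv v g x) + B (dir_deriv v f x) (g x)"
    "(\<lambda>x. B (f x) (g x)) differentiable at x"
proof -
  have d: "((\<lambda>x. B (f x) (g x)) has_derivative (\<lambda>v. B (f x) (dir_deriv v g x)
      + B (dir_deriv v f x) (g x))) (at x)"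
    using bounded_bilinear.FDERIV[OF assms(1) has_derivative_dir[OF assms(2)] has_derivative_dir[OF
        assms(3)]] .
  then show "(\<lambda>x. B (f x) (g x)) differentiable at x" by (auto simp: differentiable_def)
  show "dir_deriv v (\<lambda>x. B (f x) (g x)) x = B (f x) (dir_deriv v g x) + B (dir_deriv v f x) (g x)"
    using dir_deriv_eq[OF d] .
qed

lemma Ck_on_bilinear:
  assumes B: "bounded_bilinear B" and "open S"
  shows "Ck_on k f S \<Longrightarrow> Ck_on k g S \<Longrightarrow> Ck_on k (\<lambda>x. B (f x) (g x)) S"
proof (induction k arbitrary: f g)
  case 0
  then show ?case by (simp add: bounded_bilinear.continuous_on[OF B])
next
  case (Suc k)
  have "Ck_on k (\<lambda>x. B (f x) (dir_deriv v g x) + B (dir_deriv v f x) (g x)) S" for v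
    using Suc.prems Ck_on_Suc[OF Suc.prems(1)] Ck_on_Suc[OF Suc.prems(2)]
    by (intro Ck_on_add Suc.IH \<open>open S\<close>) auto
  then have "Ck_on k (dir_deriv v (\<lambda>x. B (f x) (g x))) S" for v
    using Suc by (subst Ck_on_cong[OF \<open>open S\<close>, where g = "\<lambda>x. B (f x) (dir_deriv v g x)
        + B (dir_deriv v f x) (g x)"])
      (auto intro: dir_deriv_bilinear[OF B])
  moreover have "(\<lambda>x. B (f x) (g x)) differentiable at x" if "x \<in> S" for x
    using Suc.prems that by (intro dir_deriv_bilinear(2)[OF B]) auto
  ultimately show ?case by simp
qed

lemmas Ck_on_mult = Ck_on_bilinear[OF bounded_bilinear_mult]
  and Ck_on_scaleR = Ck_on_bilinear[OF bounded_bilinear_scaleR]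

lemma dir_deriv_chain:
  fixes g :: "'a::euclidean_space \<Rightarrow> 'b::euclidean_space" and f :: "'b \<Rightarrow> 'c::real_normed_vector"
  assumes "g differentiable at x" "f differentiable at (g x)"
  shows "dir_deriv v (\<lambda>x. f (g x)) x = dir_deriv (dir_deriv v g x) f (g x)"
    "(\<lambda>x. f (g x)) differentiable at x"
proof -
  have d: "((\<lambda>x. f (g x)) has_derivative (\<lambda>v. dir_deriv (dir_deriv v g x) f (g x))) (at x)"
    using has_derivative_compose[OF has_derivative_dir[OF assms(1)] has_derivative_dir[OF assms(2)]] .
  then show "(\<lambda>x. f (g x)) differentiable at x" by (auto simp: differentiable_def)
  show "dir_deriv v (\<lambda>x. f (g x)) x = dir_deriv (dir_deriv v g x) f (g x)"
    using dir_deriv_eq[OF d] .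
qed

lemma dir_deriv_linear:
  assumes "f differentiable at x" shows "linear (\<lambda>v. dir_deriv v f x)"
  using has_derivative_dir[OF assms] by (simp add: has_derivative_linear)

lemma dir_deriv_basis:
  assumes "f differentiable at x"
  shows "dir_deriv v f x = (\<Sum>b\<in>Basis. (v \<bullet> b) *\<^sub>R dir_deriv b f x)"
proof -
  have "dir_deriv v f x = dir_deriv (\<Sum>b\<in>Basis. (v \<bullet> b) *\<^sub>R b) f x"
      by (simp add: euclidean_representation)
  also have "\<dots> = (\<Sum>b\<in>Basis. (v \<bullet> b) *\<^sub>R dir_deriv b f x)"
    by (simp only: linear_sum[OF dir_deriv_linear[OF assms]] linear_scale[OF dir_deriv_linear[OF
        assms]])
  finally show ?thesis .
qed

text \<open>The direction in which \<open>f\<close> is differentiated varies with the point.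
  Expanding it in a basis leaves derivatives of \<open>f\<close> in fixed directions, to which the
  induction hypothesis applies.\<close>

lemma Ck_on_compose:
  fixes g :: "'a::euclidean_space \<Rightarrow> 'b::euclidean_space" and f :: "'b \<Rightarrow> 'c::real_normed_vector"
  assumes S: "open S" and g: "\<And>k. Ck_on k g S" and gT: "g ` S \<subseteq> T"
  shows "Ck_on k f T \<Longrightarrow> Ck_on k (\<lambda>x. f (g x)) S"
proof (induction k arbitrary: f)
  case 0
  then show ?case using g[of 0] gT by (auto intro: continuous_on_compose2)
next
  case (Suc k)
  have dg: "g differentiable at x" if "x \<in> S" for x using g[of 1] that by simp
  have df: "f differentiable at (g x)" if "x \<in> S" for x using Suc.prems that gT by auto
  have "Ck_on k (dir_deriv v (\<lambda>x. f (g x))) S" for v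
  proof (subst Ck_on_cong[OF S])
    show "dir_deriv v (\<lambda>x. f (g x)) x = (\<Sum>b\<in>Basis. (dir_deriv v g x \<bullet> b) *\<^sub>R dir_deriv b f (g x))" if
        "x \<in> S" for x
      unfolding dir_deriv_chain(1)[OF dg[OF that] df[OF that]] by (rule dir_deriv_basis[OF df[OF that]])
    have "Ck_on k (dir_deriv v g) S" using g[of "Suc k"] by simp
    then show "Ck_on k (\<lambda>x. \<Sum>b\<in>Basis. (dir_deriv v g x \<bullet> b) *\<^sub>R dir_deriv b f (g x)) S"
      using Suc by (intro Ck_on_sum Ck_on_scaleR S Suc.IH Ck_on_bilinear[OF bounded_bilinear_inner]
          Ck_on_const) auto
  qed
  then show ?case using dir_deriv_chain(2)[OF dg df] by auto
qed

text \<open>Two applications of the mean value theorem, along \<open>u\<close> and then along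
  \<open>v\<close>. The second difference itself is symmetric in \<open>u\<close> and
  \<open>v\<close>, whereas the derivative on the right is taken in a definite order.\<close>

lemma second_difference:
  fixes f :: "'a::euclidean_space \<Rightarrow> real"
  assumes f: "Ck_on 2 f (ball x r)" and t: "0 < t" "t * (norm u + norm v) < r"
  shows "\<exists>y. norm (y - x) \<le> t * (norm u + norm v) \<and>
    f (x + t *\<^sub>R u + t *\<^sub>R v) - f (x + t *\<^sub>R u) - f (x + t *\<^sub>R v) + f x = t * t
        * dir_deriv v (dir_deriv u f) y"
proof -
  have nb: "norm (a *\<^sub>R u + b *\<^sub>R v) \<le> t * (norm u + norm v)" if "0 \<le> a" "a \<le> t" "0 \<le> b" "b \<le> t" for a b
  proof -
    have "norm (a *\<^sub>R u + b *\<^sub>R v) \<le> a * norm u + b * norm v"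
      using norm_triangle_ineq[of "a *\<^sub>R u" "b *\<^sub>R v"] that by simp
    also have "\<dots> \<le> t * norm u + t * norm v" by (intro add_mono mult_right_mono that) auto
    finally show ?thesis by (simp add: distrib_left)
  qed
  have inb: "x + (a *\<^sub>R u + b *\<^sub>R v) \<in> ball x r" if "0 \<le> a" "a \<le> t" "0 \<le> b" "b \<le> t" for a b
  proof -
    have "dist x (x + w) = norm w" for w by (simp add: dist_norm)
    then show ?thesis using le_less_trans[OF nb[OF that] t(2)] by (simp only: mem_ball)
  qed
  have C: "\<And>y. y \<in> ball x r \<Longrightarrow> f differentiable at y" "\<And>u y. y \<in> ball x r
      \<Longrightarrow> dir_deriv u f differentiable at y"
    using f by (auto simp: numeral_2_eq_2)
  have line: "((\<lambda>a. g (p + a *\<^sub>R w)) has_real_derivative dir_deriv w g (p + a *\<^sub>R w)) (at a)"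
    if "g differentiable at (p + a *\<^sub>R w)" for g :: "'a \<Rightarrow> real" and p w a
  proof -
    have 1: "((\<lambda>a. p + a *\<^sub>R w) has_derivative (\<lambda>h. h *\<^sub>R w)) (at a)"
      by (auto intro!: derivative_eq_intros)
    have "((\<lambda>a. g (p + a *\<^sub>R w)) has_derivative (\<lambda>h. dir_deriv (h *\<^sub>R w) g (p + a *\<^sub>R w))) (at a)"
      using has_derivative_compose[OF 1 has_derivative_dir[OF that]] .
    moreover have "(\<lambda>h. dir_deriv (h *\<^sub>R w) g (p + a *\<^sub>R w)) = (*) (dir_deriv w g (p + a *\<^sub>R w))"
      by (auto simp: fun_eq_iff linear_scale[OF dir_deriv_linear[OF that]])
    ultimately show ?thesis unfolding has_field_derivative_def by simp
  qed
  \<comment> \<open>Increment of \<open>f\<close> under the shift by t v, as a function of the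
    position along \<open>u\<close>; the second difference is its increment from 0 to t.\<close>
  define \<phi> where "\<phi> a = f ((x + t *\<^sub>R v) + a *\<^sub>R u) - f (x + a *\<^sub>R u)" for a
  have e1: "(x + t *\<^sub>R v) + a *\<^sub>R u = x + (a *\<^sub>R u + t *\<^sub>R v)" "x + a *\<^sub>R u = x + (a *\<^sub>R u + 0 *\<^sub>R v)" for a
    by simp_all
  have "\<exists>z. 0 < z \<and> z < t \<and> \<phi> t - \<phi> 0 = (t - 0) * (dir_deriv u f ((x + t *\<^sub>R v) + z *\<^sub>R u)
      - dir_deriv u f (x + z *\<^sub>R u))"
  proof (rule MVT2[OF \<open>0 < t\<close>])
    fix a assume a: "0 \<le> a" "a \<le> t"
    show "(\<phi> has_real_derivative dir_deriv u f ((x + t *\<^sub>R v) + a *\<^sub>R u) - dir_deriv u f (x + a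
        *\<^sub>R u)) (at a)"
      unfolding \<phi>_def
    proof (intro DERIV_diff line C)
      show "x + t *\<^sub>R v + a *\<^sub>R u \<in> ball x r" using inb[of a t] a t unfolding e1(1) by simp
      show "x + a *\<^sub>R u \<in> ball x r" using inb[of a 0] a t by simp
    qed
  qed
  then obtain z where z: "0 < z" "z < t"
    "\<phi> t - \<phi> 0 = t * (dir_deriv u f ((x + z *\<^sub>R u) + t *\<^sub>R v) - dir_deriv u f ((x + z *\<^sub>R u) + 0 *\<^sub>R v))"
    by (auto simp: add_ac)
  have e2: "(x + z *\<^sub>R u) + b *\<^sub>R v = x + (z *\<^sub>R u + b *\<^sub>R v)" for b by simp
  have "\<exists>y. 0 < y \<and> y < t \<and> dir_deriv u f ((x + z *\<^sub>R u) + t *\<^sub>R v) - dir_deriv u f ((x + z *\<^sub>R u) + 0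
      *\<^sub>R v)
     = (t - 0) * dir_deriv v (dir_deriv u f) ((x + z *\<^sub>R u) + y *\<^sub>R v)"
    by (rule MVT2[OF \<open>0 < t\<close>]) (use z(1,2) in \<open>intro line C, unfold e2, intro inb, simp_all\<close>)
  then obtain y where y: "0 < y" "y < t"
    "\<phi> t - \<phi> 0 = t * t * dir_deriv v (dir_deriv u f) (x + (z *\<^sub>R u + y *\<^sub>R v))"
    using z(3) by (auto simp: e2)
  have "f (x + t *\<^sub>R u + t *\<^sub>R v) - f (x + t *\<^sub>R u) - f (x + t *\<^sub>R v) + f x = \<phi> t - \<phi> 0"
    by (simp add: \<phi>_def add_ac)
  then show ?thesis using y nb[of z y] z by (intro exI[of _ "x + (z *\<^sub>R u + y *\<^sub>R v)"]) auto
qed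

text \<open>By \<open>second_difference\<close> the two mixed derivatives agree at some pair of
  points arbitrarily close to \<open>x\<close>; being continuous at \<open>x\<close>, they cannot
  differ there.\<close>

lemma dir_deriv_commute_real:
  fixes f :: "'a::euclidean_space \<Rightarrow> real"
  assumes S: "open S" "x \<in> S" and f: "Ck_on 2 f S"
  shows "dir_deriv v (dir_deriv u f) x = dir_deriv u (dir_deriv v f) x"
proof (rule ccontr)
  assume ne: "dir_deriv v (dir_deriv u f) x \<noteq> dir_deriv u (dir_deriv v f) x"
  \<comment> \<open>Half of the gap: two errors below \<open>d\<close> cannot close it.\<close>
  define d where "d = \<bar>dir_deriv v (dir_deriv u f) x - dir_deriv u (dir_deriv v f) x\<bar> / 2"
  have d: "0 < d" using ne by (simp add: d_def)
  have cont: "isCont (dir_deriv v (dir_deriv u f)) x" for u v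
    using f S by (simp add: numeral_2_eq_2 continuous_on_eq_continuous_at)
  obtain r where r: "0 < r" "ball x r \<subseteq> S" using S by (meson open_contains_ball)
  obtain r1 where r1: "0 < r1" "\<And>y. dist y x < r1
      \<Longrightarrow> dist (dir_deriv v (dir_deriv u f) y) (dir_deriv v (dir_deriv u f) x) < d"
    using cont[of v u] d unfolding continuous_at_eps_delta by blast
  obtain r2 where r2: "0 < r2" "\<And>y. dist y x < r2
      \<Longrightarrow> dist (dir_deriv u (dir_deriv v f) y) (dir_deriv u (dir_deriv v f) x) < d"
    using cont[of u v] d unfolding continuous_at_eps_delta by blast
  define R where "R = min r (min r1 r2)"
  \<comment> \<open>The summand 1 avoids division by zero when both directions vanish.\<close>
  define t where "t = R / 2 / (norm u + norm v + 1)"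
  have p: "0 < norm u + norm v + 1" using norm_ge_zero[of u] norm_ge_zero[of v] by linarith
  have R: "0 < R" using r r1 r2 by (simp add: R_def)
  then have t: "0 < t" using p by (simp add: t_def)
  have "t * (norm u + norm v) < t * (norm u + norm v + 1)" using t by simp
  also have "\<dots> = R / 2" using nonzero_eq_divide_eq[OF less_imp_neq[OF p, symmetric], of t
      "R / 2"] t_def by blast
  finally have tR: "t * (norm u + norm v) < R" using R by simp
  have fr: "Ck_on 2 f (ball x r)" using f r Ck_on_subset by blast
  obtain y where y: "norm (y - x) \<le> t * (norm u + norm v)"
    "f (x + t *\<^sub>R u + t *\<^sub>R v) - f (x + t *\<^sub>R u) - f (x + t *\<^sub>R v) + f x = t * t
        * dir_deriv v (dir_deriv u f) y"
    using second_difference[OF fr t, of u v] tR by (auto simp: R_def)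
  obtain z where z: "norm (z - x) \<le> t * (norm u + norm v)"
    "f (x + t *\<^sub>R v + t *\<^sub>R u) - f (x + t *\<^sub>R v) - f (x + t *\<^sub>R u) + f x = t * t
        * dir_deriv u (dir_deriv v f) z"
    using second_difference[OF fr t, of v u] tR by (auto simp: R_def add.commute)
  have xe: "x + t *\<^sub>R v + t *\<^sub>R u = x + t *\<^sub>R u + t *\<^sub>R v" by simp
  have "t * t * dir_deriv v (dir_deriv u f) y = t * t * dir_deriv u (dir_deriv v f) z"
    using y(2) z(2) unfolding xe by linarith
  then have "dir_deriv v (dir_deriv u f) y = dir_deriv u (dir_deriv v f) z" using t by simp
  moreover have "dist (dir_deriv v (dir_deriv u f) y) (dir_deriv v (dir_deriv u f) x) < d"
    using y(1) tR by (intro r1) (auto simp: dist_norm R_def)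
  moreover have "dist (dir_deriv u (dir_deriv v f) z) (dir_deriv u (dir_deriv v f) x) < d"
    using z(1) tR by (intro r2) (auto simp: dist_norm R_def)
  ultimately show False unfolding d_def dist_real_def by argo
qed

lemma dir_deriv_linear_comp:
  assumes L: "bounded_linear L" and f: "f differentiable at x"
  shows "dir_deriv v (\<lambda>x. L (f x)) x = L (dir_deriv v f x)"
  by (intro dir_deriv_eq bounded_linear.has_derivative[OF L] has_derivative_dir f)

lemma Ck_on_linear_comp:
  assumes "bounded_linear L" "open S" shows "Ck_on k f S \<Longrightarrow> Ck_on k (\<lambda>x. L (f x)) S"
proof (induction k arbitrary: f)
  case 0
  then show ?case using assms by (simp add: bounded_linear.continuous_on)
next
  case (Suc k)
  have "Ck_on k (dir_deriv v (\<lambda>x. L (f x))) S" for v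
    using Suc by (subst Ck_on_cong[OF \<open>open S\<close>, where g = "\<lambda>x. L (dir_deriv v f x)"])
      (auto simp: dir_deriv_linear_comp[OF assms(1)])
  moreover have "(\<lambda>x. L (f x)) differentiable at x" if "x \<in> S" for x
    using bounded_linear.has_derivative[OF assms(1)] Suc.prems that
        unfolding Ck_on.simps differentiable_def by blast
  ultimately show ?case by simp
qed

lemma dir_deriv_commute:
  fixes f :: "'a::euclidean_space \<Rightarrow> 'b::euclidean_space"
  assumes S: "open S" "x \<in> S" and f: "Ck_on 2 f S"
  shows "dir_deriv v (dir_deriv u f) x = dir_deriv u (dir_deriv v f) x"
proof (rule euclidean_eqI)
  fix b :: 'b
  have L: "bounded_linear (\<lambda>y. y \<bullet> b)" by (rule bounded_linear_inner_left)
  have C: "\<And>y. y \<in> S \<Longrightarrow> f differentiable at y" "\<And>u y. y \<in> S \<Longrightarrow> dir_deriv u f differentiable at y"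
    using f by (auto simp: numeral_2_eq_2)
  have e: "dir_deriv v (dir_deriv u f) x \<bullet> b = dir_deriv v (dir_deriv u (\<lambda>y. f y \<bullet> b)) x" for u v
  proof -
    have "dir_deriv v (dir_deriv u (\<lambda>y. f y \<bullet> b)) x = dir_deriv v (\<lambda>y. dir_deriv u f y \<bullet> b) x"
      by (rule dir_deriv_cong[OF S]) (rule dir_deriv_linear_comp[OF L C(1)])
    also have "\<dots> = dir_deriv v (dir_deriv u f) x \<bullet> b"
      by (rule dir_deriv_linear_comp[OF L C(2)[OF S(2)]])
    finally show ?thesis by simp
  qed
  show "dir_deriv v (dir_deriv u f) x \<bullet> b = dir_deriv u (dir_deriv v f) x \<bullet> b"
    unfolding e by (rule dir_deriv_commute_real[OF S Ck_on_linear_comp[OF L S(1) f]])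
qed

section \<open>Taylor series of products and conjugates\<close>

type_synonym point = "params \<times> (real^2)"

definition smooth_on :: "'a::euclidean_space set \<Rightarrow> ('a \<Rightarrow> 'b::real_normed_vector) \<Rightarrow> bool" where
  "smooth_on S f \<longleftrightarrow> open S \<and> (\<forall>k. Ck_on k f S)"

lemma smooth_near_0_iff: "smooth_near_0 f \<longleftrightarrow> (\<exists>S. smooth_on S f \<and> 0 \<in> S)"
  by (auto simp: smooth_near_0_def smooth_on_def)

lemma smooth_onD: "smooth_on S f \<Longrightarrow> open S" "smooth_on S f \<Longrightarrow> Ck_on k f S"
  "smooth_on S f \<Longrightarrow> x \<in> S \<Longrightarrow> f differentiable at x"
proof -
  show "smooth_on S f \<Longrightarrow> open S" "smooth_on S f \<Longrightarrow> Ck_on k f S" by (auto simp: smooth_on_def)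
  assume "smooth_on S f" "x \<in> S"
  moreover from this have "Ck_on (Suc 0) f S" by (simp only: smooth_on_def)
  ultimately show "f differentiable at x" by simp
qed

lemma smooth_on_dir_deriv: "smooth_on S f \<Longrightarrow> smooth_on S (dir_deriv v f)"
  unfolding smooth_on_def by (meson Ck_on.simps(2))

lemma smooth_on_subset: "smooth_on S f \<Longrightarrow> open T \<Longrightarrow> T \<subseteq> S \<Longrightarrow> smooth_on T f"
  unfolding smooth_on_def using Ck_on_subset by blast

lemma smooth_on_add: "smooth_on S f \<Longrightarrow> smooth_on S g \<Longrightarrow> smooth_on S (\<lambda>x. f x + g x)"
  by (simp add: smooth_on_def Ck_on_add)

lemma smooth_on_mult:
  fixes f g :: "'a::euclidean_space \<Rightarrow> 'b::real_normed_algebra"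
  shows "smooth_on S f \<Longrightarrow> smooth_on S g \<Longrightarrow> smooth_on S (\<lambda>x. f x * g x)"
  by (simp add: smooth_on_def Ck_on_mult)

lemma smooth_on_const: "open S \<Longrightarrow> smooth_on S (\<lambda>x. c)"
  by (simp add: smooth_on_def Ck_on_const)

lemma smooth_on_linear: "open S \<Longrightarrow> bounded_linear f \<Longrightarrow> smooth_on S f"
  by (simp add: smooth_on_def Ck_on_linear)

lemma smooth_on_linear_comp: "bounded_linear L \<Longrightarrow> smooth_on S f \<Longrightarrow> smooth_on S (\<lambda>x. L (f x))"
  by (simp add: smooth_on_def Ck_on_linear_comp)

lemma smooth_on_compose:
  fixes g :: "'a::euclidean_space \<Rightarrow> 'b::euclidean_space" and f :: "'b \<Rightarrow> 'c::real_normed_vector"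
  shows "smooth_on T f \<Longrightarrow> smooth_on S g \<Longrightarrow> g ` S \<subseteq> T \<Longrightarrow> smooth_on S (\<lambda>x. f (g x))"
  by (simp add: smooth_on_def Ck_on_compose)

text \<open>Partial derivatives numbered like the entries of an exponent tuple. Every index from 4
  on means the last parameter, so statements can range over all natural numbers.\<close>

definition pd :: "nat \<Rightarrow> (point \<Rightarrow> complex) \<Rightarrow> point \<Rightarrow> complex" where
  "pd i f = (if i = 0 then wirtinger_z f else if i = 1 then wirtinger_zbar f
     else if i = 2 then dir_deriv ((1, 0, 0), 0) f else if i = 3 then dir_deriv ((0, 1, 0), 0) f
     else dir_deriv ((0, 0, 1), 0) f)"

definition fd :: "nat \<Rightarrow> formal_series \<Rightarrow> formal_series" where
  "fd i f = (if i = 0 then deriv_z f else if i = 1 then deriv_zbar f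
     else if i = 2 then deriv_p1 f else if i = 3 then deriv_p2 f else deriv_p3 f)"

text \<open>A common shape for Wirtinger and parameter derivatives (the latter with q = 0), through
  which linearity, product rule and commutation are proved once for all.\<close>

lemma pd_form: "\<exists>p u q v. \<forall>f x. pd i f x = p * dir_deriv u f x + q * dir_deriv v f x"
proof -
  consider "i = 0" | "i = 1" | "i = 2" | "i = 3" | "i \<notin> {0, 1, 2, 3}" by auto
  then show ?thesis
  proof cases
    case 1
    show ?thesis
      by (rule exI[of _ "1 / complex_of_real (sqrt 2)"], rule exI[of _ "(0, axis 1 1)"],
          rule exI[of _ "- \<i> / complex_of_real (sqrt 2)"], rule exI[of _ "(0, axis 2 1)"])
        (simp add: 1 pd_def wirtinger_z_def diff_divide_distrib)
  next
    case 2
    show ?thesis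
      by (rule exI[of _ "1 / complex_of_real (sqrt 2)"], rule exI[of _ "(0, axis 1 1)"],
          rule exI[of _ "\<i> / complex_of_real (sqrt 2)"], rule exI[of _ "(0, axis 2 1)"])
        (simp add: 2 pd_def wirtinger_zbar_def add_divide_distrib)
  next
    case 3
    show ?thesis
      by (rule exI[of _ 1], rule exI[of _ "((1, 0, 0), 0)"], rule exI[of _ 0]) (simp add: 3 pd_def)
  next
    case 4
    show ?thesis
      by (rule exI[of _ 1], rule exI[of _ "((0, 1, 0), 0)"], rule exI[of _ 0]) (simp add: 4 pd_def)
  next
    case 5
    show ?thesis
      by (rule exI[of _ 1], rule exI[of _ "((0, 0, 1), 0)"],
          rule exI[of _ 0]) (use 5 in \<open>simp add: pd_def\<close>)
  qed
qed

lemma pd_cong: "open S \<Longrightarrow> x \<in> S \<Longrightarrow> (\<And>y. y \<in> S \<Longrightarrow> f y = g y) \<Longrightarrow> pd i f x = pd i g x"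
  using pd_form[of i] dir_deriv_cong(1)[of S x f g] by metis

lemma smooth_on_pd: "smooth_on S f \<Longrightarrow> smooth_on S (pd i f)"
proof -
  assume f: "smooth_on S f"
  obtain p u q v where "\<And>f x. pd i f x = p * dir_deriv u f x + q * dir_deriv v f x" using pd_form
      by metis
  then have "pd i f = (\<lambda>x. p * dir_deriv u f x + q * dir_deriv v f x)" by auto
  then show ?thesis
    using f by (simp add: smooth_on_add smooth_on_mult smooth_on_const smooth_on_dir_deriv smooth_onD)
qed

lemma dir_deriv_add:
  assumes "f differentiable at x" "g differentiable at x"
  shows "dir_deriv v (\<lambda>x. f x + g x) x = dir_deriv v f x + dir_deriv v g x"
  using assms by (intro dir_deriv_eq has_derivative_add has_derivative_dir)

lemma pd_add: "smooth_on S f \<Longrightarrow> smooth_on S g \<Longrightarrow> x \<in> S \<Longrightarrow> pd i (\<lambda>x. f x + g x) x = pd i f x + pd i g x"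
proof -
  assume "smooth_on S f" "smooth_on S g" "x \<in> S"
  then have d: "dir_deriv v (\<lambda>x. f x + g x) x = dir_deriv v f x + dir_deriv v g x" for v
    by (intro dir_deriv_add smooth_onD(3))
  obtain p u q v where "\<And>f x. pd i f x = p * dir_deriv u f x + q * dir_deriv v f x" using pd_form
      by metis
  then show ?thesis by (simp add: d algebra_simps)
qed

lemma pd_mult: "smooth_on S f \<Longrightarrow> smooth_on S g \<Longrightarrow> x \<in> S \<Longrightarrow> pd i (\<lambda>x. f x * g x) x = pd i f x * g x
    + f x * pd i g x"
proof -
  assume "smooth_on S f" "smooth_on S g" "x \<in> S"
  then have d: "dir_deriv v (\<lambda>x. f x * g x) x = f x * dir_deriv v g x + dir_deriv v f x * g x" for v
    by (intro dir_deriv_bilinear(1)[OF bounded_bilinear_mult] smooth_onD(3))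
  obtain p u q v where "\<And>f x. pd i f x = p * dir_deriv u f x + q * dir_deriv v f x" using pd_form
      by metis
  then show ?thesis by (simp add: d algebra_simps)
qed

lemma pd_const: "pd i (\<lambda>x. c) = (\<lambda>x. 0)"
proof -
  have "dir_deriv v (\<lambda>x::point. c) x = 0" for v x
    by (rule dir_deriv_eq) (rule has_derivative_const)
  then show ?thesis using pd_form[of i] by (metis (no_types) add_0 mult_zero_right)
qed

lemma pd_commute:
  assumes f: "smooth_on S f" and x: "x \<in> S"
  shows "pd i (pd j f) x = pd j (pd i f) x"
proof -
  obtain p u q v where i: "\<And>f x. pd i f x = p * dir_deriv u f x + q * dir_deriv v f x" using pd_form
      by metis
  obtain p' u' q' v' where j: "\<And>f x. pd j f x = p' * dir_deriv u' f x + q' * dir_deriv v' f x"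
      using pd_form by metis
  have d: "dir_deriv a (\<lambda>x. r * dir_deriv b f x + s * dir_deriv c f x) x =
     r * dir_deriv a (dir_deriv b f) x + s * dir_deriv a (dir_deriv c f) x" for a b c r s
  proof -
    have m: "dir_deriv a (\<lambda>x. r * dir_deriv b f x) x = r * dir_deriv a (dir_deriv b f) x" for r b
      by (rule dir_deriv_linear_comp[OF bounded_linear_mult_right]) (intro smooth_onD(3)[OF
          smooth_on_dir_deriv[OF f] x])
    have sm: "smooth_on S (\<lambda>x. r * dir_deriv b f x)" for r b
      by (intro smooth_on_mult smooth_on_const smooth_on_dir_deriv f smooth_onD(1)[OF f])
    show ?thesis
      unfolding dir_deriv_add[OF smooth_onD(3)[OF sm x] smooth_onD(3)[OF sm x]] m ..
  qed
  have c: "dir_deriv a (dir_deriv b f) x = dir_deriv b (dir_deriv a f) x" for a b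
    by (rule dir_deriv_commute[OF smooth_onD(1)[OF f] x smooth_onD(2)[OF f]])
  have "pd i (pd j f) x = p * dir_deriv u (\<lambda>x. p' * dir_deriv u' f x + q' * dir_deriv v' f x) x
     + q * dir_deriv v (\<lambda>x. p' * dir_deriv u' f x + q' * dir_deriv v' f x) x"
    unfolding i by (simp add: j[abs_def])
  moreover have "pd j (pd i f) x = p' * dir_deriv u' (\<lambda>x. p * dir_deriv u f x + q * dir_deriv v f x) x
     + q' * dir_deriv v' (\<lambda>x. p * dir_deriv u f x + q * dir_deriv v f x) x"
    unfolding j by (simp add: i[abs_def])
  ultimately show ?thesis
    unfolding d using c[of u' u] c[of u' v] c[of v' u] c[of v' v] by (simp add: algebra_simps)
qed

lemma pd_pow_cong: "open S \<Longrightarrow> (\<And>y. y \<in> S \<Longrightarrow> f y = g y) \<Longrightarrow> x \<in> S \<Longrightarrow> (pd i ^^ k) f x = (pd i ^^ k) g x"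
  by (induction k arbitrary: x) (auto intro: pd_cong)

lemma smooth_on_pd_pow: "smooth_on S f \<Longrightarrow> smooth_on S ((pd i ^^ k) f)"
  by (induction k) (auto intro: smooth_on_pd)

lemma pd_pow_commute: "smooth_on S f \<Longrightarrow> x \<in> S \<Longrightarrow> (pd j ^^ k) (pd i f) x = pd i ((pd j ^^ k) f) x"
proof (induction k arbitrary: x)
  case (Suc k)
  have "(pd j ^^ Suc k) (pd i f) x = pd j (pd i ((pd j ^^ k) f)) x"
    using Suc by (auto intro!: pd_cong[of S] smooth_onD(1))
  also have "\<dots> = pd i ((pd j ^^ Suc k) f) x"
    using Suc by (simp add: pd_commute[OF smooth_on_pd_pow])
  finally show ?case .
qed simp

abbreviation T :: "(point \<Rightarrow> complex) \<Rightarrow> formal_series" where "T \<equiv> taylor_series"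

lemma cf_T: "cf (T f) (k, l, a, b, c) =
  (pd 0 ^^ k) ((pd 1 ^^ l) ((pd 2 ^^ a) ((pd 3 ^^ b) ((pd 4 ^^ c) f)))) 0 / (fact k * fact l
      * fact a * fact b * fact c)"
proof -
  have "pd 0 = wirtinger_z" "pd 1 = wirtinger_zbar" "pd 2 = dir_deriv ((1, 0, 0), 0)"
    "pd 3 = dir_deriv ((0, 1, 0), 0)" "pd 4 = dir_deriv ((0, 0, 1), 0)"
    by (auto simp: pd_def fun_eq_iff)
  then show ?thesis unfolding taylor_series_def cf_mk by simp
qed

lemma T_cong:
  assumes S: "open S" "0 \<in> S" and eq: "\<And>y. y \<in> S \<Longrightarrow> f y = g y"
  shows "T f = T g"
proof (rule cf_eqI)
  fix e :: expo
  obtain k l a b c where e: "e = (k, l, a, b, c)" by (cases e)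
  have "(pd 0 ^^ k) ((pd 1 ^^ l) ((pd 2 ^^ a) ((pd 3 ^^ b) ((pd 4 ^^ c) f)))) 0 =
     (pd 0 ^^ k) ((pd 1 ^^ l) ((pd 2 ^^ a) ((pd 3 ^^ b) ((pd 4 ^^ c) g)))) 0"
    by (intro pd_pow_cong[OF S(1)] eq S(2))
  then show "cf (T f) e = cf (T g) e" by (simp only: e cf_T)
qed

lemma T_0: "cf (T f) (0, 0, 0, 0, 0) = f 0"
  by (simp add: cf_T)

text \<open>Commuting \<open>pd i\<close> into its own block of iterated derivatives raises one
  exponent by 1, and the quotient of factorials is the factor of the formal derivative.\<close>

lemma T_pd:
  assumes f: "smooth_on S f" and 0: "0 \<in> S"
  shows "T (pd i f) = fd i (T f)"
proof (rule cf_eqI)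
  fix e :: expo
  obtain k l a b c where e: "e = (k, l, a, b, c)" by (cases e)
  note S = smooth_onD(1)[OF f]
  have s: "(pd j ^^ m) (pd j g) = (pd j ^^ Suc m) g" for j m g
    by (simp add: funpow_swap1)
  note cm = pd_pow_commute[of S]
  note sm = smooth_on_pd_pow[of S] f
  have c4: "(pd 4 ^^ c) (pd i f) y = pd i ((pd 4 ^^ c) f) y" if "y \<in> S" for y
    by (intro cm sm that)
  have c3: "(pd 3 ^^ b) ((pd 4 ^^ c) (pd i f)) y = pd i ((pd 3 ^^ b) ((pd 4 ^^ c) f)) y" if "y \<in> S"
      for y
    using pd_pow_cong[OF S c4 that, where i = 3 and k = b] cm[where f = "(pd 4 ^^ c) f" and x
        = y and k = b and j = 3 and i = i] sm that by simp
  have c2: "(pd 2 ^^ a) ((pd 3 ^^ b) ((pd 4 ^^ c) (pd i f))) y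
      = pd i ((pd 2 ^^ a) ((pd 3 ^^ b) ((pd 4 ^^ c) f))) y" if "y \<in> S" for y
    using pd_pow_cong[OF S c3 that, where i = 2 and k = a] cm[where f =
        "(pd 3 ^^ b) ((pd 4 ^^ c) f)" and x = y and k = a and j = 2 and i = i] sm that by simp
  have c1: "(pd 1 ^^ l) ((pd 2 ^^ a) ((pd 3 ^^ b) ((pd 4 ^^ c) (pd i f)))) y =
      pd i ((pd 1 ^^ l) ((pd 2 ^^ a) ((pd 3 ^^ b) ((pd 4 ^^ c) f)))) y" if "y \<in> S" for y
    using pd_pow_cong[OF S c2 that, where i = 1 and k = l] cm[where f =
        "(pd 2 ^^ a) ((pd 3 ^^ b) ((pd 4 ^^ c) f))" and x = y and k = l and j = 1 and i = i] sm that
        by simp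
  consider "i = 0" | "i = 1" | "i = 2" | "i = 3" | "i \<notin> {0, 1, 2, 3}" by auto
  then show "cf (T (pd i f)) e = cf (fd i (T f)) e"
  proof cases
    case 1
    have "(pd 0 ^^ k) ((pd 1 ^^ l) ((pd 2 ^^ a) ((pd 3 ^^ b) ((pd 4 ^^ c) (pd i f))))) 0
      = (pd 0 ^^ Suc k) ((pd 1 ^^ l) ((pd 2 ^^ a) ((pd 3 ^^ b) ((pd 4 ^^ c) f)))) 0"
      unfolding s[symmetric] by (intro pd_pow_cong[OF S _ 0]) (use c1 1 in simp)
    then show ?thesis unfolding e 1 fd_def cf_T
        by (simp add: cf_derivs cf_T fact_Suc field_simps del: funpow.simps of_nat_Suc)
  next
    case 2
    have "(pd 0 ^^ k) ((pd 1 ^^ l) ((pd 2 ^^ a) ((pd 3 ^^ b) ((pd 4 ^^ c) (pd i f))))) 0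
      = (pd 0 ^^ k) ((pd 1 ^^ Suc l) ((pd 2 ^^ a) ((pd 3 ^^ b) ((pd 4 ^^ c) f)))) 0"
      unfolding s[symmetric] by (intro pd_pow_cong[OF S _ 0] pd_pow_cong[OF S]) (use c2 2 in simp_all)
    then show ?thesis unfolding e 2 fd_def cf_T
        by (simp add: cf_derivs cf_T fact_Suc field_simps del: funpow.simps of_nat_Suc)
  next
    case 3
    have "(pd 0 ^^ k) ((pd 1 ^^ l) ((pd 2 ^^ a) ((pd 3 ^^ b) ((pd 4 ^^ c) (pd i f))))) 0
      = (pd 0 ^^ k) ((pd 1 ^^ l) ((pd 2 ^^ Suc a) ((pd 3 ^^ b) ((pd 4 ^^ c) f)))) 0"
      unfolding s[symmetric] by (intro pd_pow_cong[OF S _ 0] pd_pow_cong[OF S]) (use c3 3 in simp_all)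
    then show ?thesis unfolding e 3 fd_def cf_T
        by (simp add: cf_derivs cf_T fact_Suc field_simps del: funpow.simps of_nat_Suc)
  next
    case 4
    have "(pd 0 ^^ k) ((pd 1 ^^ l) ((pd 2 ^^ a) ((pd 3 ^^ b) ((pd 4 ^^ c) (pd i f))))) 0
      = (pd 0 ^^ k) ((pd 1 ^^ l) ((pd 2 ^^ a) ((pd 3 ^^ Suc b) ((pd 4 ^^ c) f)))) 0"
      unfolding s[symmetric] by (intro pd_pow_cong[OF S _ 0] pd_pow_cong[OF S]) (use c4 4 in simp_all)
    then show ?thesis unfolding e 4 fd_def cf_T
        by (simp add: cf_derivs cf_T fact_Suc field_simps del: funpow.simps of_nat_Suc)
  next
    case 5
    then have "pd i = pd 4" by (auto simp: pd_def fun_eq_iff)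
    then have "(pd 0 ^^ k) ((pd 1 ^^ l) ((pd 2 ^^ a) ((pd 3 ^^ b) ((pd 4 ^^ c) (pd i f))))) 0
      = (pd 0 ^^ k) ((pd 1 ^^ l) ((pd 2 ^^ a) ((pd 3 ^^ b) ((pd 4 ^^ Suc c) f)))) 0"
      by (simp only: s)
    then show ?thesis unfolding e cf_T using 5
        by (simp add: fd_def cf_derivs cf_T fact_Suc field_simps del: funpow.simps of_nat_Suc)
  qed
qed

lemma fd_derivation: "derivation (fd i)"
proof -
  consider "fd i = deriv_z" | "fd i = deriv_zbar" | "fd i = deriv_p1" | "fd i = deriv_p2" | "fd i
      = deriv_p3"
    unfolding fd_def by (cases "i = 0"; cases "i = 1"; cases "i = 2"; cases "i = 3") auto
  then show ?thesis by cases (simp_all add: deriv_z_derivation deriv_zbar_derivation deriv_p_derivation)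
qed

lemma fd_cadd: "cadd (fd i)"
proof -
  consider "fd i = deriv_z" | "fd i = deriv_zbar" | "fd i = deriv_p1" | "fd i = deriv_p2" | "fd i
      = deriv_p3"
    unfolding fd_def by (cases "i = 0"; cases "i = 1"; cases "i = 2"; cases "i = 3") auto
  then show ?thesis by cases (simp_all add: cadd_deriv_z cadd_deriv_zbar cadd_deriv_p)
qed

lemmas fd_add = derivationD(1)[OF fd_derivation] and fd_mult = derivationD(2)[OF fd_derivation]
  and fd_diff = cadd_minus[OF fd_cadd]

text \<open>A nonzero exponent can be lowered in some variable, and the corresponding formal
  derivative shows the coefficient up to a nonzero integer.\<close>

lemma Fil_fd:
  assumes "cf f (0, 0, 0, 0, 0) = 0" "\<And>i. fd i f \<in> Fil 1 N"
  shows "f \<in> Fil 1 (Suc N)"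
proof (rule FilI)
  fix e assume w: "wt 1 e < Suc N"
  obtain k l a b c where e: "e = (k, l, a, b, c)" by (cases e)
  have d: "cf (fd i f) e' = 0" if "wt 1 e' < N" for i e' using FilD[OF assms(2) that] .
  consider "e = (0, 0, 0, 0, 0)" | k' where "k = Suc k'" | l' where "l = Suc l'" | a' where "a = Suc a'"
    | b' where "b = Suc b'" | c' where "c = Suc c'"
    using e by (metis not0_implies_Suc)
  then show "cf f e = 0"
  proof cases
    case 1 then show ?thesis using assms by simp
  next
    case (2 k') then show ?thesis using d[of "(k', l, a, b, c)" 0] w
        by (simp add: e fd_def cf_derivs del: of_nat_Suc)
  next
    case (3 l') then show ?thesis using d[of "(k, l', a, b, c)" 1] w
        by (simp add: e fd_def cf_derivs del: of_nat_Suc)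
  next
    case (4 a') then show ?thesis using d[of "(k, l, a', b, c)" 2] w
        by (simp add: e fd_def cf_derivs del: of_nat_Suc)
  next
    case (5 b') then show ?thesis using d[of "(k, l, a, b', c)" 3] w
        by (simp add: e fd_def cf_derivs del: of_nat_Suc)
  next
    case (6 c') then show ?thesis using d[of "(k, l, a, b, c')" 4] w
        by (simp add: e fd_def cf_derivs del: of_nat_Suc)
  qed
qed

text \<open>The order is raised for the whole family simultaneously, since the derivative of one
  defect involves other members. The index type is left open because sums and products require pairs
  of functions.\<close>

lemma jet_zero:
  assumes c: "\<And>j. P j \<Longrightarrow> cf (D j) (0, 0, 0, 0, 0) = 0"
    and d: "\<And>N j i. (\<And>j. P j \<Longrightarrow> D j \<in> Fil 1 N) \<Longrightarrow> P j \<Longrightarrow> fd i (D j) \<in> Fil 1 N"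
    and "P j"
  shows "D j = 0"
proof -
  have "\<forall>j. P j \<longrightarrow> D j \<in> Fil 1 N" for N
  proof (induction N)
    case (Suc N)
    then show ?case using Fil_fd c d by blast
  qed simp
  then show ?thesis using \<open>P j\<close> by (intro Fil_eqI[of _ _ 1]) simp
qed

context
  fixes S :: "point set"
  assumes S: "open S" "0 \<in> S"
begin

lemma T_add:
  assumes "smooth_on S f" "smooth_on S g" shows "T (\<lambda>x. f x + g x) = T f + T g"
proof -
  let ?P = "\<lambda>(f :: point \<Rightarrow> complex, g :: point \<Rightarrow> complex). smooth_on S f \<and> smooth_on S g" and ?D =
      "\<lambda>(f, g). T (\<lambda>x. f x + g x) - (T f + T g)"
  have "?D (f, g) = 0"
  proof (rule jet_zero[of ?P ?D])
    fix N j i assume IH: "\<And>j. ?P j \<Longrightarrow> ?D j \<in> Fil 1 N" and j: "?P j"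
    obtain f g where fg: "j = (f, g)" "smooth_on S f" "smooth_on S g" using j by auto
    have "fd i (T (\<lambda>x. f x + g x)) = T (pd i (\<lambda>x. f x + g x))"
      by (rule T_pd[symmetric, OF smooth_on_add[OF fg(2,3)] S(2)])
    also have "\<dots> = T (\<lambda>x. pd i f x + pd i g x)"
      by (rule T_cong[OF S]) (rule pd_add[OF fg(2,3)])
    finally have "fd i (?D j) = ?D (pd i f, pd i g)"
      by (simp add: fg fd_add fd_diff T_pd[OF _ S(2)])
    moreover have "?D (pd i f, pd i g) \<in> Fil 1 N" using fg by (intro IH) (simp add: smooth_on_pd)
    ultimately show "fd i (?D j) \<in> Fil 1 N" by simp
  qed (use assms in \<open>auto simp: T_0\<close>)
  then show ?thesis by simp
qed

lemma T_mult:
  assumes "smooth_on S f" "smooth_on S g" shows "T (\<lambda>x. f x * g x) = T f * T g"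
proof -
  let ?P = "\<lambda>(f :: point \<Rightarrow> complex, g :: point \<Rightarrow> complex). smooth_on S f \<and> smooth_on S g" and ?D =
      "\<lambda>(f, g). T (\<lambda>x. f x * g x) - T f * T g"
  have "?D (f, g) = 0"
  proof (rule jet_zero[of ?P ?D])
    fix N j i assume IH: "\<And>j. ?P j \<Longrightarrow> ?D j \<in> Fil 1 N" and j: "?P j"
    obtain f g where fg: "j = (f, g)" "smooth_on S f" "smooth_on S g" using j by auto
    have "fd i (T (\<lambda>x. f x * g x)) = T (pd i (\<lambda>x. f x * g x))"
      by (rule T_pd[symmetric, OF smooth_on_mult[OF fg(2,3)] S(2)])
    also have "\<dots> = T (\<lambda>x. pd i f x * g x + f x * pd i g x)"
      by (rule T_cong[OF S]) (rule pd_mult[OF fg(2,3)])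
    also have "\<dots> = T (\<lambda>x. pd i f x * g x) + T (\<lambda>x. f x * pd i g x)"
      by (intro T_add smooth_on_mult smooth_on_pd fg)
    finally have D: "fd i (?D j) = ?D (pd i f, g) + ?D (f, pd i g)"
      using fg(2,3) by (simp add: fg(1) fd_mult fd_diff T_pd[OF _ S(2)])
    show "fd i (?D j) \<in> Fil 1 N"
      unfolding D by (intro Fil_add IH) (use fg in \<open>simp_all add: smooth_on_pd\<close>)
  qed (use assms in \<open>auto simp: T_0 cf_mult\<close>)
  then show ?thesis by simp
qed

end

lemma T_zero: "T (\<lambda>x. 0) = 0"
  using T_add[of UNIV "\<lambda>x. 0" "\<lambda>x. 0"] by (simp add: smooth_on_const)

lemma series_eq_fd:
  assumes "cf f (0, 0, 0, 0, 0) = cf g (0, 0, 0, 0, 0)" "\<And>i. fd i f = fd i g"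
  shows "f = g"
proof -
  have "(\<lambda>_. f - g) () = 0"
    by (rule jet_zero[of "\<lambda>_. True"]) (use assms in \<open>auto simp: fd_diff\<close>)
  then show ?thesis by simp
qed

lemma fd_const: "fd i (const_series c) = 0"
  by (rule cf_eqI) (auto simp: fd_def mono_eqs(1) cf_derivs cf_mono)

lemma T_const: "T (\<lambda>x. c) = const_series c"
proof (rule series_eq_fd)
  fix i
  have "fd i (T (\<lambda>x. c)) = T (pd i (\<lambda>x. c))"
    by (rule T_pd[symmetric, of UNIV]) (auto intro: smooth_on_const)
  then show "fd i (T (\<lambda>x. c)) = fd i (const_series c)" by (simp add: pd_const T_zero fd_const)
qed (simp add: T_0 mono_eqs(1) cf_mono)

lemma T_power:
  assumes "0 \<in> S" "smooth_on S f"
  shows "smooth_on S (\<lambda>x. f x ^ k)" "T (\<lambda>x. f x ^ k) = T f ^ k"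
proof -
  have "smooth_on S (\<lambda>x. f x ^ k) \<and> T (\<lambda>x. f x ^ k) = T f ^ k"
  proof (induction k)
    case (Suc k)
    then show ?case using assms smooth_onD(1)[OF assms(2)] by (simp add: smooth_on_mult T_mult)
  qed (use smooth_onD(1)[OF assms(2)] in \<open>simp add: smooth_on_const T_const\<close>)
  then show "smooth_on S (\<lambda>x. f x ^ k)" "T (\<lambda>x. f x ^ k) = T f ^ k" by auto
qed

lemma smooth_on_cnj: "smooth_on S f \<Longrightarrow> smooth_on S (\<lambda>x. cnj (f x))"
  by (rule smooth_on_linear_comp[OF bounded_linear_cnj])

lemma pd_cnj:
  assumes f: "smooth_on S f" "x \<in> S"
  shows "pd i (\<lambda>x. cnj (f x)) x = cnj (pd (if i = 0 then 1 else if i = 1 then 0 else i) f x)"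
proof -
  have "dir_deriv v (\<lambda>x. cnj (f x)) x = cnj (dir_deriv v f x)" for v
    by (rule dir_deriv_linear_comp[OF bounded_linear_cnj smooth_onD(3)[OF f]])
  then show ?thesis by (simp add: pd_def wirtinger_z_def wirtinger_zbar_def)
qed

lemma fd_cnj: "fd i (cnj_series f) = cnj_series (fd (if i = 0 then 1 else if i = 1 then 0 else i) f)"
  by (rule cf_eqI) (auto simp: fd_def cf_cnj cf_derivs)

lemma T_cnj:
  assumes S: "0 \<in> S" and f: "smooth_on S f" shows "T (\<lambda>x. cnj (f x)) = cnj_series (T f)"
proof -
  have "T (\<lambda>x. cnj (f x)) - cnj_series (T f) = 0"
  proof (rule jet_zero[of "smooth_on S" "\<lambda>f. T (\<lambda>x. cnj (f x)) - cnj_series (T f)"])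
    fix N i :: nat and f :: "point \<Rightarrow> complex" assume IH: "\<And>f. smooth_on S f \<Longrightarrow> T (\<lambda>x. cnj (f x))
        - cnj_series (T f) \<in> Fil 1 N" and f: "smooth_on S f"
    \<comment> \<open>Conjugation exchanges the derivatives in z and zbar and keeps those in the
      parameters.\<close>
    let ?i = "if i = 0 then 1 else if i = 1 then 0 else i"
    have "fd i (T (\<lambda>x. cnj (f x))) = T (pd i (\<lambda>x. cnj (f x)))"
      by (rule T_pd[symmetric, OF smooth_on_cnj[OF f] S])
    also have "\<dots> = T (\<lambda>x. cnj (pd ?i f x))"
      by (rule T_cong[OF smooth_onD(1)[OF f] S]) (rule pd_cnj[OF f])
    finally have "fd i (T (\<lambda>x. cnj (f x)) - cnj_series (T f)) = T (\<lambda>x. cnj (pd ?i f x))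
        - cnj_series (T (pd ?i f))"
      unfolding fd_diff fd_cnj T_pd[OF f S] by simp
    then show "fd i (T (\<lambda>x. cnj (f x)) - cnj_series (T f)) \<in> Fil 1 N"
      using IH[OF smooth_on_pd[OF f]] by simp
  qed (use f in \<open>auto simp: T_0 cf_cnj\<close>)
  then show ?thesis by simp
qed

section \<open>Taylor series and changes of parameters\<close>

lemma dir_deriv_bl: "bounded_linear L \<Longrightarrow> dir_deriv v L w = L v"
  by (rule dir_deriv_eq) (rule bounded_linear_imp_has_derivative)

lemma bl_differentiable: "bounded_linear L \<Longrightarrow> L differentiable at x"
  using bounded_linear_imp_has_derivative differentiable_def by blast

lemma dir_deriv_0: "f differentiable at x \<Longrightarrow> dir_deriv 0 f x = 0"
  using linear_0[OF dir_deriv_linear] .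

lemma dir_deriv_chain_bl:
  fixes L :: "'a::euclidean_space \<Rightarrow> 'b::euclidean_space"
  assumes "bounded_linear L" "f differentiable at (L w)"
  shows "dir_deriv v (\<lambda>w. f (L w)) w = dir_deriv (L v) f (L w)"
  using dir_deriv_chain(1)[OF bl_differentiable[OF assms(1)] assms(2)]
      by (simp add: dir_deriv_bl assms(1))

lemma open_vimage_bl:
  fixes L :: "'a::euclidean_space \<Rightarrow> 'b::euclidean_space"
  assumes "bounded_linear L" "open U" shows "open {w. L w \<in> U}"
  using open_vimage[OF assms(2) linear_continuous_on[OF assms(1)]] by (simp add: vimage_def)

lemma smooth_on_compose_bl:
  fixes L :: "'a::euclidean_space \<Rightarrow> 'b::euclidean_space"
  assumes "bounded_linear L" "smooth_on U f" shows "smooth_on {w. L w \<in> U} (\<lambda>w. f (L w))"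
  by (rule smooth_on_compose[OF assms(2) smooth_on_linear[OF open_vimage_bl assms(1)]])
    (use assms smooth_onD(1) in auto)

lemma bl_fst: "bounded_linear (fst :: point \<Rightarrow> params)" by (rule bounded_linear_fst)

text \<open>Both Wirtinger derivatives vanish near 0, hence so do the formal derivatives in z and
  zbar.\<close>

lemma T_param:
  assumes f: "smooth_on U f" and 0: "0 \<in> U"
  shows "is_param (T (\<lambda>w. f (fst w)))"
proof -
  let ?S = "{w :: point. fst w \<in> U}" and ?f = "\<lambda>w :: point. f (fst w)"
  have s: "smooth_on ?S ?f" by (rule smooth_on_compose_bl[OF bl_fst f])
  have 0: "0 \<in> ?S" using 0 by simp
  have d: "dir_deriv (0, v) ?f w = 0" if "w \<in> ?S" for v w
    using that smooth_onD(3)[OF f] by (simp add: dir_deriv_chain_bl[OF bl_fst] dir_deriv_0)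
  have "fd i (T ?f) = 0" if "i = 0 \<or> i = 1" for i
  proof -
    have "T (pd i ?f) = T (\<lambda>x. 0)"
      by (rule T_cong[OF smooth_onD(1)[OF s] 0]) (use that d in \<open>auto simp: pd_def wirtinger_z_def
          wirtinger_zbar_def\<close>)
    then show ?thesis by (simp add: T_pd[OF s 0] T_zero)
  qed
  from this[of 0] this[of 1] have "cf (deriv_z (T ?f)) e = 0" "cf (deriv_zbar (T ?f)) e = 0" for e
    by (simp_all add: fd_def)
  note z = this
  show ?thesis
    unfolding is_param_iff
  proof (intro allI impI)
    fix k l e assume "(k, l) \<noteq> (0 :: nat, 0 :: nat)"
    then consider k' where "k = Suc k'" | l' where "l = Suc l'" by (metis not0_implies_Suc)
    then show "cf (T ?f) (k, l, e) = 0"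
    proof cases
      case (1 k') then show ?thesis using z(1)[of "(k', l, e)"]
          by (cases e) (simp add: cf_derivs del: of_nat_Suc)
    next
      case (2 l') then show ?thesis using z(2)[of "(k, l', e)"]
          by (cases e) (simp add: cf_derivs del: of_nat_Suc)
    qed
  qed
qed

text \<open>Parameter derivatives stay within the set x = 0 where \<open>f\<close> vanishes, so the
  induction passes from \<open>f\<close> to \<open>pd i f\<close>. It serves to turn a fixed point
  for all parameters into \<open>fixes_origin\<close>.\<close>

lemma T_vanish:
  assumes f: "smooth_on S f" and 0: "0 \<in> S" and z: "\<And>\<mu>. (\<mu>, 0) \<in> S \<Longrightarrow> f (\<mu>, 0) = 0"
  shows "cf (T f) (0, 0, a, b, c) = 0"
  using f z
proof (induction "a + b + c" arbitrary: f a b c)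
  case 0
  have "f (0, 0) = 0" using 0(3)[of 0] \<open>0 \<in> S\<close> by (simp add: zero_prod_def)
  then have "f 0 = 0" by (simp flip: zero_prod_def)
  then show ?case using 0 by (simp add: T_0)
next
  case (Suc m)
  let ?L = "\<lambda>\<mu> :: params. (\<mu>, 0 :: real^2)"
  have L: "bounded_linear ?L" by (intro bounded_linear_Pair bounded_linear_ident bounded_linear_zero)
  have d: "dir_deriv (v, 0) f (\<mu>, 0) = 0" if "(\<mu>, 0) \<in> S" for v \<mu>
  proof -
    have "dir_deriv v (\<lambda>\<mu>. f (?L \<mu>)) \<mu> = dir_deriv (v, 0) f (\<mu>, 0)"
      by (rule dir_deriv_chain_bl[OF L smooth_onD(3)[OF Suc(3) that]])
    moreover have "dir_deriv v (\<lambda>\<mu>. f (?L \<mu>)) \<mu> = dir_deriv v (\<lambda>\<mu>. 0) \<mu>"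
      by (rule dir_deriv_cong(1)[OF open_vimage_bl[OF L smooth_onD(1)[OF Suc(3)]]]) (use that Suc(4)
          in auto)
    moreover have "dir_deriv v (\<lambda>\<mu>. 0 :: complex) \<mu> = 0"
        by (rule dir_deriv_eq) (rule has_derivative_const)
    ultimately show ?thesis by simp
  qed
  have pz: "pd i f (\<mu>, 0) = 0" if "2 \<le> i" "(\<mu>, 0) \<in> S" for i \<mu>
    using that d by (auto simp: pd_def)
  have IH: "cf (fd i (T f)) (0, 0, a', b', c') = 0" if "2 \<le> i" "m = a' + b' + c'" for i a' b' c'
    using Suc(1)[OF that(2) smooth_on_pd[OF Suc(3), of i]] pz[OF that(1)]
        by (simp add: T_pd[OF Suc(3) \<open>0 \<in> S\<close>])
  consider a' where "a = Suc a'" | b' where "b = Suc b'" | c' where "c = Suc c'"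
    using Suc(2) by (metis add_is_0 nat.distinct(1) not0_implies_Suc)
  then show ?case
  proof cases
    case (1 a') then show ?thesis using IH[of 2 a' b c] Suc(2)
        by (simp add: fd_def cf_derivs del: of_nat_Suc)
  next
    case (2 b') then show ?thesis using IH[of 3 a b' c] Suc(2)
        by (simp add: fd_def cf_derivs del: of_nat_Suc)
  next
    case (3 c') then show ?thesis using IH[of 4 a b c'] Suc(2)
        by (simp add: fd_def cf_derivs del: of_nat_Suc)
  qed
qed

text \<open>Numbered like \<open>pd\<close>: \<open>coord j\<close> is the parameter that
  \<open>pd j\<close> differentiates, with complex values so that \<open>T\<close> applies.\<close>

definition coord :: "nat \<Rightarrow> params \<Rightarrow> complex" where
  "coord j = (\<lambda>(a, b, c). of_real (if j = 2 then a else if j = 3 then b else c))"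

lemma bl_coord: "bounded_linear (coord j)"
  unfolding coord_def case_prod_beta
  by (rule bounded_linear_compose[OF bounded_linear_of_real])
    (cases "j = 2"; cases "j = 3"; auto intro!: bounded_linear_fst bounded_linear_snd
        bounded_linear_compose[OF bounded_linear_fst] bounded_linear_compose[OF bounded_linear_snd])

lemma coord_0: "coord j 0 = 0"
  by (simp add: coord_def zero_prod_def)

lemma T_coord: "T (\<lambda>w. coord 2 (fst w)) = param_monom 1 0 0" "T (\<lambda>w. coord 3 (fst w))
    = param_monom 0 1 0"
  "T (\<lambda>w. coord 4 (fst w)) = param_monom 0 0 1"
proof -
  have b: "bounded_linear (\<lambda>w :: point. coord j (fst w))" for j
    by (rule bounded_linear_compose[OF bl_coord bl_fst])
  have s: "smooth_on UNIV (\<lambda>w :: point. coord j (fst w))" for j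
      by (rule smooth_on_linear[OF open_UNIV b])
  have p: "fd i (T (\<lambda>w. coord j (fst w))) = const_series (pd i (\<lambda>w. coord j (fst w)) 0)" for i j
  proof -
    have "pd i (\<lambda>w. coord j (fst w)) = (\<lambda>x. pd i (\<lambda>w. coord j (fst w)) 0)"
      by (auto simp: fun_eq_iff pd_def wirtinger_z_def wirtinger_zbar_def dir_deriv_bl[OF b])
    then have "T (pd i (\<lambda>w. coord j (fst w))) = const_series (pd i (\<lambda>w. coord j (fst w)) 0)"
        by (metis T_const)
    then show ?thesis by (simp add: T_pd[OF s])
  qed
  have q: "fd i (monom_series 1 (0, 0, a, b, c)) = const_series (if i = 2 \<and> (a, b, c) = (1, 0, 0) \<or>
    i = 3 \<and> (a, b, c) = (0, 1, 0) \<or> 4 \<le> i \<and> (a, b, c) = (0, 0, 1) then 1 else 0)"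
    if "a + b + c = 1" for a b c i
    unfolding fd_def deriv_z_monom deriv_zbar_monom deriv_p_monom mono_eqs(1)
    by (rule cf_eqI) (use that in \<open>auto simp: cf_mono\<close>)
  have v: "pd i (\<lambda>w. coord j (fst w)) 0 = (if i = 2 \<and> j = 2 \<or> i = 3 \<and> j = 3 \<or> 4 \<le> i \<and> j = 4 then 1
      else 0)"
    if "j = 2 \<or> j = 3 \<or> j = 4" for i j
    using that by (auto simp: pd_def wirtinger_z_def wirtinger_zbar_def dir_deriv_bl[OF b] coord_0)
        (auto simp: coord_def)
  show "T (\<lambda>w. coord 2 (fst w)) = param_monom 1 0 0" "T (\<lambda>w. coord 3 (fst w)) = param_monom 0 1 0"
    "T (\<lambda>w. coord 4 (fst w)) = param_monom 0 0 1"
    by (rule series_eq_fd; simp add: p q v mono_eqs(4) T_0 cf_mono; simp add: coord_def zero_prod_def)+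
qed

context
  fixes U :: "params set" and \<psi> :: "params \<Rightarrow> params"
  assumes psi: "smooth_on U \<psi>" and U0: "0 \<in> U" and psi0: "\<psi> 0 = 0"
begin

lemma smooth_on_coord: "smooth_on U (\<lambda>x. coord j (\<psi> x))"
  by (rule smooth_on_linear_comp[OF bl_coord psi])

lemma param_subst_taylor: "real_param_subst (T (\<lambda>w. coord 2 (\<psi> (fst w)))) (T (\<lambda>w. coord 3 (\<psi> (fst
    w)))) (T (\<lambda>w. coord 4 (\<psi> (fst w))))"
proof -
  have "is_param (T (\<lambda>w. coord j (\<psi> (fst w))))" for j
    using T_param[OF smooth_on_coord U0] .
  moreover have "T (\<lambda>w. coord j (\<psi> (fst w))) \<in> Fil 1 1" for j
  proof (rule FilI)
    fix e assume "wt 1 e < 1"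
    then have "e = (0, 0, 0, 0, 0)" by (cases e) auto
    then show "cf (T (\<lambda>w. coord j (\<psi> (fst w)))) e = 0"
        by (simp add: T_0 psi0) (simp add: coord_def zero_prod_def)
  qed
  moreover have "cnj_series (T (\<lambda>w. coord j (\<psi> (fst w)))) = T (\<lambda>w. coord j (\<psi> (fst w)))" for j
  proof -
    have "smooth_on {w. fst w \<in> U} (\<lambda>w :: point. coord j (\<psi> (fst w)))"
      by (rule smooth_on_compose_bl[OF bl_fst smooth_on_coord])
    then have "T (\<lambda>w. cnj (coord j (\<psi> (fst w)))) = cnj_series (T (\<lambda>w. coord j (\<psi> (fst w))))"
      by (rule T_cnj[rotated]) (use U0 in simp)
    then show ?thesis by (simp add: coord_def case_prod_beta)
  qed
  ultimately show ?thesis by unfold_locales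
qed

interpretation real_param_subst "T (\<lambda>w. coord 2 (\<psi> (fst w)))" "T (\<lambda>w. coord 3 (\<psi> (fst w)))"
    "T (\<lambda>w. coord 4 (\<psi> (fst w)))"
  by (rule param_subst_taylor)

lemma reparam_domain:
  assumes S': "open S'" "0 \<in> S'"
  shows "\<exists>S. 0 \<in> S \<and> S \<subseteq> {w :: point. fst w \<in> U} \<and> (\<lambda>w. (\<psi> (fst w), snd w)) ` S \<subseteq> S' \<and>
    smooth_on S (\<lambda>w. (\<psi> (fst w), snd w))"
proof -
  define \<Psi> :: "point \<Rightarrow> point" where "\<Psi> w = (\<psi> (fst w), snd w)" for w
  define V where "V = {w :: point. fst w \<in> U}"
  have V: "open V" unfolding V_def by (rule open_vimage_bl[OF bl_fst smooth_onD(1)[OF psi]])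
  have sp: "smooth_on V \<Psi>"
  proof -
    have "smooth_on V (\<lambda>w. \<psi> (fst w))" unfolding V_def by (rule smooth_on_compose_bl[OF bl_fst psi])
    then have "smooth_on V (\<lambda>w. (\<psi> (fst w), 0 :: real^2))"
      by (rule smooth_on_linear_comp[rotated]) (intro bounded_linear_Pair bounded_linear_ident
          bounded_linear_zero)
    moreover have "smooth_on V (\<lambda>w. (0 :: params, snd w :: real^2))"
      by (intro smooth_on_linear V bounded_linear_Pair bounded_linear_snd bounded_linear_zero)
    ultimately have "smooth_on V (\<lambda>w. (\<psi> (fst w), 0) + (0, snd w))" by (rule smooth_on_add)
    then show ?thesis by (simp add: \<Psi>_def[abs_def])
  qed
  define S where "S = V \<inter> \<Psi> -` S'"
  have "continuous_on V \<Psi>" using smooth_onD(2)[OF sp, of 0] by simp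
  then have S: "open S"
    unfolding S_def using V S'(1) by (metis continuous_open_preimage)
  have S0: "0 \<in> S" using U0 S'(2) by (simp add: S_def V_def \<Psi>_def psi0 flip: zero_prod_def)
  have SV: "S \<subseteq> V" "\<Psi> ` S \<subseteq> S'" by (auto simp: S_def)
  have sS: "smooth_on S \<Psi>" by (rule smooth_on_subset[OF sp S SV(1)])
  show ?thesis
    using S0 SV sS unfolding V_def \<Psi>_def[abs_def] by blast
qed

text \<open>Plane derivatives pass through the reparametrization unchanged; parameter derivatives
  give the same three terms on the smooth side as \<open>sub_chain\<close> gives on the formal
  side.\<close>

lemma T_compose:
  assumes f: "smooth_on S' f" and S': "0 \<in> S'"
  shows "T (\<lambda>w. f (\<psi> (fst w), snd w)) = sub (T f)"
proof -
  define \<Psi> :: "point \<Rightarrow> point" where "\<Psi> w = (\<psi> (fst w), snd w)" for w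
  define V where "V = {w :: point. fst w \<in> U}"
  obtain S where S0: "0 \<in> S" and SV: "S \<subseteq> V" "\<Psi> ` S \<subseteq> S'" and sS: "smooth_on S \<Psi>"
    using reparam_domain[OF smooth_onD(1)[OF f] S'] unfolding V_def \<Psi>_def[abs_def] by blast
  note S = smooth_onD(1)[OF sS]
  have sf: "smooth_on S (\<lambda>w. f (\<Psi> w))" if "smooth_on S' f" for f :: "point \<Rightarrow> complex"
    by (rule smooth_on_compose[OF that sS SV(2)])
  have sg: "smooth_on S (\<lambda>w. coord j (\<psi> (fst w)))" for j
    by (rule smooth_on_subset[OF smooth_on_compose_bl[OF bl_fst smooth_on_coord] S]) (use SV in
        \<open>auto simp: V_def\<close>)
  have dP: "dir_deriv v \<Psi> w = (dir_deriv (fst v) \<psi> (fst w), snd v)" if "w \<in> S" for v w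
  proof -
    have "fst w \<in> U" using that SV by (auto simp: V_def)
    then have "\<psi> differentiable at (fst w)" by (rule smooth_onD(3)[OF psi])
    then have "((\<lambda>w. \<psi> (fst w)) has_derivative (\<lambda>v. dir_deriv (fst v) \<psi> (fst w))) (at w)"
      using has_derivative_compose[OF bounded_linear_imp_has_derivative[OF bl_fst]
          has_derivative_dir] by blast
    then have "(\<Psi> has_derivative (\<lambda>v. (dir_deriv (fst v) \<psi> (fst w), snd v))) (at w)"
      unfolding \<Psi>_def[abs_def]
      by (intro has_derivative_Pair bounded_linear_imp_has_derivative bounded_linear_snd)
    then show ?thesis by (rule dir_deriv_eq)
  qed
  have dc: "dir_deriv v (\<lambda>w. f (\<Psi> w)) w = dir_deriv (dir_deriv (fst v) \<psi> (fst w), snd v) f (\<Psi> w)"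
    if "smooth_on S' f" "w \<in> S" for f :: "point \<Rightarrow> complex" and v w
    using dir_deriv_chain(1)[OF smooth_onD(3)[OF sS that(2)] smooth_onD(3)[OF that(1)], of v] that SV
    by (auto simp: dP)
  have dg: "dir_deriv (m, 0) (\<lambda>w. coord j (\<psi> (fst w))) w = coord j (dir_deriv m \<psi> (fst w))" if
      "w \<in> S" for m j w
  proof -
    have U: "fst w \<in> U" using that SV by (auto simp: V_def)
    have "dir_deriv (m, 0) (\<lambda>w :: point. coord j (\<psi> (fst w))) w
        = dir_deriv m (\<lambda>x. coord j (\<psi> x)) (fst w)"
      using dir_deriv_chain_bl[OF bl_fst smooth_onD(3)[OF smooth_on_coord U], of "(m, 0)"] by simp
    also have "\<dots> = coord j (dir_deriv m \<psi> (fst w))"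
      by (rule dir_deriv_linear_comp[OF bl_coord smooth_onD(3)[OF psi U]])
    finally show ?thesis .
  qed
  have p01: "pd i (\<lambda>w. f (\<Psi> w)) w = pd i f (\<Psi> w)" if "smooth_on S' f" "w \<in> S" "i < 2" for f w i
  proof -
    have "dir_deriv 0 \<psi> (fst w) = 0" using that(2) SV
        by (intro dir_deriv_0 smooth_onD(3)[OF psi]) (auto simp: V_def)
    then show ?thesis using that by (auto simp: pd_def wirtinger_z_def wirtinger_zbar_def dc)
  qed
  have p234: "pd i (\<lambda>w. f (\<Psi> w)) w = pd 2 f (\<Psi> w) * pd i (\<lambda>w. coord 2 (\<psi> (fst w))) w
     + pd 3 f (\<Psi> w) * pd i (\<lambda>w. coord 3 (\<psi> (fst w))) w + pd 4 f (\<Psi> w)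
         * pd i (\<lambda>w. coord 4 (\<psi> (fst w))) w"
    if "smooth_on S' f" "w \<in> S" "\<not> i < 2" for f w i
  proof -
    have lin: "linear (\<lambda>v. dir_deriv v f (\<Psi> w))"
      using that SV by (intro dir_deriv_linear smooth_onD(3)[OF that(1)]) auto
    have "dir_deriv (d, 0) f (\<Psi> w) = coord 2 d * dir_deriv ((1, 0, 0), 0) f (\<Psi> w)
      + coord 3 d * dir_deriv ((0, 1, 0), 0) f (\<Psi> w) + coord 4 d * dir_deriv ((0, 0, 1), 0) f (\<Psi> w)"
          for d
    proof -
      obtain x y z where d: "d = (x, y, z)" by (cases d)
      have "(d, 0) = x *\<^sub>R ((1, 0, 0), 0) + y *\<^sub>R ((0, 1, 0), 0) + z *\<^sub>R ((0, 0, 1), 0 :: real^2)"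
          by (simp add: d)
      then have "dir_deriv (d, 0) f (\<Psi> w) = dir_deriv (x *\<^sub>R ((1, 0, 0), 0) + y *\<^sub>R ((0, 1, 0), 0) + z
          *\<^sub>R ((0, 0, 1), 0 :: real^2)) f (\<Psi> w)"
        by (rule arg_cong)
      also have "\<dots> = x *\<^sub>R dir_deriv ((1, 0, 0), 0) f (\<Psi> w) + y *\<^sub>R dir_deriv ((0, 1, 0), 0) f (\<Psi> w)
          + z *\<^sub>R dir_deriv ((0, 0, 1), 0) f (\<Psi> w)"
        by (simp only: linear_add[OF lin] linear_scale[OF lin])
      finally show ?thesis by (simp add: d coord_def scaleR_conv_of_real)
    qed
    note D = this
    have "\<exists>m. \<forall>g. pd i g = dir_deriv (m, 0) g"
      using that(3) by (cases "i = 2"; cases "i = 3") (auto simp: pd_def)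
    then obtain m where m: "\<And>g. pd i g = dir_deriv (m, 0) g" by blast
    have "pd i (\<lambda>w. f (\<Psi> w)) w = dir_deriv (dir_deriv m \<psi> (fst w), 0) f (\<Psi> w)"
      unfolding m dc[OF that(1,2)] by simp
    also have "\<dots> = coord 2 (dir_deriv m \<psi> (fst w)) * pd 2 f (\<Psi> w) + coord 3 (dir_deriv m \<psi> (fst w))
        * pd 3 f (\<Psi> w)
      + coord 4 (dir_deriv m \<psi> (fst w)) * pd 4 f (\<Psi> w)"
      by (rule trans[OF D]) (simp add: pd_def)
    finally show ?thesis unfolding m dg[OF that(2)] by (simp only: mult.commute)
  qed
  have fs: "fd i (sub A) = sub (fd i A)" if "i < 2" for i A
    using that by (cases "i = 0") (auto simp: fd_def sub_deriv_z sub_deriv_zbar)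
  have fc: "fd i (sub A) = sub (fd 2 A) * fd i (T (\<lambda>w. coord 2 (\<psi> (fst w)))) + sub (fd 3 A)
      * fd i (T (\<lambda>w. coord 3 (\<psi> (fst w))))
    + sub (fd 4 A) * fd i (T (\<lambda>w. coord 4 (\<psi> (fst w))))" if "\<not> i < 2" for i A
  proof -
    have "fd i Z = 0" "fd i Zbar = 0" using that
      by (rule_tac cf_eqI; auto simp: fd_def mono_eqs(2,3) cf_derivs cf_mono)+
    then have "fd i (sub A) = sub (deriv_p1 A) * fd i (T (\<lambda>w. coord 2 (\<psi> (fst w))))
        + sub (deriv_p2 A) * fd i (T (\<lambda>w. coord 3 (\<psi> (fst w))))
      + sub (deriv_p3 A) * fd i (T (\<lambda>w. coord 4 (\<psi> (fst w))))"
      by (intro sub_chain fd_derivation fd_cadd fd_const)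
    then show ?thesis by (simp add: fd_def)
  qed
  let ?D = "\<lambda>f. T (\<lambda>w. f (\<Psi> w)) - sub (T f)"
  have "?D f = 0"
  proof (rule jet_zero[of "smooth_on S'" ?D])
    fix N i :: nat and f :: "point \<Rightarrow> complex"
    assume IH: "\<And>f. smooth_on S' f \<Longrightarrow> ?D f \<in> Fil 1 N" and f: "smooth_on S' f"
    have 1: "fd i (T (\<lambda>w. f (\<Psi> w))) = T (pd i (\<lambda>w. f (\<Psi> w)))"
      by (rule T_pd[symmetric, OF sf[OF f] S0])
    show "fd i (?D f) \<in> Fil 1 N"
    proof (cases "i < 2")
      case True
      have "T (pd i (\<lambda>w. f (\<Psi> w))) = T (\<lambda>w. pd i f (\<Psi> w))"
        by (rule T_cong[OF S S0]) (rule p01[OF f _ True])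
      then have "fd i (?D f) = ?D (pd i f)"
        by (simp add: fd_diff 1 fs[OF True] T_pd[OF f S'])
      then show ?thesis using IH[OF smooth_on_pd[OF f]] by simp
    next
      case False
      have "T (pd i (\<lambda>w. f (\<Psi> w))) = T (\<lambda>w. pd 2 f (\<Psi> w) * pd i (\<lambda>w. coord 2 (\<psi> (fst w))) w
         + pd 3 f (\<Psi> w) * pd i (\<lambda>w. coord 3 (\<psi> (fst w))) w + pd 4 f (\<Psi> w)
             * pd i (\<lambda>w. coord 4 (\<psi> (fst w))) w)"
        by (rule T_cong[OF S S0]) (rule p234[OF f _ False])
      also have "\<dots> = T (\<lambda>w. pd 2 f (\<Psi> w)) * T (pd i (\<lambda>w. coord 2 (\<psi> (fst w))))
         + T (\<lambda>w. pd 3 f (\<Psi> w)) * T (pd i (\<lambda>w. coord 3 (\<psi> (fst w)))) + T (\<lambda>w. pd 4 f (\<Psi> w))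
             * T (pd i (\<lambda>w. coord 4 (\<psi> (fst w))))"
        by (simp add: T_add[OF S S0] T_mult[OF S S0] smooth_on_add smooth_on_mult smooth_on_pd sf f sg)
      \<comment> \<open>Only defects of derivatives of \<open>f\<close> remain, with series as
        factors, and such factors do not lower the order.\<close>
      finally have "fd i (?D f) = ?D (pd 2 f) * fd i (T (\<lambda>w. coord 2 (\<psi> (fst w)))) +
          ?D (pd 3 f) * fd i (T (\<lambda>w. coord 3 (\<psi> (fst w)))) + ?D (pd 4 f)
              * fd i (T (\<lambda>w. coord 4 (\<psi> (fst w))))"
        unfolding fd_diff 1 fc[OF False] T_pd[OF f S'] T_pd[OF sg S0] by (simp add: algebra_simps)
      then show ?thesis by (simp only:) (intro Fil_add Fil_mult_right IH smooth_on_pd f)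
    qed
  next
    fix f :: "point \<Rightarrow> complex" assume "smooth_on S' f"
    have "cf (sub (T f)) (0, 0, 0, 0, 0) = f 0" by (simp add: cf_sub T_0 gm_def cf_1)
    moreover have "\<Psi> 0 = 0" by (simp add: \<Psi>_def psi0 flip: zero_prod_def)
    ultimately show "cf (?D f) (0, 0, 0, 0, 0) = 0" by (simp add: T_0)
  qed (rule f)
  then show ?thesis by (simp add: \<Psi>_def)
qed

end

text \<open>Functions of (mu_1, mu_2) are regarded as functions of all variables, so that a single
  notion of Taylor series is manipulated; \<open>pd 3\<close> and \<open>pd 4\<close> become the two
  partial derivatives.\<close>

lemma cf_T_taylor2:
  assumes h: "smooth_on U h" and 0: "0 \<in> U"
  shows "cf (T (\<lambda>w. h (snd (fst w)))) (k, l, a, b, c) =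
    (if k = 0 \<and> l = 0 \<and> a = 0 then fps_nth (fps_nth (taylor_series2 h) b) c else 0)"
proof -
  define K :: "point \<Rightarrow> real \<times> real" where "K w = snd (fst w)" for w
  have K: "bounded_linear K" unfolding K_def[abs_def]
      by (intro bounded_linear_compose[OF bounded_linear_snd] bounded_linear_fst)
  define S where "S = {w. K w \<in> U}"
  have S: "open S" unfolding S_def by (rule open_vimage_bl[OF K smooth_onD(1)[OF h]])
  have S0: "0 \<in> S" using 0 by (simp add: S_def K_def)
  have sm: "smooth_on S (\<lambda>w. g (K w))" if "smooth_on U g" for g :: "_ \<Rightarrow> complex"
    unfolding S_def by (rule smooth_on_compose_bl[OF K that])
  have d: "dir_deriv v (\<lambda>w. g (K w)) w = dir_deriv (K v) g (K w)" if "smooth_on U g" "w \<in> S"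
      for g :: "_ \<Rightarrow> complex" and v w
    by (rule dir_deriv_chain_bl[OF K smooth_onD(3)[OF that(1)]]) (use that in \<open>simp add: S_def\<close>)
  have it: "smooth_on U ((dir_deriv v ^^ m) g)" if "smooth_on U g" for v m and g :: "_ \<Rightarrow> complex"
    using that by (induction m) (auto intro: smooth_on_dir_deriv)
  have p4: "(pd 4 ^^ m) (\<lambda>w. g (K w)) x = (dir_deriv (0, 1) ^^ m) g (K x)" if "smooth_on U g"
      "x \<in> S" for m x and g :: "_ \<Rightarrow> complex"
    using that(2)
  proof (induction m arbitrary: x)
    case (Suc m)
    have A: "(pd 4 ^^ Suc m) (\<lambda>w. g (K w)) x = pd 4 (\<lambda>w. (dir_deriv (0, 1) ^^ m) g (K w)) x"
      using Suc by (auto intro: pd_cong[OF S])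
    have "pd 4 (\<lambda>w. (dir_deriv (0, 1) ^^ m) g (K w)) x = dir_deriv (K ((0, 0, 1),
        0)) ((dir_deriv (0, 1) ^^ m) g) (K x)"
      using d[OF it[OF that(1)] Suc.prems] by (simp add: pd_def)
    then show ?case unfolding A by (simp add: K_def)
  qed simp
  have p3: "(pd 3 ^^ m) (\<lambda>w. g (K w)) x = (dir_deriv (1, 0) ^^ m) g (K x)" if "smooth_on U g"
      "x \<in> S" for m x and g :: "_ \<Rightarrow> complex"
    using that(2)
  proof (induction m arbitrary: x)
    case (Suc m)
    have A: "(pd 3 ^^ Suc m) (\<lambda>w. g (K w)) x = pd 3 (\<lambda>w. (dir_deriv (1, 0) ^^ m) g (K w)) x"
      using Suc by (auto intro: pd_cong[OF S])
    have "pd 3 (\<lambda>w. (dir_deriv (1, 0) ^^ m) g (K w)) x = dir_deriv (K ((0, 1, 0),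
        0)) ((dir_deriv (1, 0) ^^ m) g) (K x)"
      using d[OF it[OF that(1)] Suc.prems] by (simp add: pd_def)
    then show ?case unfolding A by (simp add: K_def)
  qed simp
  let ?f = "\<lambda>w. h (K w)"
  have "cf (T ?f) (0, 0, 0, b, c) = fps_nth (fps_nth (taylor_series2 h) b) c"
  proof -
    have "(pd 3 ^^ b) ((pd 4 ^^ c) ?f) 0 = (pd 3 ^^ b) (\<lambda>w. (dir_deriv (0, 1) ^^ c) h (K w)) 0"
      by (rule pd_pow_cong[OF S _ S0]) (rule p4[OF h])
    also have "\<dots> = (dir_deriv (1, 0) ^^ b) ((dir_deriv (0, 1) ^^ c) h) 0"
      using p3[OF it[OF h] S0] by (simp add: K_def)
    finally show ?thesis by (simp add: cf_T taylor_series2_def)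
  qed
  moreover have "cf (T ?f) (k, l, a, b, c) = 0" if nz: "a \<noteq> 0"
  proof -
    obtain a' where a: "a = Suc a'" using nz by (cases a) auto
    have "T (pd 2 ?f) = T (\<lambda>w. 0)"
    proof (rule T_cong[OF S S0])
      fix w assume w: "w \<in> S"
      have "dir_deriv 0 h (K w) = 0" using w by (intro dir_deriv_0 smooth_onD(3)[OF h]) (simp add:
          S_def)
      then show "pd 2 ?f w = 0" using d[OF h w, of "((1, 0, 0), 0)"]
          by (simp add: pd_def K_def flip: zero_prod_def)
    qed
    then have "fd 2 (T ?f) = 0" by (simp add: T_pd[OF sm[OF h] S0] T_zero)
    then have "cf (deriv_p1 (T ?f)) (k, l, a', b, c) = 0" by (simp add: fd_def)
    then show ?thesis by (simp add: a cf_derivs del: of_nat_Suc)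
  qed
  moreover have "is_param (T ?f)"
  proof -
    have "smooth_on {w :: params. snd w \<in> U} (\<lambda>w. h (snd w))"
      by (rule smooth_on_compose_bl[OF bounded_linear_snd h])
    then show ?thesis unfolding K_def by (rule T_param) (use 0 in simp)
  qed
  ultimately show ?thesis unfolding is_param_iff K_def by auto
qed

section \<open>Polar form of the normal form\<close>

lemma cf_series_sum:
  "cf (series_sum f A) e = (\<Sum>i\<in>{i\<in>A. cf (f i) e \<noteq> 0}. cf (f i) e)"
  by (cases e) (simp add: series_sum_def cf_mk cf_simp)

text \<open>In both sums of the final form distinct indices contribute to distinct exponents, so
  each coefficient comes from at most one index.\<close>

lemma cf_series_sum_single:
  assumes "\<And>i. i \<in> A \<Longrightarrow> cf (f i) e \<noteq> 0 \<Longrightarrow> i = i0"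
  shows "cf (series_sum f A) e = (if i0 \<in> A then cf (f i0) e else 0)"
proof -
  have "{i\<in>A. cf (f i) e \<noteq> 0} = (if i0 \<in> A \<and> cf (f i0) e \<noteq> 0 then {i0} else {})"
    using assms by auto
  then show ?thesis by (auto simp: cf_series_sum)
qed

lemma cf_series_sum_zero:
  assumes "\<And>i. i \<in> A \<Longrightarrow> cf (f i) e = 0"
  shows "cf (series_sum f A) e = 0"
  using assms unfolding cf_series_sum by (intro sum.neutral) auto

lemma monom_prod: "const_series x * (Z ^ k * Zbar ^ l * param_monom p q r) = monom_series x (k, l,
    p, q, r)"
  by (simp add: monom_series_def)

lemma I_pow_eq: "I_pow k = Z ^ k * Zbar ^ k"
  by (simp add: I_pow_def power_mult_distrib)

lemma cf_action_series:
  "cf (I_pow 2 * series_sum (\<lambda>(k, m1, m2, m3). const_series (of_real (a k m1 m2 m3)) * I_pow k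
              * param_monom m1 m2 m3) UNIV) (K, L, p, q, r) =
   (if K = L \<and> 2 \<le> K then of_real (a (K - 2) p q r) else 0)"
proof -
  let ?f = "\<lambda>(k, m1, m2, m3). const_series (of_real (a k m1 m2 m3)) * I_pow k * param_monom m1 m2 m3"
  have f: "?f (k, m1, m2, m3) = monom_series (of_real (a k m1 m2 m3)) (k, k, m1, m2, m3)" for k m1 m2 m3
    by (simp add: I_pow_eq mult.assoc flip: monom_prod)
  have "cf (series_sum ?f UNIV) (K, L, p, q, r) = (if K = L then of_real (a K p q r) else 0)" for K L
  proof (subst cf_series_sum_single[where ?i0.0 = "(K, p, q, r)"])
    fix i assume nz: "cf (?f i) (K, L, p, q, r) \<noteq> 0"
    obtain k m1 m2 m3 where i: "i = (k, m1, m2, m3)" by (cases i)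
    show "i = (K, p, q, r)" using nz unfolding i f cf_mono by (auto split: if_splits)
  next
    show "(if (K, p, q, r) \<in> UNIV then cf (?f (K, p, q, r)) (K, L, p, q, r) else 0) = (if K = L
        then of_real (a K p q r) else 0)"
      unfolding f cf_mono by simp
  qed
  then show ?thesis by (auto simp: I_pow_eq cf_Z_mult)
qed

lemma resonant_term:
  "const_series (of_real x) * param_monom p q r * I_cos m m \<psi> =
    monom_series (of_real x * cis \<psi> / 2) (m, 0, p, q, r) + monom_series (of_real x
        * cis (- \<psi>) / 2) (0, m, p, q, r)"
proof -
  have "(m + m) div 2 = m" by simp
  then have I: "I_cos m m \<psi> = const_series (cis \<psi> / 2) * Z ^ m + const_series (cis (- \<psi>) / 2)
      * Zbar ^ m"
    by (simp add: I_cos_def)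
  have q: "const_series (of_real x * y / 2) = const_series (of_real x) * const_series (y / 2)" for y
    by (simp flip: const_series_mult)
  show ?thesis unfolding I monom_series_def prod.case q by (simp add: distrib_left mult_ac)
qed

lemma cf_resonant_series:
  fixes c \<psi> :: "nat \<Rightarrow> nat \<Rightarrow> nat \<Rightarrow> nat \<Rightarrow> real"
  assumes n: "0 < n"
  defines "R \<equiv> series_sum (\<lambda>(k, m1, m2, m3). const_series (of_real (c k m1 m2 m3))
      * param_monom m1 m2 m3
              * I_cos ((k + 1) * n) ((k + 1) * n) (\<psi> k m1 m2 m3)) {(k, m1, m2, m3). 1 \<le> k + m1}"
  shows "cf R (Suc k * n, 0, p, q, r) = (if 1 \<le> k + p then of_real (c k p q r) * cis (\<psi> k p q r) / 2
      else 0)"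
    "cf R (0, Suc k * n, p, q, r) = (if 1 \<le> k + p then of_real (c k p q r) * cis (- \<psi> k p q r) / 2
        else 0)"
    "\<not> (L = 0 \<and> 0 < K \<and> n dvd K) \<Longrightarrow> \<not> (K = 0 \<and> 0 < L \<and> n dvd L) \<Longrightarrow> cf R (K, L, p, q, r) = 0"
proof -
  let ?f = "\<lambda>(k, m1, m2, m3). const_series (of_real (c k m1 m2 m3)) * param_monom m1 m2 m3
              * I_cos ((k + 1) * n) ((k + 1) * n) (\<psi> k m1 m2 m3)"
  have f: "?f (k, m1, m2, m3) = monom_series (of_real (c k m1 m2 m3)
      * cis (\<psi> k m1 m2 m3) / 2) (Suc k * n, 0, m1, m2, m3)
     + monom_series (of_real (c k m1 m2 m3) * cis (- \<psi> k m1 m2 m3) / 2) (0, Suc k * n, m1, m2, m3)"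
         for k m1 m2 m3
    using resonant_term by simp
  have inj: "Suc i * n = Suc j * n \<longleftrightarrow> i = j" for i j using n by (metis Suc_inject mult_cancel2 not_gr0)
  have nz: "Suc i * n \<noteq> 0" for i using n by simp
  show "cf R (Suc k * n, 0, p, q, r) = (if 1 \<le> k + p then of_real (c k p q r) * cis (\<psi> k p q r) / 2
      else 0)"
    unfolding R_def
  proof (subst cf_series_sum_single[where ?i0.0 = "(k, p, q, r)"])
    fix i assume nz': "cf (?f i) (Suc k * n, 0, p, q, r) \<noteq> 0"
    obtain k' m1 m2 m3 where i: "i = (k', m1, m2, m3)" by (cases i)
    show "i = (k, p, q, r)"
      using nz' unfolding i f cf_add cf_mono using nz[of k] inj by (auto simp del: mult_Suc split:
          if_splits)
  qed (use nz[of k] in \<open>simp only: f cf_add cf_mono, auto simp del: mult_Suc\<close>)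
  show "cf R (0, Suc k * n, p, q, r) = (if 1 \<le> k + p then of_real (c k p q r)
      * cis (- \<psi> k p q r) / 2 else 0)"
    unfolding R_def
  proof (subst cf_series_sum_single[where ?i0.0 = "(k, p, q, r)"])
    fix i assume nz': "cf (?f i) (0, Suc k * n, p, q, r) \<noteq> 0"
    obtain k' m1 m2 m3 where i: "i = (k', m1, m2, m3)" by (cases i)
    show "i = (k, p, q, r)"
      using nz' unfolding i f cf_add cf_mono using nz[of k] inj by (auto simp del: mult_Suc split:
          if_splits)
  qed (use nz[of k] in \<open>simp only: f cf_add cf_mono, auto simp del: mult_Suc\<close>)
  assume *: "\<not> (L = 0 \<and> 0 < K \<and> n dvd K)" "\<not> (K = 0 \<and> 0 < L \<and> n dvd L)"
  show "cf R (K, L, p, q, r) = 0"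
    unfolding R_def
  proof (rule cf_series_sum_zero)
    fix i :: "nat \<times> nat \<times> nat \<times> nat"
    obtain k' m1 m2 m3 where i: "i = (k', m1, m2, m3)" by (cases i)
    have "(Suc k' * n, 0) \<noteq> (K, L)" "(0, Suc k' * n) \<noteq> (K, L)"
      using * nz[of k'] by (auto simp del: mult_Suc)
    then show "cf (?f i) (K, L, p, q, r) = 0" unfolding i f cf_add cf_mono by auto
  qed
qed

lemma cf_leading:
  "cf (leading_resonant_term n) (K, L, p, q, r) =
    (if (K, L, p) = (n, 0, 0) \<and> (q, r) = (1, 0) then 1 else 0) + (if (K, L, p) = (n, 0, 0) \<and> (q, r)
        = (0, 1) then \<i> else 0) +
    (if (K, L, p) = (0, n, 0) \<and> (q, r) = (1, 0) then 1 else 0) - (if (K, L, p) = (0, n, 0) \<and> (q, r)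
        = (0, 1) then \<i> else 0)"
proof -
  have "leading_resonant_term n = monom_series 1 (n, 0, 0, 1, 0) + monom_series \<i> (n, 0, 0, 0, 1)
    + (monom_series 1 (0, n, 0, 1, 0) - monom_series \<i> (0, n, 0, 0, 1))"
    by (simp add: leading_resonant_term_def monom_series_def algebra_simps)
  then show ?thesis by (auto simp: cf_mono)
qed

text \<open>Diagonal exponents give the action part, mixed ones vanish by \<open>nf\<close>, and
  pure powers are divisible by n by \<open>res\<close> and pair with their conjugates to cosines.
  The epsilon-free part of z^n is the leading term by \<open>n0\<close>, whence the condition k + m1
  \<ge> 1 in the last sum.\<close>

lemma polar_normal_form:
  fixes K :: formal_series
  assumes n: "3 \<le> n" and real: "cnj_series K = K"
    and res: "\<And>k l e. k mod n \<noteq> l mod n \<Longrightarrow> cf K (k, l, e) = 0"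
    and nf: "\<And>k l e. k \<noteq> l \<Longrightarrow> cf K (Suc k, Suc l, e) = 0"
    and 00: "\<And>e. cf K (0, 0, e) = 0" and 11: "\<And>e. cf K (1, 1, e) = (if e = (1, 0, 0) then 1 else 0)"
    and n0: "\<And>b c. cf K (n, 0, 0, b, c) = (if (b, c) = (1, 0) then 1 else if (b, c) = (0, 1) then \<i>
        else 0)"
  shows "\<exists>a c \<psi>. K = param_monom 1 0 0 * I_pow 1
       + leading_resonant_term n
       + I_pow 2 * series_sum
           (\<lambda>(k, m1, m2, m3). const_series (of_real (a k m1 m2 m3)) * I_pow k
              * param_monom m1 m2 m3) UNIV
       + series_sum
           (\<lambda>(k, m1, m2, m3). const_series (of_real (c k m1 m2 m3)) * param_monom m1 m2 m3
              * I_cos ((k + 1) * n) ((k + 1) * n) (\<psi> k m1 m2 m3)) {(k, m1, m2, m3). 1 \<le> k + m1}"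
proof -
  define a where "a k p q r = Re (cf K (k + 2, k + 2, p, q, r))" for k p q r
  \<comment> \<open>The factor 2 compensates the halves in the two exponentials of a cosine.\<close>
  define c where "c k p q r = 2 * cmod (cf K (Suc k * n, 0, p, q, r))" for k p q r
  define \<psi> where "\<psi> k p q r = Arg (cf K (Suc k * n, 0, p, q, r))" for k p q r
  let ?A = "I_pow 2 * series_sum
           (\<lambda>(k, m1, m2, m3). const_series (of_real (a k m1 m2 m3)) * I_pow k
              * param_monom m1 m2 m3) UNIV"
  let ?R = "series_sum
           (\<lambda>(k, m1, m2, m3). const_series (of_real (c k m1 m2 m3)) * param_monom m1 m2 m3
              * I_cos ((k + 1) * n) ((k + 1) * n) (\<psi> k m1 m2 m3)) {(k, m1, m2, m3). 1 \<le> k + m1}"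
  have n': "0 < n" using n by simp
  have one: "param_monom 1 0 0 * I_pow 1 = monom_series 1 (1, 1, 1, 0, 0)"
    by (simp add: I_pow_eq monom_series_def mult.commute)
  have pol: "of_real (c k p q r) * cis (\<psi> k p q r) / 2 = cf K (Suc k * n, 0, p, q, r)" for k p q r
    using rcis_cmod_Arg[of "cf K (Suc k * n, 0, p, q, r)"] by (simp add: c_def \<psi>_def rcis_def)
  have sym: "cf K (k, l, e) = cnj (cf K (l, k, e))" for k l e
    using cf_cnj[of K k l] unfolding real by (cases e) simp
  have pol': "of_real (c k p q r) * cis (- \<psi> k p q r) / 2 = cf K (0, Suc k * n, p, q, r)" for k p q r
    unfolding sym[of 0] pol[symmetric] by (simp add: cis_cnj)
  have "K = monom_series 1 (1, 1, 1, 0, 0) + leading_resonant_term n + ?A + ?R"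
  proof (rule cf_eqI)
    fix e :: expo
    obtain k l p q r where e: "e = (k, l, p, q, r)" by (cases e)
    have n0': "cf K (0, n, 0, b, c) = (if (b, c) = (1, 0) then 1 else if (b, c) = (0, 1) then - \<i>
        else 0)" for b c
      unfolding sym[of 0] n0 by auto
    consider "k = l" | k' l' where "k = Suc k'" "l = Suc l'" "k \<noteq> l" | "l = 0" "0 < k" | "k = 0" "0 < l"
      by (metis neq0_conv not0_implies_Suc)
    then show "cf K e = cf (monom_series 1 (1, 1, 1, 0, 0) + leading_resonant_term n + ?A + ?R) e"
    proof cases
      case 1
      have R: "cf ?R (k, l, p, q, r) = 0" using 1 by (intro cf_resonant_series(3)[OF n']) auto
      have Ld: "cf (leading_resonant_term n) (k, l, p, q, r) = 0" using 1 n by (auto simp: cf_leading)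
      have im: "Im (cf K (k, k, p, q, r)) = 0" using sym[of k k "(p, q, r)"]
          by (metis Reals_cnj_iff complex_is_Real_iff)
      consider "k = 0" | "k = 1" | k' where "k = k' + 2"
          by (metis One_nat_def Suc_1 add.commute add_2_eq_Suc' not0_implies_Suc)
      then show ?thesis
      proof cases
        case 1
        then show ?thesis unfolding e cf_add R Ld cf_action_series cf_mono using \<open>k = l\<close> 00 by simp
      next
        case 2
        then show ?thesis unfolding e cf_add R Ld cf_action_series cf_mono using \<open>k = l\<close> 11 by simp
      next
        case 3
        then show ?thesis unfolding e cf_add R Ld cf_action_series cf_mono
          using \<open>k = l\<close> im by (simp add: a_def complex_eq_iff)
      qed
    next
      case 2
      have R: "cf ?R (k, l, p, q, r) = 0" using 2 by (intro cf_resonant_series(3)[OF n']) auto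
      have Ld: "cf (leading_resonant_term n) (k, l, p, q, r) = 0" using 2 by (auto simp: cf_leading)
      show ?thesis using 2 nf[of k' l'] unfolding e cf_add R Ld cf_action_series cf_mono by auto
    next
      case 3
      have A: "cf ?A (k, l, p, q, r) = 0" using 3 by (simp add: cf_action_series)
      show ?thesis
      proof (cases "n dvd k")
        case True
        then obtain j where j: "k = j * n" by (metis dvd_div_mult_self)
        then obtain k' where k': "k = Suc k' * n" using 3 by (cases j) auto
        have R: "cf ?R (k, l, p, q, r) = (if 1 \<le> k' + p then cf K (k, l, p, q, r) else 0)"
          unfolding k' 3(1) cf_resonant_series(1)[OF n'] pol ..
        have Ld: "cf (leading_resonant_term n) (k, l, p, q, r) = (if 1 \<le> k' + p then 0 else cf K (k,
            l, p, q, r))"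
        proof (cases "k' = 0 \<and> p = 0")
          case True
          then show ?thesis using 3 n n0[of q r] by (auto simp: cf_leading k')
        next
          case False
          then show ?thesis using n by (cases k') (auto simp: cf_leading k' 3(1))
        qed
        show ?thesis unfolding e cf_add A R Ld using 3 by (simp add: cf_mono)
      next
        case False
        have R: "cf ?R (k, l, p, q, r) = 0" using False 3 by (intro cf_resonant_series(3)[OF n']) auto
        have Ld: "cf (leading_resonant_term n) (k, l, p, q, r) = 0" using False 3 n
            by (auto simp: cf_leading)
        have "k mod n \<noteq> 0 mod n" using False by (simp add: dvd_eq_mod_eq_0)
        then have "cf K e = 0" unfolding e 3(1) by (rule res)
        then show ?thesis unfolding e cf_add A R Ld using 3 by (simp add: cf_mono)
      qed
    next
      case 4
      have A: "cf ?A (k, l, p, q, r) = 0" using 4 by (simp add: cf_action_series)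
      show ?thesis
      proof (cases "n dvd l")
        case True
        then obtain j where j: "l = j * n" by (metis dvd_div_mult_self)
        then obtain k' where k': "l = Suc k' * n" using 4 by (cases j) auto
        have R: "cf ?R (k, l, p, q, r) = (if 1 \<le> k' + p then cf K (k, l, p, q, r) else 0)"
          unfolding k' 4(1) cf_resonant_series(2)[OF n'] pol' ..
        have Ld: "cf (leading_resonant_term n) (k, l, p, q, r) = (if 1 \<le> k' + p then 0 else cf K (k,
            l, p, q, r))"
        proof (cases "k' = 0 \<and> p = 0")
          case True
          then show ?thesis using 4 n n0'[of q r] by (auto simp: cf_leading k')
        next
          case False
          then show ?thesis using n by (cases k') (auto simp: cf_leading k' 4(1))
        qed
        show ?thesis unfolding e cf_add A R Ld using 4 by (simp add: cf_mono)
      next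
        case False
        have R: "cf ?R (k, l, p, q, r) = 0" using False 4 by (intro cf_resonant_series(3)[OF n']) auto
        have Ld: "cf (leading_resonant_term n) (k, l, p, q, r) = 0" using False 4 n
            by (auto simp: cf_leading)
        have "0 mod n \<noteq> l mod n" using False by (simp add: dvd_eq_mod_eq_0)
        then have "cf K e = 0" unfolding e 4(1) by (rule res)
        then show ?thesis unfolding e cf_add A R Ld using 4 by (simp add: cf_mono)
      qed
    qed
  qed
  then show ?thesis unfolding one by blast
qed

section \<open>Conjugation to the normal form\<close>

context param_subst
begin

lemma sub_shift:
  assumes "\<And>e. cf f (k, l, e) = cf g (0, 0, e)" shows "cf (sub f) (k, l, e) = cf (sub g) (0, 0, e)"
  using assms by (cases e) (simp add: cf_sub)

text \<open>Substitution modulo the first parameter: if \<open>g1\<close> vanishes there, terms of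
  \<open>f\<close> containing the first parameter contribute nothing, so \<open>f\<close> and
  \<open>g\<close> need to be compared only modulo it.\<close>

lemma sub_shift0:
  assumes "\<And>q r. cf f (k, l, 0, q, r) = cf g (0, 0, 0, q, r)" and g1: "\<And>q r. cf g1 (0, 0, 0, q, r) = 0"
  shows "cf (sub f) (k, l, 0, b, c) = cf (sub g) (0, 0, 0, b, c)"
proof -
  have "cf (gm (Suc p) q r) (0, 0, 0, b, c) = 0" for p q r
  proof -
    have "gm (Suc p) q r = g1 * gm p q r" by (simp add: gm_def)
    then show ?thesis by (simp add: cf_mult g1)
  qed
  then have eq: "cf f (k, l, p, q, r) * cf (gm p q r) (0, 0, 0, b, c) = cf g (0, 0, p, q, r)
      * cf (gm p q r) (0, 0, 0, b, c)" for p q r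
    using assms by (cases p) auto
  show ?thesis unfolding cf_sub by (simp only: eq)
qed

lemma sub_const_coeff: "cf (sub f) (k, l, 0, 0, 0) = cf f (k, l, 0, 0, 0)"
  by (simp add: cf_sub gm_def cf_1)

end

lemma z_of_bounded_linear: "bounded_linear z_of"
proof (intro bounded_linearI' )
  fix x y :: "real^2" and r :: real
  show "z_of (x + y) = z_of x + z_of y"
    by (simp add: z_of_def complex_eq_iff add_divide_distrib)
  show "z_of (r *\<^sub>R x) = r *\<^sub>R z_of x"
    by (simp add: z_of_def complex_eq_iff)
qed

lemma T_eventually:
  assumes "\<forall>\<^sub>F x in nhds 0. f x = (g x :: complex)"
  shows "T (\<lambda>w. f (snd (fst w))) = T (\<lambda>w. g (snd (fst w)))"
proof -
  obtain N where N: "open N" "0 \<in> N" "\<And>x. x \<in> N \<Longrightarrow> f x = g x"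
    using assms unfolding eventually_nhds by blast
  have K: "bounded_linear (\<lambda>w :: point. snd (fst w))"
    by (intro bounded_linear_compose[OF bounded_linear_snd] bounded_linear_fst)
  show ?thesis by (rule T_cong[OF open_vimage_bl[OF K N(1)]]) (use N in auto)
qed

lemma cf_takens_ham:
  assumes "takens_coeffs n h"
  shows "cf (takens_ham h) (k, l, m, b, c) = cf (T (\<lambda>w. h k l m (snd (fst w)))) (0, 0, 0, b, c)"
proof -
  obtain U where U: "smooth_on U (h k l m)" "0 \<in> U"
    using assms unfolding takens_coeffs_def smooth_near_0_iff by blast
  have "cf (takens_ham h) (k, l, m, b, c) = fps_nth (fps_nth (taylor_series2 (h k l m)) b) c"
    by (simp only: cf_simp takens_ham_def fps_nth_Abs_fps)
  then show ?thesis by (simp add: cf_T_taylor2[OF U])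
qed

text \<open>The conditions in \<open>takens_coeffs\<close> hold near 0 only, which suffices because
  Taylor coefficients depend on germs.\<close>

lemma takens_ham_cases:
  assumes h: "takens_coeffs n h"
  shows "\<not> (3 \<le> k + l + m \<and> k mod n = l mod n) \<Longrightarrow> cf (takens_ham h) (k, l, m, b, c) = 0"
    "cf (takens_ham h) (1, 1, m, b, c) = (if (m, b, c) = (1, 0, 0) then 1 else 0)"
    "cnj_series (takens_ham h) = takens_ham h"
    "cf (takens_ham h) (k, l, 0, 0, 0) = h k l 0 (0, 0)"
proof -
  note H = cf_takens_ham[OF h]
  have E: "\<forall>\<^sub>F \<mu> in nhds 0. (\<not> (3 \<le> k + l + m \<and> [k = l] (mod n)) \<longrightarrow> h k l m \<mu> = 0) \<and>
        h k l m \<mu> = cnj (h l k m \<mu>) \<and> h 1 1 m \<mu> = (if m = 1 then 1 else 0)" for k l m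
    using h unfolding takens_coeffs_def by blast
  have const: "T (\<lambda>w. x) = monom_series x (0, 0, 0, 0, 0)" for x
    by (simp add: T_const mono_eqs(1))
  show "cf (takens_ham h) (k, l, m, b, c) = 0" if *: "\<not> (3 \<le> k + l + m \<and> k mod n = l mod n)"
  proof -
    have "\<forall>\<^sub>F \<mu> in nhds 0. h k l m \<mu> = 0"
      using E[of k l m] by (rule eventually_mono) (use * in \<open>simp add: cong_def\<close>)
    then show ?thesis using T_eventually[of "h k l m" "\<lambda>_. 0"] by (simp add: H T_zero)
  qed
  show "cf (takens_ham h) (1, 1, m, b, c) = (if (m, b, c) = (1, 0, 0) then 1 else 0)"
  proof -
    have "\<forall>\<^sub>F \<mu> in nhds 0. h 1 1 m \<mu> = (if m = 1 then 1 else 0)"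
      using E[of 1 1 m] by (rule eventually_mono) blast
    then have "cf (takens_ham h) (1, 1, m, b, c) = cf (T (\<lambda>w. if m = 1 then 1 else 0)) (0, 0, 0, b, c)"
      using T_eventually[of "h 1 1 m" "\<lambda>_. if m = 1 then 1 else 0"] unfolding H by simp
    then show ?thesis unfolding const cf_mono by auto
  qed
  show "cnj_series (takens_ham h) = takens_ham h"
  proof (rule cf_eqI)
    fix e :: expo
    obtain k l m b c where e: "e = (k, l, m, b, c)" by (cases e)
    obtain U where U: "smooth_on U (h l k m)" "0 \<in> U"
      using h unfolding takens_coeffs_def smooth_near_0_iff by blast
    have K: "bounded_linear (\<lambda>w :: point. snd (fst w))"
      by (intro bounded_linear_compose[OF bounded_linear_snd] bounded_linear_fst)
    have "\<forall>\<^sub>F \<mu> in nhds 0. h k l m \<mu> = cnj (h l k m \<mu>)"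
      using E[of k l m] by (rule eventually_mono) blast
    then have "T (\<lambda>w. h k l m (snd (fst w))) = T (\<lambda>w. cnj (h l k m (snd (fst w))))"
      by (rule T_eventually)
    also have "\<dots> = cnj_series (T (\<lambda>w. h l k m (snd (fst w))))"
      by (rule T_cnj[OF _ smooth_on_compose_bl[OF K U(1)]]) (use U in simp)
    finally have eq: "T (\<lambda>w. h k l m (snd (fst w))) = cnj_series (T (\<lambda>w. h l k m (snd (fst w))))" .
    show "cf (cnj_series (takens_ham h)) e = cf (takens_ham h) e"
      unfolding e cf_cnj H eq ..
  qed
  show "cf (takens_ham h) (k, l, 0, 0, 0) = h k l 0 (0, 0)"
    unfolding H T_0 by (simp add: zero_prod_def)
qed

lemma ham_flow_param:
  assumes "ham_flow H \<Phi>" "is_param g" shows "ham_flow (H - g) \<Phi>"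
proof -
  have "deriv_zbar (H - g) = deriv_zbar H"
    using cadd_minus[OF cadd_deriv_zbar, of H g] deriv_param(2)[OF assms(2)] by simp
  then show ?thesis using assms(1) by (simp add: ham_flow_iff)
qed

lemma smooth_on_exp:
  assumes f: "smooth_on S f" shows "smooth_on S (\<lambda>x. exp (f x :: complex))"
proof -
  have d: "((\<lambda>x. exp (f x)) has_derivative (\<lambda>v. exp (f x) * dir_deriv v f x)) (at x)" if "x \<in> S" for x
    by (rule has_derivative_compose[OF has_derivative_dir[OF smooth_onD(3)[OF f that]]
        DERIV_exp[unfolded has_field_derivative_def]])
  note S = smooth_onD(1)[OF f]
  have "Ck_on k (\<lambda>x. exp (f x)) S" for k
  proof (induction k)
    case 0
    then show ?case using smooth_onD(2)[OF f, of 0] by (auto intro: continuous_intros)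
  next
    case (Suc k)
    have "Ck_on k (dir_deriv v (\<lambda>x. exp (f x))) S" for v
      by (subst Ck_on_cong[OF S, where g = "\<lambda>x. exp (f x) * dir_deriv v f x"])
        (auto intro!: Ck_on_mult S Suc smooth_onD(2)[OF smooth_on_dir_deriv[OF f]] dir_deriv_eq[OF d])
    then show ?case using d by (auto simp: differentiable_def)
  qed
  then show ?thesis using S by (simp add: smooth_on_def)
qed

text \<open>Rotation by an angle depending on the parameters: the conjugate factor inverts it, its
  Jacobian is \<open>E * cnj_series E\<close>, and plane rotations commute.\<close>

lemma flow_conjugate_rotation:
  assumes N: "flow_conjugate a f H" and E: "is_param E" "E * cnj_series E = 1"
  shows "flow_conjugate a f (compose_series H (E * Z))"
proof (rule flow_conjugate_step[OF N])
  have Ec: "is_param (cnj_series E)"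
    using E(1) by (auto simp: is_param_iff cf_cnj)
  have fo: "fixes_origin (E * Z)" "fixes_origin (cnj_series E * Z)"
    using fixes_origin_Z by (simp_all add: fixes_origin_Fil Fil_mult_left)
  show invariant: "inverse_change (E * Z) (cnj_series E * Z)"
    unfolding inverse_change_def
  proof (intro conjI fo)
    show "compose_series (E * Z) (cnj_series E * Z) = Z"
      by (simp only: compose_param[OF fo(2) E(1)] compose_basic(1)[OF fo(2)] mult.assoc[symmetric]
          E(2) mult_1_left)
    have "cnj_series E * E = 1" using E(2) by (simp only: mult.commute)
    then show "compose_series (cnj_series E * Z) (E * Z) = Z"
      by (simp only: compose_param[OF fo(1) Ec] compose_basic(1)[OF fo(1)] mult.assoc[symmetric]
          mult_1_left)
  qed
  have "bracket (E * Z) (cnj_series (E * Z)) = E * cnj_series E * bracket Z Zbar"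
    by (simp add: cnj_mult bracket_mult bracket_mult' bracket_param E Ec algebra_simps)
  then show "canonical_change (E * Z)"
    using invariant E(2) by (auto simp: canonical_change_iff bracket_Z)
  have fl: "fixes_origin (const_series (cis a) * Z)" using fixes_origin_Z
      by (simp add: fixes_origin_Fil Fil_const)
  have "compose_series (cnj_series E * Z) (const_series (cis a) * Z) = cnj_series E
      * (const_series (cis a) * Z)"
    by (simp only: compose_param[OF fl Ec] compose_basic(1)[OF fl])
  then show "compose_series (cnj_series E * Z) (const_series (cis a) * Z) = const_series (cis a)
      * (cnj_series E * Z)"
    by (simp only: mult.left_commute)
qed

lemma eventually_filterlim_nhds:
  assumes "\<forall>\<^sub>F y in nhds 0. P y" "isCont M 0" "M 0 = 0"
  shows "\<forall>\<^sub>F x in nhds 0. P (M x)"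
proof -
  have "(M \<longlongrightarrow> M 0) (nhds 0)" using assms(2) by (simp add: isCont_def tendsto_at_iff_tendsto_nhds)
  then show ?thesis using assms(1,3) unfolding filterlim_iff by simp
qed

theorem theorem4:
  fixes F :: "real \<times> real \<times> real \<Rightarrow> real^2 \<Rightarrow> real^2"
    and \<alpha> :: "real \<times> real \<times> real \<Rightarrow> real"
    and n :: nat
    and \<mu>\<^sub>3 :: "real \<times> real \<times> real \<Rightarrow> real"
    and h :: "nat \<Rightarrow> nat \<Rightarrow> nat \<Rightarrow> real \<times> real \<Rightarrow> complex"
    and \<theta> :: "real \<times> real \<Rightarrow> real"
    and \<nu> :: "real \<times> real \<Rightarrow> complex"
    and M :: "real \<times> real \<times> real \<Rightarrow> real \<times> real \<times> real"
  assumes "area_preserving_family F"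
    and "elliptic_at_0 F \<alpha>"
    and "resonant_of_order n (cis (\<alpha> 0))"
    and "param_change (\<lambda>(m1, m2, m3). (\<alpha> 0 - \<alpha> (m1, m2, m3), m1, m2))
           (\<lambda>(\<epsilon>, m1, m2). (m1, m2, \<mu>\<^sub>3 (\<epsilon>, m1, m2)))"
    and "takens_normal_form n (\<alpha> 0)
           (map_series (\<lambda>(\<epsilon>, m1, m2). F (m1, m2, \<mu>\<^sub>3 (\<epsilon>, m1, m2)))) h"
    and "h 2 2 0 (0, 0) \<noteq> 0"
    and "h n 0 0 (0, 0) = 0"
    and "(h (n + 1) 1 0 (0, 0))\<^sup>2 - 4 * h 2 2 0 (0, 0) * h (2 * n) 0 0 (0, 0) \<noteq> 0"
    and "arg_branch (resonance_discriminant n h) \<theta>"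
    and "\<And>m. \<nu> m = h n 0 0 m * exp (- (\<i> / 2) * of_real (\<theta> m))"
    and "param_change
           (\<lambda>(m1, m2, m3). (\<alpha> 0 - \<alpha> (m1, m2, m3), Re (\<nu> (m1, m2)), Im (\<nu> (m1, m2)))) M"
  shows "\<exists>H \<Phi> u. \<exists>a c \<psi> :: nat \<Rightarrow> nat \<Rightarrow> nat \<Rightarrow> nat \<Rightarrow> real.
     real_series H \<and> ham_flow H \<Phi> \<and> canonical_change u \<and>
     conjugates u (map_series (\<lambda>\<Upsilon>. F (M \<Upsilon>))) (rotate_map (\<alpha> 0) (\<Phi> 1)) \<and>
     H = param_monom 1 0 0 * I_pow 1
       + leading_resonant_term n
       + I_pow 2 * series_sum
           (\<lambda>(k, m1, m2, m3). const_series (of_real (a k m1 m2 m3)) * I_pow k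
              * param_monom m1 m2 m3) UNIV
       + series_sum
           (\<lambda>(k, m1, m2, m3). const_series (of_real (c k m1 m2 m3)) * param_monom m1 m2 m3
              * I_cos ((k + 1) * n) ((k + 1) * n) (\<psi> k m1 m2 m3)) {(k, m1, m2, m3). 1 \<le> k + m1}"
proof -
  define Q where "Q = (\<lambda>(\<epsilon>, m1, m2). (m1, m2, \<mu>\<^sub>3 (\<epsilon>, m1, m2)))"
  \<comment> \<open>From Upsilon to (epsilon, mu_1, mu_2), the parameters of the Takens normal form;
    \<open>Q\<close> then restores mu_3.\<close>
  define \<psi> :: "params \<Rightarrow> params" where "\<psi> \<Upsilon> = (fst \<Upsilon>, fst (M \<Upsilon>), fst (snd (M \<Upsilon>)))" for \<Upsilon>
  define G where "G = (\<lambda>w :: point. z_of (F (Q (fst w)) (snd w)))"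

  \<comment> \<open>A root of unity of order 1 or 2 is real, contrary to ellipticity.\<close>
  have n3: "3 \<le> n"
  proof -
    have "cis (\<alpha> 0) \<notin> \<real>"
      using eventually_nhds_x_imp_x assms(2) unfolding elliptic_at_0_def by blast
    moreover have "cis (\<alpha> 0) \<in> \<real>" if "n = 1 \<or> n = 2"
    proof -
      have "(cis (\<alpha> 0))\<^sup>2 = 1" using that assms(3) by (auto simp: resonant_of_order_def)
      then have "cis (\<alpha> 0) = 1 \<or> cis (\<alpha> 0) = -1" by (simp add: power2_eq_1_iff)
      then show ?thesis by auto
    qed
    ultimately show ?thesis using assms(3) by (cases "n = 1 \<or> n = 2") (auto simp: resonant_of_order_def)
  qed

  have Q: "Q 0 = 0" "smooth_near_0 Q" "\<forall>\<^sub>F \<mu> in nhds 0. Q (\<alpha> 0 - \<alpha> \<mu>, fst \<mu>, fst (snd \<mu>)) = \<mu>"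
    using assms(4) unfolding param_change_def Q_def by (simp_all add: case_prod_beta)
  have M: "M 0 = 0" "smooth_near_0 M"
    "\<forall>\<^sub>F \<Upsilon> in nhds 0. (\<alpha> 0 - \<alpha> (M \<Upsilon>), Re (\<nu> (fst (M \<Upsilon>), fst (snd (M \<Upsilon>)))), Im (\<nu> (fst (M \<Upsilon>),
        fst (snd (M \<Upsilon>))))) = \<Upsilon>"
    using assms(11) unfolding param_change_def by (simp_all add: case_prod_beta)
  obtain UM where UM: "smooth_on UM M" "0 \<in> UM" using M(2) by (auto simp: smooth_near_0_iff)
  obtain UQ where UQ: "smooth_on UQ Q" "0 \<in> UQ" using Q(2) by (auto simp: smooth_near_0_iff)
  have cM: "isCont M 0" using smooth_onD(3)[OF UM] by (rule differentiable_imp_continuous_within)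
  have cQ: "isCont Q 0" using smooth_onD(3)[OF UQ] by (rule differentiable_imp_continuous_within)

  \<comment> \<open>The first component of Upsilon is epsilon at the point M(Upsilon), which is also
    the first argument of \<open>Q\<close>; so the two inverse parameter changes fit
    together.\<close>
  have psi_M: "\<forall>\<^sub>F \<Upsilon> in nhds 0. Q (\<psi> \<Upsilon>) = M \<Upsilon> \<and> \<nu> (snd (\<psi> \<Upsilon>)) = Complex (fst (snd \<Upsilon>)) (snd (snd \<Upsilon>))"
    using eventually_filterlim_nhds[OF Q(3) cM M(1)] M(3)
    by eventually_elim (auto simp: \<psi>_def complex_eq_iff prod_eq_iff)
  have psi: "smooth_on UM \<psi>"
  proof -
    have "smooth_on UM (\<lambda>\<Upsilon>. (fst \<Upsilon> :: real, 0 :: real, 0 :: real))"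
      by (intro smooth_on_linear smooth_onD(1)[OF UM(1)] bounded_linear_Pair bounded_linear_fst
          bounded_linear_zero)
    moreover have "smooth_on UM (\<lambda>\<Upsilon>. (0 :: real, fst (M \<Upsilon>), fst (snd (M \<Upsilon>))))"
      by (rule smooth_on_linear_comp[OF _ UM(1)])
        (intro bounded_linear_Pair bounded_linear_fst bounded_linear_zero bounded_linear_compose[OF
            bounded_linear_fst] bounded_linear_snd)
    ultimately have "smooth_on UM (\<lambda>\<Upsilon>. (fst \<Upsilon>, 0, 0) + (0, fst (M \<Upsilon>), fst (snd (M \<Upsilon>))))"
      by (rule smooth_on_add)
    then show ?thesis by (simp add: \<psi>_def[abs_def])
  qed
  have psi0: "\<psi> 0 = 0" using M(1) by (simp add: \<psi>_def flip: zero_prod_def)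

  obtain SF where SF: "smooth_on SF (\<lambda>(\<mu>, x). F \<mu> x)" "0 \<in> SF"
    using assms(1) by (auto simp: area_preserving_family_def smooth_near_0_iff)
  obtain S where S: "0 \<in> S" "smooth_on S G"
  proof -
    obtain S where S: "0 \<in> S" "(\<lambda>w. (Q (fst w), snd w)) ` S \<subseteq> SF"
        "smooth_on S (\<lambda>w :: point. (Q (fst w), snd w))"
      using reparam_domain[OF UQ Q(1) smooth_onD(1)[OF SF(1)] SF(2)] by blast
    have "smooth_on S (\<lambda>w. (\<lambda>(\<mu>, x). F \<mu> x) (Q (fst w), snd w))"
      by (rule smooth_on_compose[OF SF(1) S(3,2)])
    then have "smooth_on S G"
      unfolding G_def by (intro smooth_on_linear_comp[OF z_of_bounded_linear]) simp
    then show ?thesis using that S(1) by blast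
  qed

  have fixG: "fixes_origin (T G)"
  proof -
    have "\<forall>\<^sub>F \<mu> in nhds 0. F \<mu> 0 = 0"
      using assms(2) unfolding elliptic_at_0_def by (rule eventually_mono) blast
    then have "\<forall>\<^sub>F p in nhds 0. F (Q p) 0 = 0" by (rule eventually_filterlim_nhds[OF _ cQ Q(1)])
    then obtain N where N: "open N" "0 \<in> N" "\<And>p. p \<in> N \<Longrightarrow> F (Q p) 0 = 0"
      unfolding eventually_nhds by blast
    define S' where "S' = S \<inter> {w. fst w \<in> N}"
    have oS': "open S'" unfolding S'_def using smooth_onD(1)[OF S(2)] open_vimage_bl[OF bl_fst N(1)]
        by blast
    have "cf (T G) (0, 0, a, b, c) = 0" for a b c
    proof (rule T_vanish)
      show "smooth_on S' G" using S(2) oS' by (rule smooth_on_subset) (simp add: S'_def)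
      show "0 \<in> S'" using S(1) N(2) by (simp add: S'_def)
      fix \<mu> assume "(\<mu>, 0) \<in> S'"
      then show "G (\<mu>, 0) = 0" using N(3)[of \<mu>] by (simp add: S'_def G_def z_of_def complex_eq_iff)
    qed
    then show ?thesis unfolding fixes_origin_def fps_eq_iff by (simp add: cf_simp)
  qed

  have mapG: "map_series (\<lambda>(\<epsilon>, m1, m2). F (m1, m2, \<mu>\<^sub>3 (\<epsilon>, m1, m2))) = T G"
    by (simp add: map_series_def G_def Q_def case_prod_unfold)
  define H where "H = takens_ham h"
  \<comment> \<open>Removes the terms free of z and zbar, which the target form does not
    contain.\<close>
  define H0 where "H0 = H - lift (zcoeff H 0 0)"
  have tk: "takens_coeffs n h" using assms(5) by (simp add: takens_normal_form_def)
  note Hc = takens_ham_cases[OF tk, folded H_def]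
  have H0c: "cf H0 (k, l, e) = (if (k, l) = (0, 0) then 0 else cf H (k, l, e))" for k l e
    by (cases e) (auto simp: H0_def cf_lift, simp add: cf_simp)
  have fc0: "flow_conjugate (\<alpha> 0) (T G) H0"
  proof -
    obtain \<Phi> u where *: "ham_flow H \<Phi>" "canonical_change u"
        "conjugates u (T G) (rotate_map (\<alpha> 0) (\<Phi> 1))"
      using assms(5) unfolding takens_normal_form_def mapG H_def by blast
    have "ham_flow H0 \<Phi>" unfolding H0_def by (rule ham_flow_param[OF *(1) is_param_lift])
    moreover have "real_series H0"
      unfolding real_series_def
    proof (rule cf_eqI)
      fix e :: expo
      obtain k l e' where e: "e = (k, l, e')" by (cases e)
      have "cf H (k, l, e') = cnj (cf H (l, k, e'))"
        using cf_cnj[of H k l] Hc(3) by (cases e') simp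
      then show "cf (cnj_series H0) e = cf H0 e"
        by (cases e') (auto simp: e cf_cnj H0c)
    qed
    ultimately show ?thesis using * fixG unfolding flow_conjugate_def by blast
  qed

  interpret P: real_param_subst "T (\<lambda>w. coord 2 (\<psi> (fst w)))" "T (\<lambda>w. coord 3 (\<psi> (fst w)))"
      "T (\<lambda>w. coord 4 (\<psi> (fst w)))"
    by (rule param_subst_taylor[OF psi UM(2) psi0])
  \<comment> \<open>Epsilon belongs to both sets of parameters and is replaced by itself, so
    coefficients may be compared modulo epsilon before and after the substitution.\<close>
  have g1: "T (\<lambda>w. coord 2 (\<psi> (fst w))) = param_monom 1 0 0"
    using T_coord(1) by (simp add: coord_def \<psi>_def case_prod_beta)

  have mapM: "map_series (\<lambda>\<Upsilon>. F (M \<Upsilon>)) = P.sub (T G)"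
  proof -
    obtain N where N: "open N" "0 \<in> N" "\<And>\<Upsilon>. \<Upsilon> \<in> N \<Longrightarrow> Q (\<psi> \<Upsilon>) = M \<Upsilon>"
      using psi_M unfolding eventually_nhds by blast
    have "map_series (\<lambda>\<Upsilon>. F (M \<Upsilon>)) = T (\<lambda>w. z_of (F (M (fst w)) (snd w)))"
      by (simp add: map_series_def case_prod_unfold)
    also have "\<dots> = T (\<lambda>w. G (\<psi> (fst w), snd w))"
      by (rule T_cong[OF open_vimage_bl[OF bl_fst N(1)]]) (use N in \<open>auto simp: G_def\<close>)
    also have "\<dots> = P.sub (T G)" by (rule T_compose[OF psi UM(2) psi0 S(2,1)])
    finally show ?thesis .
  qed

  \<comment> \<open>Rotation adjusting the phase of the z^n term\<close>
  define e where "e m = exp (- \<i> * of_real (\<theta> m) / (2 * of_nat n))" for m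
  define E where "E = T (\<lambda>w. e (snd (\<psi> (fst w))))"
  obtain U\<theta> where Ut: "smooth_on U\<theta> \<theta>" "0 \<in> U\<theta>"
    using assms(9) by (auto simp: arg_branch_def smooth_near_0_iff)
  obtain Uh where Uh: "smooth_on Uh (h n 0 0)" "0 \<in> Uh"
    using tk unfolding takens_coeffs_def smooth_near_0_iff by blast
  have e_smooth: "smooth_on U\<theta> e"
    unfolding e_def
  proof (rule smooth_on_exp)
    have "smooth_on U\<theta> (\<lambda>m. complex_of_real (\<theta> m))"
        by (rule smooth_on_linear_comp[OF bounded_linear_of_real Ut(1)])
    then have "smooth_on U\<theta> (\<lambda>m. (- \<i> / (2 * of_nat n)) * complex_of_real (\<theta> m))"
      by (intro smooth_on_mult smooth_on_const smooth_onD(1)[OF Ut(1)])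
    then show "smooth_on U\<theta> (\<lambda>m. - \<i> * of_real (\<theta> m) / (2 * of_nat n))" by simp
  qed
  have psi_dom: "\<exists>V. open V \<and> 0 \<in> V \<and> smooth_on V (\<lambda>\<Upsilon>. f (snd (\<psi> \<Upsilon>)))"
    if f: "smooth_on U f" "0 \<in> U" for f :: "real \<times> real \<Rightarrow> complex" and U
  proof -
    have sp: "smooth_on UM (\<lambda>\<Upsilon>. snd (\<psi> \<Upsilon>))" by (rule smooth_on_linear_comp[OF bounded_linear_snd psi])
    have "open (UM \<inter> (\<lambda>\<Upsilon>. snd (\<psi> \<Upsilon>)) -` U)"
      using smooth_onD(2)[OF sp, of 0] smooth_onD(1)[OF UM(1)] smooth_onD(1)[OF f(1)]
      by (intro continuous_open_preimage) auto
    moreover from this have "smooth_on (UM \<inter> (\<lambda>\<Upsilon>. snd (\<psi> \<Upsilon>)) -` U) (\<lambda>\<Upsilon>. f (snd (\<psi> \<Upsilon>)))"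
      by (intro smooth_on_compose[OF f(1)] smooth_on_subset[OF sp]) auto
    moreover have "0 \<in> UM \<inter> (\<lambda>\<Upsilon>. snd (\<psi> \<Upsilon>)) -` U" using UM(2) psi0 f(2) by simp
    ultimately show ?thesis by blast
  qed
  obtain Ve where Ve: "0 \<in> Ve" "smooth_on Ve (\<lambda>\<Upsilon>. e (snd (\<psi> \<Upsilon>)))"
    using psi_dom[OF e_smooth Ut(2)] by blast
  obtain Vh where Vh: "0 \<in> Vh" "smooth_on Vh (\<lambda>\<Upsilon>. h n 0 0 (snd (\<psi> \<Upsilon>)))"
    using psi_dom[OF Uh] by blast
  have sE: "smooth_on {w :: point. fst w \<in> Ve} (\<lambda>w. e (snd (\<psi> (fst w))))"
    by (rule smooth_on_compose_bl[OF bl_fst Ve(2)])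
  have sH: "smooth_on {w :: point. fst w \<in> Vh} (\<lambda>w. h n 0 0 (snd (\<psi> (fst w))))"
    by (rule smooth_on_compose_bl[OF bl_fst Vh(2)])
  have Ep: "is_param E" unfolding E_def by (rule T_param[OF Ve(2,1)])
  have E1: "E * cnj_series E = 1"
  proof -
    have "E * cnj_series E = T (\<lambda>w. e (snd (\<psi> (fst w))) * cnj (e (snd (\<psi> (fst w)))))"
      unfolding E_def using Ve(1)
      by (simp add: T_mult[OF smooth_onD(1)[OF sE] _ sE smooth_on_cnj[OF sE]] T_cnj[OF _ sE])
    moreover have "e m * cnj (e m) = 1" for m
      by (simp add: e_def exp_cnj flip: exp_add)
    ultimately show ?thesis by (simp add: T_const)
  qed
  have fc1: "flow_conjugate (\<alpha> 0) (map_series (\<lambda>\<Upsilon>. F (M \<Upsilon>))) (compose_series (P.sub H0) (E * Z))"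
    unfolding mapM by (rule flow_conjugate_rotation[OF P.sub_flow_conjugate[OF fc0] Ep E1])

  define H1 where "H1 = compose_series (P.sub H0) (E * Z)"
  \<comment> \<open>As a parameter series, this is the factor multiplying z;
    \<open>\<epsilon>2\<close> is the one multiplying zbar.\<close>
  define \<epsilon>1 where "\<epsilon>1 = zcoeff E 0 0"
  define \<epsilon>2 where "\<epsilon>2 = zcoeff (cnj_series E) 0 0"
  have E_lift: "E = lift \<epsilon>1" using Ep by (simp add: is_param_def \<epsilon>1_def)
  have "is_param (cnj_series E)" using Ep by (auto simp: is_param_iff cf_cnj)
  then have E_lift': "lift \<epsilon>2 = cnj_series (lift \<epsilon>1)"
      by (simp add: is_param_def \<epsilon>2_def E_lift[symmetric])
  have e12: "\<epsilon>1 * \<epsilon>2 = 1"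
  proof -
    have "lift (\<epsilon>1 * \<epsilon>2) = 1" using E1 unfolding lift_mult E_lift' E_lift[symmetric] .
    then have "zcoeff (lift (\<epsilon>1 * \<epsilon>2)) 0 0 = zcoeff 1 0 0" by simp
    then show ?thesis by (simp add: lift_def)
  qed
  have H1z: "zcoeff H1 k l = zcoeff (P.sub H0) k l * \<epsilon>1 ^ k * \<epsilon>2 ^ l" for k l
    unfolding H1_def E_lift by (rule zcoeff_compose_scale[OF E_lift'])
  have H1zero: "cf H1 (k, l, x) = 0" if "\<And>x. cf H0 (k, l, x) = 0" for k l x
  proof -
    have "cf (P.sub H0) (k, l, x) = 0" for x using that by (cases x) (simp add: P.cf_sub)
    then have "zcoeff (P.sub H0) k l = 0" unfolding fps_eq_iff by (metis cf_simp fps_zero_nth)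
    then show ?thesis by (cases x) (simp add: cf_simp H1z)
  qed
  \<comment> \<open>Opposite phases cancel on powers of z zbar, so the coefficient of z zbar and the
    nonvanishing h_220 survive the rotation.\<close>
  have H1diag: "cf H1 (k, k, x) = cf (P.sub H0) (k, k, x)" for k x
  proof -
    have "\<epsilon>1 ^ k * \<epsilon>2 ^ k = 1" using e12 by (simp flip: power_mult_distrib)
    then have "zcoeff H1 k k = zcoeff (P.sub H0) k k" unfolding H1z by (simp add: mult.assoc)
    then show ?thesis by (cases x) (simp add: cf_simp)
  qed

  have lam: "cis (\<alpha> 0) * cnj (cis (\<alpha> 0)) = 1" by (simp add: cis_cnj cis_mult)
  interpret R: resonance n "cis (\<alpha> 0)"
    using assms(3) n3 lam by unfold_locales
  \<comment> \<open>At order 0 in epsilon only h_n00 enters the coefficient of z^n; rotated and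
    expressed in the new parameters it is nu_1 + i nu_2 exactly, not merely to first order.\<close>
  have H1n0: "cf H1 (n, 0, 0, b, c) = (if (b, c) = (1, 0) then 1 else if (b, c) = (0, 1) then \<i>
      else 0)" for b c
  proof -
    let ?P = "T (\<lambda>w. h n 0 0 (snd (fst w)))"
    have K: "bounded_linear (\<lambda>w :: point. snd (fst w))"
      by (intro bounded_linear_compose[OF bounded_linear_snd] bounded_linear_fst)
    have s: "cf (P.sub H0) (n, 0, 0, b, c) = cf (P.sub ?P) (0, 0, 0, b, c)" for b c
    proof (rule P.sub_shift0)
      show "cf H0 (n, 0, 0, q, r) = cf ?P (0, 0, 0, q, r)" for q r
        using n3 by (simp add: H0c H_def cf_takens_ham[OF tk])
      show "cf (T (\<lambda>w. coord 2 (\<psi> (fst w)))) (0, 0, 0, q, r) = 0" for q r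
        by (simp add: g1 mono_eqs(4) cf_mono)
    qed
    have P: "P.sub ?P = T (\<lambda>w. h n 0 0 (snd (\<psi> (fst w))))"
      using T_compose[OF psi UM(2) psi0 smooth_on_compose_bl[OF K Uh(1)]] Uh(2) by simp
    have "cf H1 (n, 0, 0, b, c) = cf (lift (zcoeff (P.sub H0) n 0) * E ^ n) (0, 0, 0, b, c)"
    proof -
      have "E ^ n = lift (\<epsilon>1 ^ n)" unfolding E_lift by (simp add: lift_def fps_const_power)
      then show ?thesis by (simp add: cf_simp H1z zcoeff_lift_mult) (simp add: lift_def)
    qed
    also have "\<dots> = cf (P.sub ?P * E ^ n) (0, 0, 0, b, c)"
    proof -
      have "cf (lift (zcoeff (P.sub H0) n 0)) (0, 0, 0, b, c) = cf (P.sub ?P) (0, 0, 0, b, c)" for b c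
        unfolding s[symmetric] by (simp add: cf_lift) (simp add: cf_simp)
      then show ?thesis by (simp add: cf_mult)
    qed
    also have "P.sub ?P * E ^ n = T (\<lambda>w. h n 0 0 (snd (\<psi> (fst w))) * e (snd (\<psi> (fst w))) ^ n)"
    proof -
      let ?S = "{w :: point. fst w \<in> Vh} \<inter> {w. fst w \<in> Ve}"
      have oS: "open ?S" using smooth_onD(1)[OF sE] smooth_onD(1)[OF sH] by blast
      have 0: "0 \<in> ?S" using Ve(1) Vh(1) by simp
      have s1: "smooth_on ?S (\<lambda>w. e (snd (\<psi> (fst w))))" by (rule smooth_on_subset[OF sE oS]) simp
      have s2: "smooth_on ?S (\<lambda>w. h n 0 0 (snd (\<psi> (fst w))))" by (rule smooth_on_subset[OF sH oS]) simp
      show ?thesis unfolding P E_def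
        by (simp only: T_mult[OF oS 0 s2 T_power(1)[OF 0 s1]] T_power(2)[OF 0 s1])
    qed
    also have "\<dots> = T (\<lambda>w. coord 3 (fst w) + \<i> * coord 4 (fst w))"
    proof -
      obtain N where N: "open N" "0 \<in> N" "\<And>\<Upsilon>. \<Upsilon> \<in> N \<Longrightarrow> \<nu> (snd (\<psi> \<Upsilon>))
          = Complex (fst (snd \<Upsilon>)) (snd (snd \<Upsilon>))"
        using psi_M unfolding eventually_nhds by blast
      \<comment> \<open>The angle in \<open>e\<close> was divided by 2 n so that its n-th power is
        the factor exp(-i theta/2) in nu.\<close>
      have "h n 0 0 m * e m ^ n = \<nu> m" for m
        using n3 by (simp add: e_def assms(10) exp_of_nat_mult[symmetric])
      then show ?thesis
        by (intro T_cong[OF open_vimage_bl[OF bl_fst N(1)]])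
          (use N in \<open>auto simp: coord_def case_prod_beta complex_eq_iff\<close>)
    qed
    also have "\<dots> = param_monom 0 1 0 + const_series \<i> * param_monom 0 0 1"
    proof -
      have sp: "smooth_on UNIV (\<lambda>w :: point. coord j (fst w))" for j
        by (intro smooth_on_linear bounded_linear_compose[OF bl_coord bl_fst]) simp
      have "smooth_on UNIV (\<lambda>w :: point. \<i> * coord 4 (fst w))"
        by (intro smooth_on_mult smooth_on_const sp) simp
      then show ?thesis
        by (simp add: T_add[OF open_UNIV _ sp] T_mult[OF open_UNIV _ smooth_on_const sp] T_const
            T_coord)
    qed
    finally show ?thesis by (auto simp: mono_eqs(4) cf_mono)
  qed
  interpret N: quartic_hamiltonian n "cis (\<alpha> 0)" H1
  proof unfold_locales
    show "R.invariant H1"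
      unfolding R.invariant_iff
    proof (intro allI impI)
      fix k l x assume "k mod n \<noteq> l mod n"
      then have "cf H0 (k, l, x) = 0" for x by (cases x) (simp add: H0c Hc(1))
      then show "cf H1 (k, l, x) = 0" by (rule H1zero)
    qed
    show "cnj_series H1 = H1" using fc1 by (simp add: flow_conjugate_def real_series_def H1_def)
    show "cf H1 (0, 0, x) = 0" for x by (rule H1zero) (simp add: H0c)
    show "cf H1 (1, 1, x) = (if x = (1, 0, 0) then 1 else 0)" for x
    proof -
      have "cf H1 (1, 1, x) = cf (P.sub (param_monom 1 0 0)) (0, 0, x)"
        unfolding H1diag
      proof (rule P.sub_shift)
        fix y show "cf H0 (1, 1, y) = cf (param_monom 1 0 0) (0, 0, y)"
          by (cases y) (use Hc(2) in \<open>auto simp: H0c mono_eqs(4) cf_mono\<close>)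
      qed
      also have "P.sub (param_monom 1 0 0) = param_monom 1 0 0"
        unfolding P.sub_param_monom P.gm_def by (simp add: g1)
      finally show ?thesis by (auto simp: mono_eqs(4) cf_mono)
    qed
    show "cf H1 (2, 2, 0, 0, 0) \<noteq> 0"
      using assms(6) Hc(4)[of 2 2] by (simp add: H1diag P.sub_const_coeff H0c)
    show "cf H1 (n, 0, 0, 0, 0) = 0" by (simp add: H1n0)
  qed
  define K where "K = compose_series H1 N.w"
  have fc2: "flow_conjugate (\<alpha> 0) (map_series (\<lambda>\<Upsilon>. F (M \<Upsilon>))) K"
    unfolding K_def by (rule flow_conjugate_step[OF fc1[folded H1_def] N.canonical_w N.inverse_w
        N.v_rot])
  have "\<exists>a c \<psi>. K = param_monom 1 0 0 * I_pow 1
       + leading_resonant_term n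
       + I_pow 2 * series_sum
           (\<lambda>(k, m1, m2, m3). const_series (of_real (a k m1 m2 m3)) * I_pow k
              * param_monom m1 m2 m3) UNIV
       + series_sum
           (\<lambda>(k, m1, m2, m3). const_series (of_real (c k m1 m2 m3)) * param_monom m1 m2 m3
              * I_cos ((k + 1) * n) ((k + 1) * n) (\<psi> k m1 m2 m3)) {(k, m1, m2, m3). 1 \<le> k + m1}"
  proof (rule polar_normal_form[OF n3])
    show "cnj_series K = K" using fc2 by (simp add: flow_conjugate_def real_series_def)
    show "cf K (k, l, x) = 0" if "k mod n \<noteq> l mod n" for k l x
    proof -
      \<comment> \<open>The normalizing change commutes with the rotation, so the normalized
        Hamiltonian inherits the invariance of \<open>H1\<close>.\<close>
      have rw: "compose_series R.rot N.w = const_series (cis (\<alpha> 0)) * N.w"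
        by (simp only: compose_const_mult compose_basic(1)[OF N.fixes_origin_w])
      have "compose_series K R.rot = compose_series H1 (const_series (cis (\<alpha> 0)) * N.w)"
        unfolding K_def compose_assoc[OF R.fixes_origin_rot N.fixes_origin_w] N.w_rot ..
      also have "\<dots> = compose_series (compose_series H1 R.rot) N.w"
        unfolding compose_assoc[OF N.fixes_origin_w R.fixes_origin_rot] rw ..
      also have "\<dots> = K" using N.H_invariant unfolding R.invariant_def K_def by simp
      finally have "R.invariant K" unfolding R.invariant_def .
      then show ?thesis using that unfolding R.invariant_iff by blast
    qed
    show "cf K (Suc k, Suc l, x) = 0" if "k \<noteq> l" for k l x
      unfolding K_def by (rule N.normal_form[OF that])
    show "cf K (0, 0, x) = 0" for x
      unfolding K_def by (subst N.normal_form_unchanged) (use N.H00 in \<open>cases x, auto\<close>)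
    show "cf K (1, 1, x) = (if x = (1, 0, 0) then 1 else 0)" for x
      unfolding K_def by (subst N.normal_form_unchanged) (cases x, simp, rule N.H11)
    show "cf K (n, 0, 0, b, c) = (if (b, c) = (1, 0) then 1 else if (b, c) = (0, 1) then \<i> else 0)"
        for b c
      unfolding K_def by (subst N.normal_form_unchanged) (auto simp: H1n0)
  qed
  then show ?thesis using fc2 unfolding flow_conjugate_def by blast
qed

end
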